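(* When parameterized by the neighborhood diversity $k$ of the input graph, Enum Minimal MC admits a fully-polynomial enumeration kernel, and Enum MC and Enum Maximal MC admit polynomial-delay enumeration kernels, each with at most $3k$ vertices.
   Context: A module of $G$ is a set $U\subseteq V(G)$ such that every vertex outside $U$ is adjacent either to all or to none of $U$. A neighborhood decomposition is a partition of $V(G)$ into modules each of which is a clique or an independent set; the neighborhood diversity ${\sf nd}(G)$ is the minimum number of parts of such a decomposition. A matching cut of $G$ is a (possibly empty) edge set $M$ that is a matching and equals $E(A,B)$ (edges between $A$ and $B$) for some partition $\{A,B\}$ of $V(G)$; minimal/maximal are w.r.t. inclusion among matching cuts. Enum MC / Enum Minimal MC / Enum Maximal MC: list all / all minimal / all maximal matching cuts without repetition. For a parameterized enumeration problem (instances $x$, solutions $\mathsf{Sol}(x)$, parameter $\kappa(x)$): a fully-polynomial enumeration kernel is a pair of algorithms $\mathcal A,\mathcal A'$ where $\mathcal A$ computes in time polynomial in $|x|+\kappa(x)$ an instance $y$ with $|y|+\kappa(y)\le f(\kappa(x))$ ($f$ computable), and for each $s\in\mathsf{Sol}(y)$, $\mathcal A'$ computes in time polynomial in $|x|+|y|+\kappa(x)+\kappa(y)$ a nonempty $S_s\subseteq\mathsf{Sol}(x)$ such that $\{S_s\}_{s\in\mathsf{Sol}(y)}$ partitions $\mathsf{Sol}(x)$; a polynomial-delay enumeration kernel is the same except that $\mathcal A'$ enumerates $S_s$ with delay polynomial in $|x|+|y|+\kappa(x)+\kappa(y)$. *)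

theory Defs
  imports Main "HOL-Library.Disjoint_Sets" "HOL-Computational_Algebra.Polynomial"
begin

section \<open>Model of computation\<close>

text \<open>
  Algorithms are programs of a first-order functional language over binary trees with general
  recursion.  A program is a list of function bodies; every function has one argument, function 0
  is the entry point, and variables are de Bruijn indices.  Completing the evaluation of any
  subexpression costs one plus the size of its value.  The number of steps as well as the size of
  every value occurring in a run are therefore bounded by the cost of the run, and the model is
  polynomially equivalent to Turing machines (also for computing functions).
  The expression \<open>Emit e\<close> outputs one item of an enumeration.
\<close>

datatype data = Leaf | Pair data data

datatype expr =
    Var nat
  | LeafE
  | PairE expr expr
  | LeftE expr
  | RightE expr
  | IfE expr expr expr
  | LetE expr expr
  | Call nat expr
  | Emit expr

type_synonym program = "expr list"

datatype event = Work nat | Out data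

fun left :: "data \<Rightarrow> data" where
  "left Leaf = Leaf"
| "left (Pair a b) = a"

fun right :: "data \<Rightarrow> data" where
  "right Leaf = Leaf"
| "right (Pair a b) = b"

definition charge :: "data \<Rightarrow> event" where
  "charge v = Work (size v + 1)"

inductive eval :: "program \<Rightarrow> data list \<Rightarrow> expr \<Rightarrow> data \<Rightarrow> event list \<Rightarrow> bool"
  for P :: program where
  Var: "i < length env \<Longrightarrow> eval P env (Var i) (env ! i) [charge (env ! i)]"
| LeafE: "eval P env LeafE Leaf [charge Leaf]"
| PairE: "eval P env a v tr \<Longrightarrow> eval P env b w tr' \<Longrightarrow>
    eval P env (PairE a b) (Pair v w) (tr @ tr' @ [charge (Pair v w)])"
| LeftE: "eval P env a v tr \<Longrightarrow> eval P env (LeftE a) (left v) (tr @ [charge (left v)])"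
| RightE: "eval P env a v tr \<Longrightarrow> eval P env (RightE a) (right v) (tr @ [charge (right v)])"
| IfTrue: "eval P env a v tr \<Longrightarrow> v \<noteq> Leaf \<Longrightarrow> eval P env b w tr' \<Longrightarrow>
    eval P env (IfE a b c) w (tr @ tr' @ [charge w])"
| IfFalse: "eval P env a Leaf tr \<Longrightarrow> eval P env c w tr' \<Longrightarrow>
    eval P env (IfE a b c) w (tr @ tr' @ [charge w])"
| LetE: "eval P env a v tr \<Longrightarrow> eval P (v # env) b w tr' \<Longrightarrow>
    eval P env (LetE a b) w (tr @ tr' @ [charge w])"
| Call: "eval P env a v tr \<Longrightarrow> f < length P \<Longrightarrow> eval P [v] (P ! f) w tr' \<Longrightarrow>
    eval P env (Call f a) w (tr @ tr' @ [charge w])"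
| Emit: "eval P env a v tr \<Longrightarrow> eval P env (Emit a) Leaf (tr @ [Out v, charge Leaf])"

lemma eval_deterministic:
  "eval P env e v tr \<Longrightarrow> eval P env e v' tr' \<Longrightarrow> v = v' \<and> tr = tr'"
proof (induction arbitrary: v' tr' rule: eval.induct)
  case Var from Var.prems show ?case by cases auto
next
  case LeafE from LeafE.prems show ?case by cases auto
next
  case PairE from PairE.prems show ?case by cases (use PairE.IH in blast)
next
  case LeftE from LeftE.prems show ?case by cases (use LeftE.IH in blast)
next
  case RightE from RightE.prems show ?case by cases (use RightE.IH in blast)
next
  case IfTrue from IfTrue.prems show ?case
    by cases (use IfTrue.IH IfTrue.hyps in blast)+
next
  case IfFalse from IfFalse.prems show ?case by cases (use IfFalse.IH in blast)+
next
  case LetE from LetE.prems show ?case by cases (use LetE.IH in blast)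
next
  case Call from Call.prems show ?case by cases (use Call.IH in blast)
next
  case Emit from Emit.prems show ?case by cases (use Emit.IH in blast)
qed

definition runs :: "program \<Rightarrow> data \<Rightarrow> data \<Rightarrow> event list \<Rightarrow> bool" where
  "runs P inp res tr \<longleftrightarrow> eval P [inp] (Call 0 (Var 0)) res tr"

fun time :: "event list \<Rightarrow> nat" where
  "time [] = 0"
| "time (Work n # tr) = n + time tr"
| "time (Out v # tr) = time tr"

fun outputs :: "event list \<Rightarrow> data list" where
  "outputs [] = []"
| "outputs (Work n # tr) = outputs tr"
| "outputs (Out v # tr) = v # outputs tr"

text \<open>
  The segments \<open>ys\<close> below include those before the first and after the last output.
\<close>

definition delay_at_most :: "nat \<Rightarrow> event list \<Rightarrow> bool" where
  "delay_at_most d tr \<longleftrightarrow>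
    (\<forall>xs ys zs. tr = xs @ ys @ zs \<and> outputs ys = [] \<longrightarrow> time ys \<le> d)"

fun enc_list :: "data list \<Rightarrow> data" where
  "enc_list [] = Leaf"
| "enc_list (v # vs) = Pair v (enc_list vs)"

definition enc_bool :: "bool \<Rightarrow> data" where
  "enc_bool b = (if b then Pair Leaf Leaf else Leaf)"

definition enc_nat :: "nat \<Rightarrow> data" where
  "enc_nat n = enc_list (replicate n Leaf)"

definition computable :: "(nat \<Rightarrow> nat) \<Rightarrow> bool" where
  "computable f \<longleftrightarrow> (\<exists>P. \<forall>n. \<exists>tr. runs P (enc_nat n) (enc_nat (f n)) tr)"


section \<open>Parameterized enumeration problems and their kernels\<close>

text \<open>
  The encoding of a solution may refer to the instance it belongs to.
\<close>

record ('x, 's) enum_problem =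
  instances :: "'x set"
  Sol :: "'x \<Rightarrow> 's set"
  param :: "'x \<Rightarrow> nat"
  enc_inst :: "'x \<Rightarrow> data"
  enc_sol :: "'x \<Rightarrow> 's \<Rightarrow> data"

definition inst_size :: "('x, 's) enum_problem \<Rightarrow> 'x \<Rightarrow> nat" where
  "inst_size Q x = size (enc_inst Q x)"

text \<open>
  In the following \<open>K\<close> is the function on instances that is computed by the program \<open>A\<close>.
\<close>

definition kernelization ::
  "('x, 's) enum_problem \<Rightarrow> program \<Rightarrow> ('x \<Rightarrow> 'x) \<Rightarrow> bool" where
  "kernelization Q A K \<longleftrightarrow>
    (\<forall>x\<in>instances Q. K x \<in> instances Q) \<and>
    (\<exists>p :: nat poly. \<forall>x\<in>instances Q. \<exists>tr.
       runs A (enc_inst Q x) (enc_inst Q (K x)) tr \<and>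
       time tr \<le> poly p (inst_size Q x + param Q x)) \<and>
    (\<exists>f. computable f \<and>
       (\<forall>x\<in>instances Q. inst_size Q (K x) + param Q (K x) \<le> f (param Q x)))"

definition solution_partition ::
  "('x, 's) enum_problem \<Rightarrow> 'x \<Rightarrow> 'x \<Rightarrow> ('s \<Rightarrow> 's set) \<Rightarrow> bool" where
  "solution_partition Q x y S \<longleftrightarrow>
    (\<forall>s\<in>Sol Q y. S s \<noteq> {}) \<and>
    disjoint_family_on S (Sol Q y) \<and>
    (\<Union>s\<in>Sol Q y. S s) = Sol Q x"

definition lift_input :: "('x, 's) enum_problem \<Rightarrow> 'x \<Rightarrow> 'x \<Rightarrow> 's \<Rightarrow> data" where
  "lift_input Q x y s = Pair (enc_inst Q x) (Pair (enc_inst Q y) (enc_sol Q y s))"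

definition lift_size :: "('x, 's) enum_problem \<Rightarrow> 'x \<Rightarrow> 'x \<Rightarrow> nat" where
  "lift_size Q x y = inst_size Q x + inst_size Q y + param Q x + param Q y"

definition fully_polynomial_enum_kernel ::
  "('x, 's) enum_problem \<Rightarrow> program \<Rightarrow> program \<Rightarrow> ('x \<Rightarrow> 'x) \<Rightarrow> bool" where
  "fully_polynomial_enum_kernel Q A A' K \<longleftrightarrow>
    kernelization Q A K \<and>
    (\<exists>p :: nat poly. \<forall>x\<in>instances Q. \<exists>S.
       solution_partition Q x (K x) S \<and>
       (\<forall>s\<in>Sol Q (K x). \<exists>zs tr.
          distinct zs \<and> set zs = S s \<and>
          runs A' (lift_input Q x (K x) s) (enc_list (map (enc_sol Q x) zs)) tr \<and>
          time tr \<le> poly p (lift_size Q x (K x))))"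

definition polynomial_delay_enum_kernel ::
  "('x, 's) enum_problem \<Rightarrow> program \<Rightarrow> program \<Rightarrow> ('x \<Rightarrow> 'x) \<Rightarrow> bool" where
  "polynomial_delay_enum_kernel Q A A' K \<longleftrightarrow>
    kernelization Q A K \<and>
    (\<exists>p :: nat poly. \<forall>x\<in>instances Q. \<exists>S.
       solution_partition Q x (K x) S \<and>
       (\<forall>s\<in>Sol Q (K x). \<exists>zs res tr.
          distinct zs \<and> set zs = S s \<and>
          runs A' (lift_input Q x (K x) s) res tr \<and>
          outputs tr = map (enc_sol Q x) zs \<and>
          delay_at_most (poly p (lift_size Q x (K x))) tr))"


section \<open>Neighborhood diversity and matching cuts\<close>

definition simple_graph :: "'a set \<Rightarrow> 'a set set \<Rightarrow> bool" where
  "simple_graph V E \<longleftrightarrow> finite V \<and> (\<forall>e\<in>E. e \<subseteq> V \<and> card e = 2)"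

definition graph_module :: "'a set \<Rightarrow> 'a set set \<Rightarrow> 'a set \<Rightarrow> bool" where
  "graph_module V E U \<longleftrightarrow>
    U \<subseteq> V \<and> (\<forall>v\<in>V - U. (\<forall>u\<in>U. {u, v} \<in> E) \<or> (\<forall>u\<in>U. {u, v} \<notin> E))"

definition clique :: "'a set set \<Rightarrow> 'a set \<Rightarrow> bool" where
  "clique E U \<longleftrightarrow> (\<forall>u\<in>U. \<forall>v\<in>U. u \<noteq> v \<longrightarrow> {u, v} \<in> E)"

definition independent_set :: "'a set set \<Rightarrow> 'a set \<Rightarrow> bool" where
  "independent_set E U \<longleftrightarrow> (\<forall>u\<in>U. \<forall>v\<in>U. {u, v} \<notin> E)"

definition neighborhood_decomposition :: "'a set \<Rightarrow> 'a set set \<Rightarrow> 'a set set \<Rightarrow> bool" where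
  "neighborhood_decomposition V E \<P> \<longleftrightarrow>
    partition_on V \<P> \<and>
    (\<forall>U\<in>\<P>. graph_module V E U \<and> (clique E U \<or> independent_set E U))"

definition nd :: "'a set \<Rightarrow> 'a set set \<Rightarrow> nat" where
  "nd V E = (LEAST k. \<exists>\<P>. neighborhood_decomposition V E \<P> \<and> card \<P> = k)"

definition edges_between :: "'a set set \<Rightarrow> 'a set \<Rightarrow> 'a set \<Rightarrow> 'a set set" where
  "edges_between E A B = {e \<in> E. \<exists>a\<in>A. \<exists>b\<in>B. e = {a, b}}"

definition matching :: "'a set set \<Rightarrow> bool" where
  "matching M \<longleftrightarrow> (\<forall>e\<in>M. \<forall>f\<in>M. e \<noteq> f \<longrightarrow> e \<inter> f = {})"

text \<open>
  \<^const>\<open>partition_on\<close> requires the parts \<open>A\<close> and \<open>B\<close> to be nonempty, so the empty set is a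
  matching cut of exactly the disconnected graphs.
\<close>

definition matching_cut :: "'a set \<Rightarrow> 'a set set \<Rightarrow> 'a set set \<Rightarrow> bool" where
  "matching_cut V E M \<longleftrightarrow>
    matching M \<and> (\<exists>A B. A \<noteq> B \<and> partition_on V {A, B} \<and> M = edges_between E A B)"

definition minimal_matching_cut :: "'a set \<Rightarrow> 'a set set \<Rightarrow> 'a set set \<Rightarrow> bool" where
  "minimal_matching_cut V E M \<longleftrightarrow>
    matching_cut V E M \<and> (\<forall>M'. matching_cut V E M' \<longrightarrow> \<not> M' \<subset> M)"

definition maximal_matching_cut :: "'a set \<Rightarrow> 'a set set \<Rightarrow> 'a set set \<Rightarrow> bool" where
  "maximal_matching_cut V E M \<longleftrightarrow>
    matching_cut V E M \<and> (\<forall>M'. matching_cut V E M' \<longrightarrow> \<not> M \<subset> M')"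


section \<open>The enumeration problems\<close>

text \<open>
  As input of an algorithm a graph has vertex set \<open>{0, \<dots>, n - 1}\<close>.  Graphs, and likewise sets of
  edges of a graph on \<open>n\<close> vertices, are encoded by their adjacency matrices.
\<close>

type_synonym graph = "nat \<times> nat set set"

definition verts :: "graph \<Rightarrow> nat set" where
  "verts G = {..<fst G}"

definition edges :: "graph \<Rightarrow> nat set set" where
  "edges G = snd G"

definition graphs :: "graph set" where
  "graphs = {G. simple_graph (verts G) (edges G)}"

definition enc_edges :: "nat \<Rightarrow> nat set set \<Rightarrow> data" where
  "enc_edges n E =
    enc_list (map (\<lambda>i. enc_list (map (\<lambda>j. enc_bool ({i, j} \<in> E)) [0..<n])) [0..<n])"

definition nd_enum_problem ::
  "(nat set \<Rightarrow> nat set set \<Rightarrow> nat set set \<Rightarrow> bool) \<Rightarrow> (graph, nat set set) enum_problem" where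
  "nd_enum_problem is_sol =
    \<lparr>instances = graphs,
     Sol = (\<lambda>G. {M. is_sol (verts G) (edges G) M}),
     param = (\<lambda>G. nd (verts G) (edges G)),
     enc_inst = (\<lambda>G. enc_edges (fst G) (edges G)),
     enc_sol = (\<lambda>G M. enc_edges (fst G) M)\<rparr>"

definition enum_mc :: "(graph, nat set set) enum_problem" where
  "enum_mc = nd_enum_problem matching_cut"

definition enum_minimal_mc :: "(graph, nat set set) enum_problem" where
  "enum_minimal_mc = nd_enum_problem minimal_matching_cut"

definition enum_maximal_mc :: "(graph, nat set set) enum_problem" where
  "enum_maximal_mc = nd_enum_problem maximal_matching_cut"

text \<open>Graphs and edge sets are determined by their encodings.\<close>

lemma enc_list_inject: "enc_list vs = enc_list ws \<longleftrightarrow> vs = ws"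
proof (induction vs arbitrary: ws)
  case Nil then show ?case by (cases ws) auto
next
  case (Cons v vs) then show ?case by (cases ws) auto
qed

lemma enc_edges_inject:
  assumes "simple_graph {..<m} E" "simple_graph {..<n} F"
  shows "enc_edges m E = enc_edges n F \<longleftrightarrow> m = n \<and> E = F"
proof
  assume eq: "enc_edges m E = enc_edges n F"
  have rows: "map (\<lambda>i. enc_list (map (\<lambda>j. enc_bool ({i, j} \<in> E)) [0..<m])) [0..<m] =
      map (\<lambda>i. enc_list (map (\<lambda>j. enc_bool ({i, j} \<in> F)) [0..<n])) [0..<n]"
    using eq by (simp add: enc_edges_def enc_list_inject)
  from arg_cong[OF this, of length] have mn: "m = n" by simp
  have bit: "{i, j} \<in> E \<longleftrightarrow> {i, j} \<in> F" if "i < n" "j < n" for i j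
  proof -
    have "\<forall>i\<in>{0..<n}. \<forall>j\<in>{0..<n}. enc_bool ({i, j} \<in> E) = enc_bool ({i, j} \<in> F)"
      using rows by (simp add: mn enc_list_inject)
    then have "enc_bool ({i, j} \<in> E) = enc_bool ({i, j} \<in> F)" using that by simp
    then show ?thesis by (simp add: enc_bool_def split: if_splits)
  qed
  have shape: "\<exists>i j. e = {i, j} \<and> i < n \<and> j < n" if "e \<subseteq> {..<n}" "card e = 2" for e
    using that by (auto simp: card_2_iff)
  have "e \<in> E \<longleftrightarrow> e \<in> F" for e
    using assms bit shape unfolding simple_graph_def mn by metis
  then show "m = n \<and> E = F" using mn by blast
qed simp

end

theory Submission imports Defs begin

text \<open>
  The kernel keeps the three smallest vertices of every class of twins; a part of a neighborhood
  decomposition consists of twins, so at most \<open>3 * nd\<close> vertices remain.  Let \<open>r\<close> send a kept vertex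
  to itself and any other vertex to its smallest twin.  A matching cut that touches a class of at
  least three twins consists, at this class, of one edge to a common and only neighbor \<open>w\<close> of the
  class.  Hence \<open>r\<close> is injective on the vertices touched by a matching cut \<open>M\<close>, the image \<open>r(M)\<close> is a
  matching cut of the kernel, and the matching cuts with image \<open>M'\<close> are exactly the sets \<open>\<sigma>(M')\<close>
  for sections \<open>\<sigma>\<close> of \<open>r\<close>.  Both maps are strictly monotone and thus respect minimality and
  maximality, so the fibres of \<open>M \<mapsto> r(M)\<close> are the required partition.  A fibre over a minimal cut
  is small enough to be listed; in general it is enumerated by a traversal of a binary tree of
  linear depth without dead ends.

  Programs are obtained from closure properties of the class of functions computable in polynomial
  time, chiefly under iteration with an accumulator of polynomial size.
\<close>

section \<open>Functions computable in polynomial time\<close>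

text \<open>The shape of cuts at a twin class changes between two and three twins and not after
  that. With two kept vertices per class the complete bipartite graph on 2 + 3 vertices, which has
  no matching cut, would shrink to a 4-cycle, which has one touching both members of each class. The
  contracted vertices of a class all go to one kept vertex, so the two other kept ones form fibres
  of their own. They guarantee that, whatever a cut of the kernel touches, the class still has an
  untouched kept vertex. Going back from the kernel depends on this: an untouched vertex in the
  fibre of a touched one must not follow \<open>r\<close>, but takes the side of an untouched kept
  twin. The empty cut has no touched vertices that would pin down two sides in the kernel and is
  treated separately. For the delay, the silent stretches at the two ends of the trace of a subtree
  are bounded separately from those inside. The ends grow by a fixed amount per level, although the
  number of leaves may double.\<close>

lemma poly_nat_mono: "m \<le> n \<Longrightarrow> poly p m \<le> poly p n" for p :: "nat poly"
  by (induction p) (auto intro!: add_mono mult_mono)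

lemma time_append [simp]: "time (xs @ ys) = time xs + time ys"
  by (induction xs rule: time.induct) auto

lemma outputs_append [simp]: "outputs (xs @ ys) = outputs xs @ outputs ys"
  by (induction xs rule: outputs.induct) auto

lemma time_charge [simp]: "time (charge v # tr) = size v + 1 + time tr"
  by (simp add: charge_def)

lemma outputs_charge [simp]: "outputs (charge v # tr) = outputs tr"
  by (simp add: charge_def)

section \<open>Linking programs and reusing them in larger environments\<close>

fun shift :: "nat \<Rightarrow> expr \<Rightarrow> expr" where
  "shift k (Var i) = Var i"
| "shift k LeafE = LeafE"
| "shift k (PairE a b) = PairE (shift k a) (shift k b)"
| "shift k (LeftE a) = LeftE (shift k a)"
| "shift k (RightE a) = RightE (shift k a)"
| "shift k (IfE a b c) = IfE (shift k a) (shift k b) (shift k c)"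
| "shift k (LetE a b) = LetE (shift k a) (shift k b)"
| "shift k (Call f a) = Call (k + f) (shift k a)"
| "shift k (Emit a) = Emit (shift k a)"

text \<open>Calls name functions by their position in the program. A program placed behind
  \<open>Q\<close> therefore needs its calls renumbered, while one that is only extended at the end
  runs unchanged.\<close>

lemma eval_shift:
  "eval P env e v tr \<Longrightarrow> eval (Q @ map (shift (length Q)) P) env (shift (length Q) e) v tr"
proof (induction rule: eval.induct)
  case (Call env a v tr f w tr')
  then show ?case by (auto intro!: eval.Call simp: nth_append)
qed (auto intro: eval.intros)

lemma eval_append_program: "eval P env e v tr \<Longrightarrow> eval (P @ Q) env e v tr"
proof (induction rule: eval.induct)
  case (Call env a v tr f w tr')
  then show ?case by (auto intro!: eval.Call simp: nth_append)
qed (auto intro: eval.intros)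

lemma eval_append_env: "eval P env e v tr \<Longrightarrow> eval P (env @ env') e v tr"
proof (induction rule: eval.induct)
  case (Var i env)
  then show ?case using eval.Var[of i "env @ env'" P] by (simp add: nth_append)
qed (auto intro: eval.intros)

text \<open>The last event of every evaluation charges the size of the result plus one. Time bounds
  are thus size bounds as well, which keeps compositions polynomial.\<close>

lemma eval_size_less_time: "eval P env e v tr \<Longrightarrow> size v < time tr"
  by (induction rule: eval.induct) auto

definition evals_within :: "program \<Rightarrow> expr \<Rightarrow> nat poly \<Rightarrow> (data \<Rightarrow> data) \<Rightarrow> bool" where
  "evals_within P e p f \<longleftrightarrow>
    (\<forall>x. \<exists>tr. eval P [x] e (f x) tr \<and> outputs tr = [] \<and> time tr \<le> poly p (size x))"

definition polytime :: "(data \<Rightarrow> data) \<Rightarrow> bool" where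
  "polytime f \<longleftrightarrow> (\<exists>P e p. evals_within P e p f)"

text \<open>Evaluation from a one-element environment looks at no further variable, so more entries
  to its right do no harm and \<open>e\<close> can be used below other binders.\<close>

lemma evals_withinE:
  assumes "evals_within P e p f"
  obtains tr where "eval P (x # env) e (f x) tr" "outputs tr = []" "time tr \<le> poly p (size x)"
  using assms eval_append_env[of P "[x]" e _ _ env] unfolding evals_within_def by fastforce

lemma evals_within_size: "evals_within P e p f \<Longrightarrow> size (f x) \<le> poly p (size x)"
  using evals_withinE[of P e p f x "[]"] eval_size_less_time by (metis less_imp_le order_trans)

lemma evals_within_append: "evals_within P e p f \<Longrightarrow> evals_within (P @ Q) e p f"
  unfolding evals_within_def using eval_append_program by blast

lemma evals_within_shift:
  "evals_within P e p f \<Longrightarrow>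
    evals_within (Q @ map (shift (length Q)) P) (shift (length Q) e) p f"
  unfolding evals_within_def using eval_shift by blast

lemma evals_within_Cons:
  "evals_within P e p f \<Longrightarrow> evals_within (b # map (shift 1) P) (shift 1 e) p f"
  using evals_within_shift[of P e p f "[b]"] by simp

lemma polytime_size:
  assumes "polytime f"
  obtains p where "\<And>x. size (f x) \<le> poly p (size x)"
  using assms evals_within_size unfolding polytime_def by blast

text \<open>The second program is renumbered and appended to the first, so that both expressions
  live in one program.\<close>

lemma polytime2E:
  assumes "polytime f" "polytime g"
  obtains P e p e' p' where "evals_within P e p f" "evals_within P e' p' g"
  using assms evals_within_append evals_within_shift unfolding polytime_def by metis

section \<open>Closure under the constructs of the language\<close>

lemma polytime_id: "polytime (\<lambda>x. x)"
proof -
  have "evals_within [] (Var 0) [:1, 1:] (\<lambda>x. x)"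
    unfolding evals_within_def using eval.Var[of 0 "[x]" "[]" for x]
    by (auto intro!: exI[of _ "[charge _]"])
  then show ?thesis unfolding polytime_def by blast
qed

lemma polytime_Leaf: "polytime (\<lambda>x. Leaf)"
proof -
  have "evals_within [] LeafE [:1:] (\<lambda>x. Leaf)"
    unfolding evals_within_def using eval.LeafE by (auto intro!: exI[of _ "[charge _]"])
  then show ?thesis unfolding polytime_def by blast
qed

lemma polytime_Pair:
  assumes "polytime f" "polytime g"
  shows "polytime (\<lambda>x. Pair (f x) (g x))"
proof -
  obtain P e p e' p' where fg: "evals_within P e p f" "evals_within P e' p' g"
    using polytime2E assms by blast
  have "evals_within P (PairE e e') (2 * p + 2 * p' + 2) (\<lambda>x. Pair (f x) (g x))"
    unfolding evals_within_def
  proof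
    fix x
    obtain tr where tr: "eval P [x] e (f x) tr" "outputs tr = []" "time tr \<le> poly p (size x)"
      using fg(1) by (rule evals_withinE)
    obtain tr' where tr': "eval P [x] e' (g x) tr'" "outputs tr' = []" "time tr' \<le> poly p' (size x)"
      using fg(2) by (rule evals_withinE)
    from eval.PairE[OF tr(1) tr'(1)] tr tr' eval_size_less_time[OF tr(1)] eval_size_less_time[OF tr'(1)]
    show "\<exists>tr. eval P [x] (PairE e e') (Pair (f x) (g x)) tr \<and> outputs tr = [] \<and>
        time tr \<le> poly (2 * p + 2 * p' + 2) (size x)"
      by (intro exI[of _ "tr @ tr' @ [charge _]"]) auto
  qed
  then show ?thesis unfolding polytime_def by blast
qed

lemma size_left: "size (left v) \<le> size v" and size_right: "size (right v) \<le> size v"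
  by (cases v; simp)+

lemma size_left_right: "size (left v) + size (right v) \<le> size v"
  by (cases v) auto

lemma polytime_left:
  assumes "polytime f"
  shows "polytime (\<lambda>x. left (f x))"
proof -
  obtain P e p where f: "evals_within P e p f" using assms polytime_def by auto
  have "evals_within P (LeftE e) (2 * p + 1) (\<lambda>x. left (f x))"
    unfolding evals_within_def
  proof
    fix x
    obtain tr where tr: "eval P [x] e (f x) tr" "outputs tr = []" "time tr \<le> poly p (size x)"
      using f by (rule evals_withinE)
    from eval.LeftE[OF tr(1)] tr eval_size_less_time[OF tr(1)] size_left[of "f x"]
    show "\<exists>tr. eval P [x] (LeftE e) (left (f x)) tr \<and> outputs tr = [] \<and>
        time tr \<le> poly (2 * p + 1) (size x)"
      by (intro exI[of _ "tr @ [charge _]"]) auto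
  qed
  then show ?thesis unfolding polytime_def by blast
qed

lemma polytime_right:
  assumes "polytime f"
  shows "polytime (\<lambda>x. right (f x))"
proof -
  obtain P e p where f: "evals_within P e p f" using assms polytime_def by auto
  have "evals_within P (RightE e) (2 * p + 1) (\<lambda>x. right (f x))"
    unfolding evals_within_def
  proof
    fix x
    obtain tr where tr: "eval P [x] e (f x) tr" "outputs tr = []" "time tr \<le> poly p (size x)"
      using f by (rule evals_withinE)
    from eval.RightE[OF tr(1)] tr eval_size_less_time[OF tr(1)] size_right[of "f x"]
    show "\<exists>tr. eval P [x] (RightE e) (right (f x)) tr \<and> outputs tr = [] \<and>
        time tr \<le> poly (2 * p + 1) (size x)"
      by (intro exI[of _ "tr @ [charge _]"]) auto
  qed
  then show ?thesis unfolding polytime_def by blast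
qed

lemma polytime_comp:
  assumes "polytime f" "polytime g"
  shows "polytime (\<lambda>x. f (g x))"
proof -
  obtain P e p e' p' where fg: "evals_within P e p f" "evals_within P e' p' g"
    using polytime2E assms by blast
  have "evals_within P (LetE e' e) (p' + 2 * pcompose p p' + 1) (\<lambda>x. f (g x))"
    unfolding evals_within_def
  proof
    fix x
    obtain tr' where tr': "eval P [x] e' (g x) tr'" "outputs tr' = []" "time tr' \<le> poly p' (size x)"
      using fg(2) by (rule evals_withinE)
    obtain tr where tr: "eval P [g x, x] e (f (g x)) tr" "outputs tr = []" "time tr \<le> poly p (size (g x))"
      using fg(1) by (rule evals_withinE)
    have "poly p (size (g x)) \<le> poly p (poly p' (size x))"
      using evals_within_size[OF fg(2)] poly_nat_mono by blast
    with eval.LetE[OF tr'(1) tr(1)] tr tr' eval_size_less_time[OF tr(1)]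
    show "\<exists>tr. eval P [x] (LetE e' e) (f (g x)) tr \<and> outputs tr = [] \<and>
        time tr \<le> poly (p' + 2 * pcompose p p' + 1) (size x)"
      by (intro exI[of _ "tr' @ tr @ [charge _]"]) (auto simp: poly_pcompose)
  qed
  then show ?thesis unfolding polytime_def by blast
qed

lemma polytime_If_Leaf:
  assumes "polytime c" "polytime f" "polytime g"
  shows "polytime (\<lambda>x. if c x \<noteq> Leaf then f x else g x)"
proof -
  \<comment> \<open>\<open>h\<close> selects from a triple of computed values. Evaluating both
    branches before the choice costs only a sum of polynomials and reduces the conditional to
    pairing and composition.\<close>
  define h where "h x = (if left x \<noteq> Leaf then left (right x) else right (right x))" for x
  have "polytime h"
  proof -
    have "evals_within [] (IfE (LeftE (Var 0)) (LeftE (RightE (Var 0))) (RightE (RightE (Var 0))))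
      [:10, 10:] h"
      unfolding evals_within_def
    proof
      fix x
      have v: "eval [] [x] (Var 0) x [charge x]" using eval.Var[of 0 "[x]" "[]"] by simp
      note l = eval.LeftE[OF v] and r = eval.RightE[OF v]
      note rl = eval.LeftE[OF r] and rr = eval.RightE[OF r]
      note s = size_left[of x] size_right[of x] size_left[of "right x"] size_right[of "right x"]
      show "\<exists>tr. eval [] [x] (IfE (LeftE (Var 0)) (LeftE (RightE (Var 0))) (RightE (RightE (Var 0)))) (h x) tr
         \<and> outputs tr = [] \<and> time tr \<le> poly [:10, 10:] (size x)"
      proof (cases "left x = Leaf")
        case True
        with l have "eval [] [x] (LeftE (Var 0)) Leaf ([charge x] @ [charge (left x)])" by simp
        from eval.IfFalse[OF this rr] True s show ?thesis
          by (intro exI) (auto simp: h_def)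
      next
        case False
        from eval.IfTrue[OF l False rl] False s show ?thesis
          by (intro exI) (auto simp: h_def)
      qed
    qed
    then show ?thesis unfolding polytime_def by blast
  qed
  from polytime_comp[OF this polytime_Pair[OF assms(1) polytime_Pair[OF assms(2,3)]]]
  show ?thesis by (simp add: h_def cong: if_cong)
qed

text \<open>The step receives the rest \<open>b\<close> of the list instead of its head. On a unary
  number the length of the rest is the loop index, which runs downwards to 0.\<close>

fun tail_fold :: "(data \<Rightarrow> data) \<Rightarrow> data \<Rightarrow> data \<Rightarrow> data \<Rightarrow> data" where
  "tail_fold s Leaf acc x = acc"
| "tail_fold s (Pair a b) acc x = tail_fold s b (s (Pair b (Pair acc x))) x"

lemma eval_Var_Cons: "eval P (v # env) (Var 0) v [charge v]"
  using eval.Var[of 0 "v # env" P] by simp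

text \<open>
  The growth of the accumulator is bounded additively, so that it stays polynomial over all rounds.
\<close>

lemma polytime_tail_fold:
  assumes "polytime s"
    and bound: "\<And>b acc x. size (s (Pair b (Pair acc x))) \<le> size acc + poly q (size b + size x)"
  shows "polytime (\<lambda>z. tail_fold s (left z) (left (right z)) (right (right z)))"
proof -
  obtain P0 e0 p where s0: "evals_within P0 e0 p s" using assms(1) polytime_def by auto
  define e where "e = shift 1 e0"
  define body where "body =
    IfE (LeftE (Var 0))
      (LetE (PairE (RightE (LeftE (Var 0))) (RightE (Var 0)))
        (LetE e (Call 0 (PairE (LeftE (Var 1)) (PairE (Var 0) (RightE (RightE (Var 2))))))))
      (LeftE (RightE (Var 0)))"
  define P where "P = body # map (shift 1) P0"
  have s: "evals_within P e p s" using evals_within_Cons[OF s0] by (simp add: P_def e_def)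
  \<comment> \<open>Cost of one round without the recursive call, if all arguments have size at most
    \<open>B\<close>: the run of \<open>s\<close>, and a constant number of charges for taking apart
    and rebuilding the triple.\<close>
  define C where "C B = poly p B + 50 * B + 50" for B
  \<comment> \<open>\<open>B\<close> bounds the present arguments together with all growth still to
    come. \<open>N\<close> is fixed apart from \<open>l\<close>, so that every remaining round is
    allowed the same increase \<open>poly q (N + size x)\<close>.\<close>
  have loop: "\<exists>tr. eval P [Pair l (Pair acc x)] body (tail_fold s l acc x) tr \<and> outputs tr = [] \<and>
      size (tail_fold s l acc x) \<le> B \<and> time tr \<le> (size l + 1) * C B"
    if "size l + size acc + size l * poly q (N + size x) + size x + 2 \<le> B" "size l \<le> N" for l acc x B N
    using that
  proof (induction l arbitrary: acc)
    case Leaf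
    let ?z = "Pair Leaf (Pair acc x)"
    note z = eval_Var_Cons[of P ?z "[]"]
    have t: "eval P [?z] (LeftE (Var 0)) Leaf ([charge ?z] @ [charge Leaf])"
      using eval.LeftE[OF z] by simp
    have "eval P [?z] (LeftE (RightE (Var 0))) acc (([charge ?z] @ [charge (Pair acc x)]) @ [charge acc])"
      using eval.LeftE[OF eval.RightE[OF z]] by simp
    from eval.IfFalse[OF t this] Leaf show ?case
      by (intro exI) (auto simp: body_def C_def)
  next
    case (Pair a b)
    let ?z = "Pair (Pair a b) (Pair acc x)"
    let ?y = "Pair b (Pair acc x)"
    let ?acc = "s ?y"
    let ?z' = "Pair b (Pair ?acc x)"
    let ?w = "tail_fold s b ?acc x"
    have "poly q (size b + size x) \<le> poly q (N + size x)"
      using Pair.prems by (intro poly_nat_mono) auto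
    with bound[of b acc x] have acc: "size ?acc \<le> size acc + poly q (N + size x)" by linarith
    have le: "size b + size ?acc + size b * poly q (N + size x) + size x + 2 \<le> B"
      using Pair.prems(1) acc by (simp add: algebra_simps)
    moreover have "size b \<le> N" using Pair.prems by simp
    ultimately obtain tr where tr: "eval P [?z'] body ?w tr" "outputs tr = []"
        "size ?w \<le> B" "time tr \<le> (size b + 1) * C B"
      using Pair.IH(2) by blast
    obtain tr' where tr': "eval P [?y, ?z] e ?acc tr'" "outputs tr' = []" "time tr' \<le> poly p (size ?y)"
      using s by (rule evals_withinE)
    have y_le: "size ?y \<le> B" using Pair.prems(1) by simp
    then have "poly p (size ?y) \<le> poly p B" by (rule poly_nat_mono)
    with tr' have tr'_le: "time tr' \<le> poly p B" by linarith
    note z = eval_Var_Cons[of P ?z "[]"]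
    note t = eval.LeftE[OF z]
    have yev: "eval P [?z] (PairE (RightE (LeftE (Var 0))) (RightE (Var 0))) ?y
        ((([charge ?z] @ [charge (Pair a b)]) @ [charge b]) @ ([charge ?z] @ [charge (Pair acc x)]) @ [charge ?y])"
      using eval.PairE[OF eval.RightE[OF t] eval.RightE[OF z]] by simp
    let ?env = "[?acc, ?y, ?z]"
    have v0: "eval P ?env (Var 0) ?acc [charge ?acc]"
      and v1: "eval P ?env (Var 1) ?y [charge ?y]"
      and v2: "eval P ?env (Var 2) ?z [charge ?z]"
      using eval.Var[of 0 ?env P] eval.Var[of 1 ?env P] eval.Var[of 2 ?env P] by simp_all
    have arg: "eval P ?env (PairE (LeftE (Var 1)) (PairE (Var 0) (RightE (RightE (Var 2))))) ?z'
      (([charge ?y] @ [charge b]) @ ([charge ?acc] @ (([charge ?z] @ [charge (Pair acc x)]) @ [charge x]) @ [charge (Pair ?acc x)]) @ [charge ?z'])"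
      using eval.PairE[OF eval.LeftE[OF v1] eval.PairE[OF v0 eval.RightE[OF eval.RightE[OF v2]]]] by simp
    have "eval P [?z'] (P ! 0) ?w tr" using tr(1) by (simp add: P_def)
    note call = eval.Call[OF arg _ this]
    note ev = eval.IfTrue[OF t _ eval.LetE[OF yev eval.LetE[OF tr'(1) call]]]
    have z'_le: "size ?z' \<le> B" using le by simp
    have z_le: "size ?z \<le> B" using Pair.prems(1) by simp
    show ?case
      apply (rule exI, intro conjI)
         apply (simp only: body_def tail_fold.simps)
         apply (rule ev)
          apply (simp_all add: tr tr' P_def[symmetric])
       apply (simp add: P_def)
      using tr(3,4) tr'_le y_le z_le z'_le by (auto simp: C_def algebra_simps)
  qed
  \<comment> \<open>The bound \<open>B\<close> as a polynomial in the input size n: the input, and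
    at most n rounds that each add at most q(2n).\<close>
  define r where "r = [:2, 1:] + [:0, 1:] * pcompose q [:0, 2:]"
  define R where "R = [:1, 1:] * (pcompose p r + smult 50 r + 50) + r + [:10, 10:]"
  have "evals_within P (Call 0 (PairE (LeftE (Var 0)) (PairE (LeftE (RightE (Var 0))) (RightE (RightE (Var 0))))))
      (R + [: 100, 100:]) (\<lambda>z. tail_fold s (left z) (left (right z)) (right (right z)))"
    unfolding evals_within_def
  proof
    fix z
    let ?l = "left z" and ?acc = "left (right z)" and ?x = "right (right z)"
    let ?N = "size z" and ?B = "poly r (size z)"
    have sz: "size ?l + size ?acc + size ?x \<le> size z"
      using size_left_right[of z] size_left_right[of "right z"] by linarith
    let ?y = "Pair ?l (Pair ?acc ?x)"
    let ?w = "tail_fold s ?l ?acc ?x"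
    have "size ?l * poly q (size z + size ?x) \<le> size z * poly q (2 * size z)"
      using sz by (intro mult_mono poly_nat_mono) auto
    then have "size ?l + size ?acc + size ?l * poly q (?N + size ?x) + size ?x + 2 \<le> ?B"
      using sz by (simp add: r_def poly_pcompose mult.commute)
    then obtain tr where tr: "eval P [?y] body ?w tr" "outputs tr = []" "size ?w \<le> ?B"
        "time tr \<le> (size ?l + 1) * C ?B"
      using loop[of ?l ?acc ?N ?x ?B] sz by auto
    have "(size ?l + 1) * C ?B \<le> (size z + 1) * C ?B" using sz by (intro mult_right_mono) auto
    with tr(4) have tr_le: "time tr \<le> (size z + 1) * C ?B" by linarith
    note v = eval_Var_Cons[of P z "[]"]
    note rv = eval.RightE[OF v]
    note arg = eval.PairE[OF eval.LeftE[OF v] eval.PairE[OF eval.LeftE[OF rv] eval.RightE[OF rv]]]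
    have "eval P [?y] (P ! 0) ?w tr" using tr(1) by (simp add: P_def)
    note ev = eval.Call[OF arg _ this]
    show "\<exists>tr. eval P [z] (Call 0 (PairE (LeftE (Var 0)) (PairE (LeftE (RightE (Var 0))) (RightE (RightE (Var 0))))))
       ?w tr \<and> outputs tr = [] \<and> time tr \<le> poly (R + [: 100, 100:]) (size z)"
      apply (rule exI, intro conjI)
        apply (rule ev)
        apply (simp add: P_def)
       apply (simp add: tr)
      using tr(3) tr_le sz size_right[of z]
      apply (simp add: R_def C_def poly_pcompose algebra_simps)
      done
  qed
  then show ?thesis unfolding polytime_def by blast
qed


section \<open>Unary arithmetic, tests, bounded quantifiers and list comprehensions\<close>

fun len :: "data \<Rightarrow> nat" where
  "len Leaf = 0"
| "len (Pair a b) = Suc (len b)"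

lemma len_enc_list [simp]: "len (enc_list vs) = length vs"
  by (induction vs) auto

lemma len_enc_nat [simp]: "len (enc_nat n) = n"
  by (simp add: enc_nat_def)

lemma len_le_size: "len v \<le> size v"
  by (induction v) auto

lemma enc_nat_0 [simp]: "enc_nat 0 = Leaf"
  and enc_nat_Suc [simp]: "enc_nat (Suc n) = Pair Leaf (enc_nat n)"
  by (simp_all add: enc_nat_def)

lemma size_enc_nat [simp]: "size (enc_nat n) = n"
  by (induction n) auto

lemma enc_bool_simps [simp]: "enc_bool True = Pair Leaf Leaf" "enc_bool False = Leaf"
  "enc_bool b = Leaf \<longleftrightarrow> \<not> b"
  by (simp_all add: enc_bool_def)

lemma size_enc_bool: "size (enc_bool b) \<le> 1"
  by (cases b) auto

definition polytime_nat :: "(data \<Rightarrow> nat) \<Rightarrow> bool" where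
  "polytime_nat n \<longleftrightarrow> polytime (\<lambda>x. enc_nat (n x))"

definition polytime_bool :: "(data \<Rightarrow> bool) \<Rightarrow> bool" where
  "polytime_bool b \<longleftrightarrow> polytime (\<lambda>x. enc_bool (b x))"

lemma polytime_If:
  assumes "polytime_bool b" "polytime f" "polytime g"
  shows "polytime (\<lambda>x. if b x then f x else g x)"
  using polytime_If_Leaf[OF assms[unfolded polytime_bool_def]] by simp

lemma foldr_upt_eq_tail_fold:
  "foldr (\<lambda>i acc. step i acc x) [0..<n] acc =
    tail_fold (\<lambda>z. step (len (left z)) (left (right z)) (right (right z))) (enc_nat n) acc x"
  by (induction n arbitrary: acc) auto

lemma polytime_foldr_upt:
  assumes "polytime_nat n" "polytime init"
    and "polytime (\<lambda>z. step (len (left z)) (left (right z)) (right (right z)))"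
    and bound: "\<And>i acc x. size (step i acc x) \<le> size acc + poly q (i + size x)"
  shows "polytime (\<lambda>x. foldr (\<lambda>i acc. step i acc x) [0..<n x] (init x))"
proof -
  let ?s = "\<lambda>z. step (len (left z)) (left (right z)) (right (right z))"
  have "size (?s (Pair b (Pair acc x))) \<le> size acc + poly q (size b + size x)" for b acc x
    using bound[of "len b" acc x] poly_nat_mono[of "len b + size x" "size b + size x" q] len_le_size[of b]
    by fastforce
  from polytime_comp[OF polytime_tail_fold[OF assms(3) this]
      polytime_Pair[OF assms(1)[unfolded polytime_nat_def] polytime_Pair[OF assms(2) polytime_id]]]
  show ?thesis by (simp add: foldr_upt_eq_tail_fold)
qed

lemma polytime_nat_0: "polytime_nat (\<lambda>x. 0)"
  unfolding polytime_nat_def using polytime_Leaf by simp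

lemma polytime_nat_Suc: "polytime_nat n \<Longrightarrow> polytime_nat (\<lambda>x. Suc (n x))"
  unfolding polytime_nat_def by (auto intro: polytime_Pair polytime_Leaf)

text \<open>Any list can serve as a loop counter once its spine has been copied as a unary
  number.\<close>

lemma polytime_nat_len:
  assumes "polytime f"
  shows "polytime_nat (\<lambda>x. len (f x))"
proof -
  let ?s = "\<lambda>z. Pair Leaf (left (right z))"
  have *: "tail_fold ?s l acc x = enc_nat (n + len l)" if "acc = enc_nat n" for l acc x n
    using that
  proof (induction l arbitrary: acc n)
    case (Pair a b)
    from Pair.IH(2)[of "Pair Leaf acc" "Suc n"] Pair.prems show ?case by simp
  qed simp
  have "polytime ?s"
    by (intro polytime_Pair polytime_Leaf polytime_left polytime_right polytime_id)
  from polytime_comp[OF polytime_tail_fold[OF this, of 1]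
      polytime_Pair[OF assms polytime_Pair[OF polytime_Leaf polytime_Leaf]]]
  show ?thesis by (simp add: polytime_nat_def *[of _ 0])
qed

lemma funpow_right_enc_nat: "(right ^^ m) (enc_nat n) = enc_nat (n - m)"
proof (induction m)
  case (Suc m)
  then show ?case by (cases "n - m") (auto simp: Suc_diff_Suc[symmetric] diff_Suc)
qed simp

lemma foldr_const_step: "foldr (\<lambda>i acc. f acc) [0..<n] a = (f ^^ n) a"
  by (induction n arbitrary: a) (auto simp: funpow_swap1)

lemma polytime_funpow_right:
  assumes "polytime_nat n" "polytime f"
  shows "polytime (\<lambda>x. (right ^^ n x) (f x))"
proof -
  have "polytime (\<lambda>x. foldr (\<lambda>i acc. right acc) [0..<n x] (f x))"
    by (rule polytime_foldr_upt[OF assms, where q = 0])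
      (auto intro!: polytime_left polytime_right polytime_id size_right)
  then show ?thesis by (simp add: foldr_const_step)
qed

lemma polytime_nat_diff:
  assumes "polytime_nat m" "polytime_nat n"
  shows "polytime_nat (\<lambda>x. m x - n x)"
  using polytime_funpow_right[OF assms(2) assms(1)[unfolded polytime_nat_def]]
  by (simp add: polytime_nat_def funpow_right_enc_nat)

lemma polytime_bool_nonempty:
  assumes "polytime f"
  shows "polytime_bool (\<lambda>x. f x \<noteq> Leaf)"
  using polytime_If_Leaf[OF assms polytime_Pair[OF polytime_Leaf polytime_Leaf] polytime_Leaf]
  by (simp add: polytime_bool_def enc_bool_def)

lemma polytime_bool_const: "polytime_bool (\<lambda>x. c)"
  by (cases c) (auto simp: polytime_bool_def intro: polytime_Leaf polytime_Pair)

lemma polytime_bool_If: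
  assumes "polytime_bool b" "polytime_bool c" "polytime_bool d"
  shows "polytime_bool (\<lambda>x. if b x then c x else d x)"
  using polytime_If[OF assms(1) assms(2,3)[unfolded polytime_bool_def]]
  by (simp add: polytime_bool_def if_distrib)

lemma polytime_bool_Not: "polytime_bool b \<Longrightarrow> polytime_bool (\<lambda>x. \<not> b x)"
proof -
  assume "polytime_bool b"
  then have "polytime_bool (\<lambda>x. if b x then False else True)"
    by (intro polytime_bool_If polytime_bool_const)
  moreover have "(\<lambda>x. if b x then False else True) = (\<lambda>x. \<not> b x)" by auto
  ultimately show ?thesis by metis
qed

lemma polytime_bool_conj:
  "polytime_bool b \<Longrightarrow> polytime_bool c \<Longrightarrow> polytime_bool (\<lambda>x. b x \<and> c x)"
proof -
  assume "polytime_bool b" "polytime_bool c"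
  then have "polytime_bool (\<lambda>x. if b x then c x else False)"
    by (intro polytime_bool_If polytime_bool_const)
  moreover have "(\<lambda>x. if b x then c x else False) = (\<lambda>x. b x \<and> c x)" by auto
  ultimately show ?thesis by metis
qed

lemma polytime_bool_disj:
  "polytime_bool b \<Longrightarrow> polytime_bool c \<Longrightarrow> polytime_bool (\<lambda>x. b x \<or> c x)"
  using polytime_bool_Not[OF polytime_bool_conj[OF polytime_bool_Not polytime_bool_Not], of b c] by simp

lemma polytime_bool_imp:
  "polytime_bool b \<Longrightarrow> polytime_bool c \<Longrightarrow> polytime_bool (\<lambda>x. b x \<longrightarrow> c x)"
  unfolding imp_conv_disj by (intro polytime_bool_disj polytime_bool_Not)

lemma polytime_bool_iff:
  "polytime_bool b \<Longrightarrow> polytime_bool c \<Longrightarrow> polytime_bool (\<lambda>x. b x \<longleftrightarrow> c x)"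
  using polytime_bool_conj[OF polytime_bool_imp polytime_bool_imp, of b c c b]
  by (simp add: iff_conv_conj_imp)

lemma polytime_bool_less:
  assumes "polytime_nat m" "polytime_nat n"
  shows "polytime_bool (\<lambda>x. m x < n x)"
proof -
  have "enc_nat (n x - m x) \<noteq> Leaf \<longleftrightarrow> m x < n x" for x
    by (cases "n x - m x") auto
  with polytime_bool_nonempty[OF polytime_nat_diff[OF assms(2,1), unfolded polytime_nat_def]]
  show ?thesis by simp
qed

lemma polytime_bool_eq:
  assumes "polytime_nat m" "polytime_nat n"
  shows "polytime_bool (\<lambda>x. m x = n x)"
proof -
  have "m x = n x \<longleftrightarrow> \<not> m x < n x \<and> \<not> n x < m x" for x by auto
  with assms show ?thesis
    by (simp add: polytime_bool_conj polytime_bool_Not polytime_bool_less)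
qed

text \<open>The bound variable reaches the body as the length of the left component of a pair and
  the parameter as the right one. Nested binders become nested pairs, so that a first-order
  description of a function can be compiled by introduction rules alone.\<close>

lemma polytime_bool_Ex:
  assumes "polytime_nat n" "polytime_bool (\<lambda>z. b (len (left z)) (right z))"
  shows "polytime_bool (\<lambda>x. \<exists>i<n x. b i x)"
proof -
  let ?step = "\<lambda>i acc x. if b i x then Pair Leaf Leaf else acc"
  have "polytime_bool (\<lambda>z. b (len (left z)) (right (right z)))"
    using polytime_comp[OF assms(2)[unfolded polytime_bool_def], of "\<lambda>z. Pair (left z) (right (right z))"]
    by (simp add: polytime_bool_def polytime_Pair polytime_left polytime_right polytime_id)
  then have "polytime (\<lambda>x. foldr (\<lambda>i acc. ?step i acc x) [0..<n x] Leaf)"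
    by (intro polytime_foldr_upt[OF assms(1), where q = 1])
      (auto intro!: polytime_If polytime_Pair polytime_left polytime_right polytime_id polytime_Leaf)
  moreover have "foldr (\<lambda>i acc. ?step i acc x) [0..<m] (enc_bool c) = enc_bool ((\<exists>i<m. b i x) \<or> c)" for m x c
  proof (induction m arbitrary: c)
    case (Suc m)
    have "(if b m x then Pair Leaf Leaf else enc_bool c) = enc_bool (b m x \<or> c)" by simp
    with Suc[of "b m x \<or> c"] show ?case
      by (simp del: enc_bool_simps) (rule arg_cong[of _ _ enc_bool], auto simp: less_Suc_eq)
  qed simp
  from this[of _ _ False] have "foldr (\<lambda>i acc. ?step i acc x) [0..<n x] Leaf = enc_bool (\<exists>i<n x. b i x)" for x
    by simp
  ultimately show ?thesis by (simp add: polytime_bool_def)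
qed

lemma polytime_bool_All:
  assumes "polytime_nat n" "polytime_bool (\<lambda>z. b (len (left z)) (right z))"
  shows "polytime_bool (\<lambda>x. \<forall>i<n x. b i x)"
  using polytime_bool_Not[OF polytime_bool_Ex[OF assms(1) polytime_bool_Not[OF assms(2)]]] by simp

lemma polytime_map_filter:
  assumes "polytime_nat n" "polytime_bool (\<lambda>z. b (len (left z)) (right z))"
    and "polytime (\<lambda>z. h (len (left z)) (right z))"
  shows "polytime (\<lambda>x. enc_list (map (\<lambda>i. h i x) (filter (\<lambda>i. b i x) [0..<n x])))"
proof -
  let ?step = "\<lambda>i acc x. if b i x then Pair (h i x) acc else acc"
  have "polytime_bool (\<lambda>z. b (len (left z)) (right (right z)))"
    using polytime_comp[OF assms(2)[unfolded polytime_bool_def], of "\<lambda>z. Pair (left z) (right (right z))"]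
    by (simp add: polytime_bool_def polytime_Pair polytime_left polytime_right polytime_id)
  moreover have "polytime (\<lambda>z. h (len (left z)) (right (right z)))"
    using polytime_comp[OF assms(3), of "\<lambda>z. Pair (left z) (right (right z))"]
    by (simp add: polytime_Pair polytime_left polytime_right polytime_id)
  moreover obtain p where p: "size (h (len (left z)) (right z)) \<le> poly p (size z)" for z
    using polytime_size[OF assms(3)] by blast
  have "size (h i x) \<le> poly p (i + size x + 1)" for i x
    using p[of "Pair (enc_nat i) x"] by simp
  \<comment> \<open>The body is applied to \<open>Pair (enc_nat i) x\<close> of size i + size x + 1,
    which explains the inner polynomial; the summand 1 is the new list cell.\<close>
  then have "size (?step i acc x) \<le> size acc + poly (pcompose p [:1, 1:] + 1) (i + size x)" for i acc x
    by (simp add: poly_pcompose add.commute add_mono)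
  ultimately have "polytime (\<lambda>x. foldr (\<lambda>i acc. ?step i acc x) [0..<n x] Leaf)"
    by (intro polytime_foldr_upt[OF assms(1), where q = "pcompose p [:1, 1:] + 1"])
      (assumption | intro polytime_If polytime_Pair polytime_left polytime_right polytime_id polytime_Leaf)+
  moreover have "foldr (\<lambda>i acc. ?step i acc x) [0..<m] (enc_list vs) =
      enc_list (map (\<lambda>i. h i x) (filter (\<lambda>i. b i x) [0..<m]) @ vs)" for m x vs
    by (induction m arbitrary: vs) (auto simp flip: enc_list.simps)
  from this[of _ _ "[]"] have "foldr (\<lambda>i acc. ?step i acc x) [0..<n x] Leaf =
      enc_list (map (\<lambda>i. h i x) (filter (\<lambda>i. b i x) [0..<n x]))" for x by simp
  ultimately show ?thesis by simp
qed

lemma polytime_map: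
  assumes "polytime_nat n" "polytime (\<lambda>z. h (len (left z)) (right z))"
  shows "polytime (\<lambda>x. enc_list (map (\<lambda>i. h i x) [0..<n x]))"
  using polytime_map_filter[OF assms(1) polytime_bool_const[of True] assms(2)] by simp

lemma polytime_nat_count:
  assumes "polytime_nat n" "polytime_bool (\<lambda>z. b (len (left z)) (right z))"
  shows "polytime_nat (\<lambda>x. length (filter (\<lambda>i. b i x) [0..<n x]))"
  using polytime_nat_len[OF polytime_map_filter[OF assms polytime_Leaf]] by simp

lemma polytime_enc_nat: "polytime_nat n \<Longrightarrow> polytime (\<lambda>x. enc_nat (n x))"
  by (simp add: polytime_nat_def)

lemma polytime_enc_bool: "polytime_bool b \<Longrightarrow> polytime (\<lambda>x. enc_bool (b x))"
  by (simp add: polytime_bool_def)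

lemmas polytime_intros =
  polytime_id polytime_Leaf polytime_Pair polytime_left polytime_right polytime_If
  polytime_funpow_right polytime_map_filter polytime_map polytime_enc_nat polytime_enc_bool
  polytime_nat_0 polytime_nat_Suc polytime_nat_len polytime_nat_diff polytime_nat_count
  polytime_bool_nonempty polytime_bool_const polytime_bool_Not polytime_bool_conj
  polytime_bool_disj polytime_bool_imp polytime_bool_iff polytime_bool_less polytime_bool_eq
  polytime_bool_Ex polytime_bool_All

section \<open>Enumeration with polynomial delay\<close>

text \<open>
  The number \<open>a\<close> bounds the time before the first and after the last output: these two segments
  grow when traces are concatenated, while the delay \<open>d\<close> inside the trace does not.
\<close>

definition paced :: "nat \<Rightarrow> nat \<Rightarrow> event list \<Rightarrow> bool" where
  "paced a d tr \<longleftrightarrow>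
    (\<forall>ys zs. tr = ys @ zs \<and> outputs ys = [] \<longrightarrow> time ys \<le> a) \<and>
    (\<forall>xs ys. tr = xs @ ys \<and> outputs ys = [] \<longrightarrow> time ys \<le> a) \<and>
    delay_at_most d tr"

text \<open>A silent segment lies on one side of the seam or crosses it. In the latter case it is
  the silent end of the first trace followed by the silent beginning of the second.\<close>

lemma delay_at_most_append:
  assumes "delay_at_most d tr" "delay_at_most d tr'"
    and post: "\<And>xs ys. tr = xs @ ys \<Longrightarrow> outputs ys = [] \<Longrightarrow> time ys \<le> a"
    and pre: "\<And>ys zs. tr' = ys @ zs \<Longrightarrow> outputs ys = [] \<Longrightarrow> time ys \<le> b"
    and "a + b \<le> d"
  shows "delay_at_most d (tr @ tr')"
  unfolding delay_at_most_def
proof (intro allI impI, elim conjE)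
  fix xs ys zs assume eq: "tr @ tr' = xs @ ys @ zs" and out: "outputs ys = []"
  from append_eq_append_conv2[THEN iffD1, OF eq] obtain us where
    "tr = xs @ us \<and> us @ tr' = ys @ zs \<or> tr @ us = xs \<and> tr' = us @ ys @ zs" by blast
  then show "time ys \<le> d"
  proof (elim disjE conjE)
    assume tr: "tr = xs @ us" and "us @ tr' = ys @ zs"
    from append_eq_append_conv2[THEN iffD1, OF this(2)] obtain ws where
      "us = ys @ ws \<and> ws @ tr' = zs \<or> us @ ws = ys \<and> tr' = ws @ zs" by blast
    then show ?thesis
    proof (elim disjE conjE)
      assume "us = ys @ ws"
      with tr assms(1) out show ?thesis unfolding delay_at_most_def by blast
    next
      assume "us @ ws = ys" "tr' = ws @ zs"
      with pre[of ws zs] post[of xs us] tr out \<open>a + b \<le> d\<close> show ?thesis by auto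
    qed
  next
    assume "tr' = us @ ys @ zs"
    with assms(2) out show ?thesis unfolding delay_at_most_def by blast
  qed
qed

text \<open>As both traces contain an output, a silent beginning or end of the concatenation stays
  inside one of them. Only the gap across the seam adds up, and it is charged to
  \<open>d\<close>.\<close>

lemma paced_append:
  assumes "paced a d tr" "paced b d tr'" "outputs tr \<noteq> []" "outputs tr' \<noteq> []" "a + b \<le> d"
  shows "paced (max a b) d (tr @ tr')"
proof -
  have "time ys \<le> a" if "tr @ tr' = ys @ zs" "outputs ys = []" for ys zs
    using that assms(1,3) unfolding append_eq_append_conv2 paced_def by auto
  moreover have "time ys \<le> b" if "tr @ tr' = xs @ ys" "outputs ys = []" for xs ys
    using that assms(2,4) unfolding append_eq_append_conv2 paced_def by auto
  moreover have "delay_at_most d (tr @ tr')"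
    by (rule delay_at_most_append[of _ _ _ a b]) (use assms in \<open>auto simp: paced_def\<close>)
  ultimately show ?thesis unfolding paced_def by (meson max.coboundedI1 max.coboundedI2)
qed

lemma silent_segment:
  assumes "outputs s = []" "time s \<le> c" "s = xs @ ys @ zs"
  shows "time ys \<le> c"
  using assms by simp

lemma paced_silent_left:
  assumes "outputs s = []" "time s \<le> c" "paced a d tr" "outputs tr \<noteq> []" "a + c \<le> d"
  shows "paced (a + c) d (s @ tr)"
proof -
  have "time ys \<le> a + c" if "s @ tr = ys @ zs" "outputs ys = []" for ys zs
  proof -
    from append_eq_append_conv2[THEN iffD1, OF that(1)] obtain us where
      "s = ys @ us \<and> us @ tr = zs \<or> s @ us = ys \<and> tr = us @ zs" by blast
    then show ?thesis
    proof (elim disjE conjE)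
      assume "s @ us = ys" "tr = us @ zs"
      then have "time us \<le> a" using that(2) assms(3) unfolding paced_def by auto
      then show ?thesis using \<open>s @ us = ys\<close> assms(2) by auto
    qed (use assms(2) in auto)
  qed
  moreover have "time ys \<le> a + c" if "s @ tr = xs @ ys" "outputs ys = []" for xs ys
    using that assms(3,4) unfolding append_eq_append_conv2 paced_def by (auto intro: trans_le_add1)
  moreover have "delay_at_most d (s @ tr)"
  proof (rule delay_at_most_append[of _ _ _ c a])
    show "delay_at_most d s" using assms(1,2,5) silent_segment unfolding delay_at_most_def by fastforce
  qed (use assms in \<open>auto simp: paced_def add.commute\<close>)
  ultimately show ?thesis unfolding paced_def by blast
qed

lemma paced_silent_right:
  assumes "outputs s = []" "time s \<le> c" "paced a d tr" "outputs tr \<noteq> []" "a + c \<le> d"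
  shows "paced (a + c) d (tr @ s)"
proof -
  have "time ys \<le> a + c" if "tr @ s = xs @ ys" "outputs ys = []" for xs ys
  proof -
    from append_eq_append_conv2[THEN iffD1, OF that(1)] obtain us where
      "tr = xs @ us \<and> us @ s = ys \<or> tr @ us = xs \<and> s = us @ ys" by blast
    then show ?thesis
    proof (elim disjE conjE)
      assume "tr = xs @ us" "us @ s = ys"
      then have "time us \<le> a" using that(2) assms(3) unfolding paced_def by auto
      then show ?thesis using \<open>us @ s = ys\<close> assms(2) by auto
    qed (use assms(2) in auto)
  qed
  moreover have "time ys \<le> a + c" if "tr @ s = ys @ zs" "outputs ys = []" for ys zs
    using that assms(3,4) unfolding append_eq_append_conv2 paced_def by (auto intro: trans_le_add1)
  moreover have "delay_at_most d (tr @ s)"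
  proof (rule delay_at_most_append[of _ _ _ a c])
    show "delay_at_most d s" using assms(1,2,5) silent_segment unfolding delay_at_most_def by fastforce
  qed (use assms in \<open>auto simp: paced_def\<close>)
  ultimately show ?thesis unfolding paced_def by blast
qed

lemma paced_Out: "paced 0 d [Out v]"
  unfolding paced_def delay_at_most_def by (auto simp: append_eq_Cons_conv Cons_eq_append_conv)

lemma paced_mono: "paced a d tr \<Longrightarrow> a \<le> b \<Longrightarrow> paced b d tr"
  unfolding paced_def by (blast intro: order_trans)

lemma paced_single:
  assumes "paced a d tr" "outputs tr \<noteq> []" "outputs s = []" "outputs s' = []"
    and "time s + time s' \<le> T" "2 * a + T \<le> d"
  shows "paced (a + T) d (s @ tr @ s')"
proof -
  have "paced (a + time s') d (tr @ s')" using assms by (intro paced_silent_right) auto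
  then have "paced (a + time s' + time s) d (s @ tr @ s')"
    using paced_silent_left[of s "time s" "a + time s'" d "tr @ s'"] assms by simp
  then show ?thesis by (rule paced_mono) (use assms in auto)
qed

text \<open>A node with two recursive calls and own work \<open>T\<close>. Although there are two
  subtraces, the bound on the ends grows only from \<open>a\<close> to \<open>a + T\<close>: the
  ends that face each other meet in the middle and are paid for by \<open>d\<close>. Hence the ends
  grow linearly with the depth.\<close>

lemma paced_double:
  assumes "paced a d tr" "outputs tr \<noteq> []" "paced a d tr'" "outputs tr' \<noteq> []"
    and "outputs s = []" "outputs s' = []" "outputs s'' = []"
    and "time s + time s' + time s'' \<le> T" "2 * a + T \<le> d"
  shows "paced (a + T) d (s @ tr @ s' @ tr' @ s'')"
proof -
  have "paced (a + time s) d (s @ tr)" using assms by (intro paced_silent_left) auto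
  moreover have "paced (a + (time s' + time s'')) d (s' @ tr' @ s'')"
    using assms by (intro paced_single) auto
  ultimately have "paced (max (a + time s) (a + (time s' + time s''))) d ((s @ tr) @ (s' @ tr' @ s''))"
    using assms by (intro paced_append) auto
  then have "paced (a + T) d ((s @ tr) @ (s' @ tr' @ s''))" by (rule paced_mono) (use assms in auto)
  then show ?thesis by simp
qed

text \<open>
  A traversal of a binary tree of depth given by a unary number. At an inner node the left component
  of \<open>W\<close> tells whether to branch on the next bit and the right component is the bit used
  otherwise; at a leaf \<open>W\<close> is the output. As every subtree has a leaf, the delay is governed by the depth.
\<close>

fun enum_tree :: "(data \<Rightarrow> data) \<Rightarrow> data \<Rightarrow> data \<Rightarrow> data \<Rightarrow> data list" where
  "enum_tree W Leaf acc x = [W (Pair Leaf (Pair acc x))]"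
| "enum_tree W (Pair a b) acc x =
    (let w = W (Pair (Pair a b) (Pair acc x)) in
     if left w \<noteq> Leaf
     then enum_tree W b (Pair Leaf acc) x @ enum_tree W b (Pair (Pair Leaf Leaf) acc) x
     else enum_tree W b (Pair (right w) acc) x)"

lemma enum_tree_nonempty: "enum_tree W l acc x \<noteq> []"
  by (induction l arbitrary: acc) (auto simp: Let_def)

text \<open>The argument of a recursive call, built from the argument \<open>z\<close> of the
  current node: one cell is taken off the depth counter and the bit \<open>b\<close> is pushed onto
  the accumulator.\<close>

definition push_arg :: "expr \<Rightarrow> expr \<Rightarrow> expr" where
  "push_arg z b = PairE (RightE (LeftE z)) (PairE (PairE b (LeftE (RightE z))) (RightE (RightE z)))"

lemma eval_push_arg:
  assumes "eval P env z (Pair (Pair a l) (Pair acc x)) [charge (Pair (Pair a l) (Pair acc x))]"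
    and "eval P env b v tr" "outputs tr = []"
  obtains tr' where "eval P env (push_arg z b) (Pair l (Pair (Pair v acc) x)) tr'"
    "outputs tr' = []" "time tr' \<le> time tr + 20 * (size a + size l + size acc + size x + size v) + 50"
proof -
  note l = eval.LeftE[OF assms(1)] and r = eval.RightE[OF assms(1)]
  note p = eval.PairE[OF eval.RightE[OF l]
      eval.PairE[OF eval.PairE[OF assms(2) eval.LeftE[OF r]] eval.RightE[OF r]]]
  show ?thesis
  proof (rule that)
    show "eval P env (push_arg z b) (Pair l (Pair (Pair v acc) x))
      ((([charge (Pair (Pair a l) (Pair acc x))] @ [charge (Pair a l)]) @ [charge l]) @
       ((tr @ (([charge (Pair (Pair a l) (Pair acc x))] @ [charge (Pair acc x)]) @ [charge acc]) @ [charge (Pair v acc)]) @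
       (([charge (Pair (Pair a l) (Pair acc x))] @ [charge (Pair acc x)]) @ [charge x]) @
        [charge (Pair (Pair v acc) x)]) @ [charge (Pair l (Pair (Pair v acc) x))])"
      using p by (simp add: push_arg_def)
  qed (use assms(3) in auto)
qed

text \<open>The size bound on the bit chosen at an inner node keeps the accumulator linear in the
  depth, and so every call of \<open>W\<close> polynomial in the input.\<close>

lemma enum_tree_program:
  assumes "polytime W" "polytime g"
    and bit: "\<And>a b y. size (right (W (Pair (Pair a b) y))) \<le> 1"
  obtains P p where "\<And>x. \<exists>res tr. runs P x res tr \<and>
    outputs tr = enum_tree W (left (g x)) (left (right (g x))) (right (right (g x))) \<and>
    delay_at_most (poly p (size x)) tr"
proof -
  obtain P0 e0 p e0' p' where W0: "evals_within P0 e0 p W" and g0: "evals_within P0 e0' p' g"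
    using polytime2E[OF assms(1,2)] .
  define e where "e = shift 2 e0"
  define e' where "e' = shift 2 e0'"
  define body where "body =
    LetE e (IfE (LeftE (Var 1))
      (IfE (LeftE (Var 0))
        (LetE (Call 1 (push_arg (Var 1) LeafE)) (Call 1 (push_arg (Var 2) (PairE LeafE LeafE))))
        (Call 1 (push_arg (Var 1) (RightE (Var 0)))))
      (Emit (Var 0)))"
  define main where "main = LetE e'
    (Call 1 (PairE (LeftE (Var 0)) (PairE (LeftE (RightE (Var 0))) (RightE (RightE (Var 0))))))"
  define P where "P = [main, body] @ map (shift 2) P0"
  have W: "evals_within P e p W" and g: "evals_within P e' p' g"
    using evals_within_shift[OF W0, of "[main, body]"] evals_within_shift[OF g0, of "[main, body]"]
    by (simp_all add: P_def e_def e'_def numeral_2_eq_2)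
  have len: "0 < length P" "1 < length P" and nth: "P ! 0 = main" "P ! 1 = body"
    by (simp_all add: P_def)
  \<comment> \<open>Each level removes at least one from the size of the counter and adds at most
    two to that of the accumulator, which is why \<open>size l\<close> occurs twice in the bound for
    \<open>B\<close>. \<open>T\<close> covers the silent work of one node, so the ends amount to one
    \<open>T\<close> per level.\<close>
  have loop: "\<exists>tr. eval P [Pair l (Pair acc x)] body Leaf tr \<and> outputs tr = enum_tree W l acc x \<and>
      paced ((size l + 1) * T) D tr"
    if "size l + size acc + size x + size l + 4 \<le> B" "10 * poly p B + 100 * B + 100 \<le> T"
      "size l \<le> N" "2 * ((N + 1) * T) + T \<le> D" for l acc x B N T D
    using that(1,3)
  proof (induction l arbitrary: acc)
    case Leaf
    let ?z = "Pair Leaf (Pair acc x)"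
    let ?w = "W ?z"
    have zB: "size ?z \<le> B" using Leaf by simp
    then have pB: "poly p (size ?z) \<le> poly p B" by (rule poly_nat_mono)
    have wB: "size ?w \<le> poly p B" using evals_within_size[OF W, of ?z] pB by linarith
    obtain trw where trw: "eval P [?z] e ?w trw" "outputs trw = []" "time trw \<le> poly p (size ?z)"
      using W by (rule evals_withinE)
    let ?env = "[?w, ?z]"
    have v0: "eval P ?env (Var 0) ?w [charge ?w]" and v1: "eval P ?env (Var 1) ?z [charge ?z]"
      using eval.Var[of 0 ?env P] eval.Var[of 1 ?env P] by simp_all
    have t: "eval P ?env (LeftE (Var 1)) Leaf ([charge ?z] @ [charge Leaf])"
      using eval.LeftE[OF v1] by simp
    note ev = eval.LetE[OF trw(1) eval.IfFalse[OF t eval.Emit[OF v0]]]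
    let ?s = "trw @ [charge ?z, charge Leaf, charge ?w]" and ?s' = "replicate 3 (charge Leaf)"
    have D: "2 * 0 + T \<le> D" using that(4) by simp
    have "paced (0 + T) D (?s @ [Out ?w] @ ?s')"
      by (rule paced_single[OF paced_Out _ _ _ _ D])
        (use trw(2,3) pB wB zB that(2) in \<open>auto simp: numeral_3_eq_3\<close>)
    moreover have "eval P [?z] body Leaf (?s @ [Out ?w] @ ?s')"
      using ev by (simp add: body_def numeral_3_eq_3)
    ultimately show ?case using trw(2)
      by (intro exI[of _ "?s @ [Out ?w] @ ?s'"]) (auto simp: numeral_3_eq_3)
  next
    case (Pair a l)
    let ?z = "Pair (Pair a l) (Pair acc x)"
    let ?w = "W ?z"
    have zB: "size ?z \<le> B" using Pair.prems by simp
    then have pB: "poly p (size ?z) \<le> poly p B" by (rule poly_nat_mono)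
    have wB: "size ?w \<le> poly p B" using evals_within_size[OF W, of ?z] pB by linarith
    obtain trw where trw: "eval P [?z] e ?w trw" "outputs trw = []" "time trw \<le> poly p (size ?z)"
      using W by (rule evals_withinE)
    let ?env = "[?w, ?z]"
    have v0: "eval P ?env (Var 0) ?w [charge ?w]" and v1: "eval P ?env (Var 1) ?z [charge ?z]"
      using eval.Var[of 0 ?env P] eval.Var[of 1 ?env P] by simp_all
    have v2: "eval P (Leaf # ?env) (Var 2) ?z [charge ?z]"
      using eval.Var[of 2 "Leaf # ?env" P] by simp
    have t: "eval P ?env (LeftE (Var 1)) (Pair a l) ([charge ?z] @ [charge (Pair a l)])"
      using eval.LeftE[OF v1] by simp
    note c = eval.LeftE[OF v0]
    have child: "\<exists>tr. eval P [Pair l (Pair (Pair v acc) x)] (P ! 1) Leaf tr \<and>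
        outputs tr = enum_tree W l (Pair v acc) x \<and> paced ((size l + 1) * T) D tr" if "size v \<le> 1" for v
      using Pair.IH(2)[of "Pair v acc"] Pair.prems that unfolding nth by simp
    let ?a = "(size l + 1) * T"
    have "?a \<le> (N + 1) * T" using Pair.prems by (intro mult_right_mono) auto
    with that(4) have D: "2 * ?a + T \<le> D" by linarith
    have aT: "?a + T \<le> (size (Pair a l) + 1) * T" by (simp add: algebra_simps)
    have lw: "size (left ?w) \<le> poly p B" using size_left[of ?w] wB by linarith
    show ?case
    proof (cases "left ?w = Leaf")
      case True
      let ?v = "right ?w"
      have v: "size ?v \<le> 1" by (rule bit)
      obtain arg where arg: "eval P ?env (push_arg (Var 1) (RightE (Var 0))) (Pair l (Pair (Pair ?v acc) x)) arg"
        "outputs arg = []"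
        "time arg \<le> time ([charge ?w] @ [charge ?v]) + 20 * (size a + size l + size acc + size x + size ?v) + 50"
        by (rule eval_push_arg[OF v1 eval.RightE[OF v0]]) auto
      obtain tr where tr: "eval P [Pair l (Pair (Pair ?v acc) x)] (P ! 1) Leaf tr"
        "outputs tr = enum_tree W l (Pair ?v acc) x" "paced ?a D tr"
        using child[OF v] by blast
      have c': "eval P ?env (LeftE (Var 0)) Leaf ([charge ?w] @ [charge Leaf])" using c True by simp
      note ev = eval.LetE[OF trw(1) eval.IfTrue[OF t _ eval.IfFalse[OF c' eval.Call[OF arg(1) len(2) tr(1)]]]]
      let ?s = "trw @ [charge ?z, charge (Pair a l), charge ?w, charge Leaf] @ arg"
      let ?s' = "replicate 4 (charge Leaf)"
      have "paced (?a + T) D (?s @ tr @ ?s')"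
        by (rule paced_single[OF tr(3) _ _ _ _ D])
          (use trw(2,3) pB wB zB that(2) arg(2,3) v in \<open>auto simp: numeral_eq_Suc tr(2) enum_tree_nonempty\<close>)
      then have "paced ((size (Pair a l) + 1) * T) D (?s @ tr @ ?s')" using aT by (rule paced_mono)
      moreover have "eval P [?z] body Leaf (?s @ tr @ ?s')"
        using ev by (simp add: body_def numeral_eq_Suc)
      moreover have "outputs (?s @ tr @ ?s') = enum_tree W (Pair a l) acc x"
        using True trw(2) arg(2) tr(2) by (simp add: numeral_eq_Suc Let_def)
      ultimately show ?thesis by blast
    next
      case False
      obtain arg where arg: "eval P ?env (push_arg (Var 1) LeafE) (Pair l (Pair (Pair Leaf acc) x)) arg"
        "outputs arg = []"
        "time arg \<le> time [charge Leaf] + 20 * (size a + size l + size acc + size x + size Leaf) + 50"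
        by (rule eval_push_arg[OF v1 eval.LeafE]) auto
      obtain arg' where arg': "eval P (Leaf # ?env) (push_arg (Var 2) (PairE LeafE LeafE))
            (Pair l (Pair (Pair (Pair Leaf Leaf) acc) x)) arg'"
        "outputs arg' = []"
        "time arg' \<le> time ([charge Leaf] @ [charge Leaf] @ [charge (Pair Leaf Leaf)])
          + 20 * (size a + size l + size acc + size x + size (Pair Leaf Leaf)) + 50"
        by (rule eval_push_arg[OF v2 eval.PairE[OF eval.LeafE eval.LeafE]]) auto
      obtain tr where tr: "eval P [Pair l (Pair (Pair Leaf acc) x)] (P ! 1) Leaf tr"
        "outputs tr = enum_tree W l (Pair Leaf acc) x" "paced ?a D tr"
        using child[of Leaf] by auto
      obtain tr' where tr': "eval P [Pair l (Pair (Pair (Pair Leaf Leaf) acc) x)] (P ! 1) Leaf tr'"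
        "outputs tr' = enum_tree W l (Pair (Pair Leaf Leaf) acc) x" "paced ?a D tr'"
        using child[of "Pair Leaf Leaf"] by auto
      note ev = eval.LetE[OF trw(1) eval.IfTrue[OF t _ eval.IfTrue[OF c False
        eval.LetE[OF eval.Call[OF arg(1) len(2) tr(1)] eval.Call[OF arg'(1) len(2) tr'(1)]]]]]
      let ?s = "trw @ [charge ?z, charge (Pair a l), charge ?w, charge (left ?w)] @ arg"
      let ?s' = "charge Leaf # arg'"
      let ?s'' = "replicate 5 (charge Leaf)"
      have "paced (?a + T) D (?s @ tr @ ?s' @ tr' @ ?s'')"
        by (rule paced_double[OF tr(3) _ tr'(3) _ _ _ _ _ D])
          (use trw(2,3) pB wB lw zB that(2) arg(2,3) arg'(2,3) in
            \<open>auto simp: numeral_eq_Suc tr(2) tr'(2) enum_tree_nonempty\<close>)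
      then have "paced ((size (Pair a l) + 1) * T) D (?s @ tr @ ?s' @ tr' @ ?s'')" using aT by (rule paced_mono)
      moreover have "eval P [?z] body Leaf (?s @ tr @ ?s' @ tr' @ ?s'')"
        using ev by (simp add: body_def numeral_eq_Suc)
      moreover have "outputs (?s @ tr @ ?s' @ tr' @ ?s'') = enum_tree W (Pair a l) acc x"
        using False trw(2) arg(2) tr(2) arg'(2) tr'(2) by (simp add: numeral_eq_Suc Let_def)
      ultimately show ?thesis by blast
    qed
  qed
  define B where "B = 2 * p' + 4"
  define T where "T = 10 * pcompose p B + 100 * B + 100"
  define U where "U = p' + 100 * p' + 100 + [:0, 1:]"
  \<comment> \<open>Two facing ends of maximal length, the work of one node, and the set-up cost
    \<open>U\<close> for computing \<open>g x\<close> and unpacking it.\<close>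
  define D where "D = 2 * ((p' + 1) * T) + T + U"
  show thesis
  proof (rule that[of P D])
    fix x
    let ?y = "g x"
    let ?l = "left ?y" and ?acc = "left (right ?y)" and ?x = "right (right ?y)"
    let ?n = "size x"
    have y: "size ?y \<le> poly p' ?n" using evals_within_size[OF g] .
    have sz: "size ?l + size ?acc + size ?x \<le> size ?y"
      using size_left_right[of ?y] size_left_right[of "right ?y"] by linarith
    have "\<exists>tr. eval P [Pair ?l (Pair ?acc ?x)] body Leaf tr \<and> outputs tr = enum_tree W ?l ?acc ?x \<and>
      paced ((size ?l + 1) * poly T ?n) (poly D ?n) tr"
      by (rule loop[of _ _ _ "poly B ?n" _ "poly p' ?n"])
        (use y sz in \<open>auto simp: B_def T_def D_def poly_pcompose\<close>)
    then obtain tr where tr: "eval P [Pair ?l (Pair ?acc ?x)] (P ! 1) Leaf tr"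
        "outputs tr = enum_tree W ?l ?acc ?x" "paced ((size ?l + 1) * poly T ?n) (poly D ?n) tr"
      unfolding nth by blast
    obtain trg where trg: "eval P [x] e' ?y trg" "outputs trg = []" "time trg \<le> poly p' ?n"
      using g by (rule evals_withinE)
    note v = eval_Var_Cons[of P ?y "[x]"]
    note rv = eval.RightE[OF v]
    note arg = eval.PairE[OF eval.LeftE[OF v] eval.PairE[OF eval.LeftE[OF rv] eval.RightE[OF rv]]]
    have "eval P [x] (P ! 0) Leaf
       (trg @ ((([charge ?y] @ [charge ?l]) @ ((([charge ?y] @ [charge (right ?y)]) @ [charge ?acc]) @
         (([charge ?y] @ [charge (right ?y)]) @ [charge ?x]) @ [charge (Pair ?acc ?x)]) @
         [charge (Pair ?l (Pair ?acc ?x))]) @ tr @ [charge Leaf]) @ [charge Leaf])"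
      using eval.LetE[OF trg(1) eval.Call[OF arg len(2) tr(1)]] by (simp add: nth main_def)
    note ev = eval.Call[OF eval_Var_Cons[of P x "[]"] len(1) this]
    let ?s = "[charge x] @ trg @ [charge ?y, charge ?l, charge ?y, charge (right ?y), charge ?acc,
      charge ?y, charge (right ?y), charge ?x, charge (Pair ?acc ?x), charge (Pair ?l (Pair ?acc ?x))]"
    let ?s' = "replicate 3 (charge Leaf)"
    have run: "runs P x Leaf (?s @ tr @ ?s')"
      using ev by (simp add: runs_def numeral_eq_Suc)
    have "(size ?l + 1) * poly T ?n \<le> (poly p' ?n + 1) * poly T ?n"
      using sz y by (intro mult_right_mono) auto
    moreover have "poly D ?n = 2 * ((poly p' ?n + 1) * poly T ?n) + poly T ?n + poly U ?n"
      by (simp add: D_def)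
    ultimately have "2 * ((size ?l + 1) * poly T ?n) + poly U ?n \<le> poly D ?n" by linarith
    then have "paced ((size ?l + 1) * poly T ?n + poly U ?n) (poly D ?n) (?s @ tr @ ?s')"
      by (intro paced_single[OF tr(3)])
        (use trg(2,3) sz y size_right[of ?y] in \<open>auto simp: numeral_eq_Suc tr(2) enum_tree_nonempty U_def\<close>)
    then show "\<exists>res tr. runs P x res tr \<and> outputs tr = enum_tree W ?l ?acc ?x \<and>
        delay_at_most (poly D (size x)) tr"
      using run trg(2) tr(2) by (intro exI[of _ Leaf] exI[of _ "?s @ tr @ ?s'"])
        (simp add: paced_def numeral_eq_Suc)
  qed
qed

lemma polytime_program:
  assumes "polytime f"
  obtains P p where "\<And>x. \<exists>tr. runs P x (f x) tr \<and> time tr \<le> poly p (size x)"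
proof -
  obtain P0 e0 p where f0: "evals_within P0 e0 p f" using assms polytime_def by auto
  define P where "P = shift 1 e0 # map (shift 1) P0"
  have f: "evals_within P (shift 1 e0) p f" using evals_within_Cons[OF f0] by (simp add: P_def)
  show thesis
  proof (rule that[of P "2 * p + [:10, 10:]"])
    fix x
    obtain tr where tr: "eval P [x] (P ! 0) (f x) tr" "time tr \<le> poly p (size x)"
      using f evals_withinE[of P "shift 1 e0" p f x "[]"] by (auto simp: P_def)
    have "0 < length P" by (simp add: P_def)
    from eval.Call[OF eval_Var_Cons this tr(1)] tr(2) eval_size_less_time[OF tr(1)]
    show "\<exists>tr. runs P x (f x) tr \<and> time tr \<le> poly (2 * p + [:10, 10:]) (size x)"
      by (intro exI[of _ "[charge x] @ tr @ [charge (f x)]"]) (auto simp: runs_def)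
  qed
qed

section \<open>Twins and matching cuts\<close>

text \<open>Adjacency between \<open>u\<close> and \<open>v\<close> themselves is left open, so true
  and false twins are treated alike. The relation is an equivalence on \<open>V\<close> all the
  same.\<close>

definition twin :: "'a set \<Rightarrow> 'a set set \<Rightarrow> 'a \<Rightarrow> 'a \<Rightarrow> bool" where
  "twin V E u v \<longleftrightarrow> u \<in> V \<and> v \<in> V \<and> (\<forall>w\<in>V - {u, v}. {u, w} \<in> E \<longleftrightarrow> {v, w} \<in> E)"

lemma twin_refl: "v \<in> V \<Longrightarrow> twin V E v v"
  by (simp add: twin_def)

lemma twin_sym: "twin V E u v \<Longrightarrow> twin V E v u"
  by (auto simp: twin_def)

lemma twin_in: "twin V E u v \<Longrightarrow> u \<in> V \<and> v \<in> V"
  by (simp add: twin_def)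

lemma twinD: "twin V E u v \<Longrightarrow> w \<in> V \<Longrightarrow> w \<noteq> u \<Longrightarrow> w \<noteq> v \<Longrightarrow> {u, w} \<in> E \<longleftrightarrow> {v, w} \<in> E"
  by (simp add: twin_def)

lemma twin_trans:
  assumes "twin V E u v" "twin V E v w"
  shows "twin V E u w"
proof -
  have "{u, x} \<in> E \<longleftrightarrow> {w, x} \<in> E" if x: "x \<in> V" "x \<noteq> u" "x \<noteq> w" for x
  \<comment> \<open>For the middle vertex \<open>v\<close> neither hypothesis applies directly; its
    edges to \<open>u\<close> and to \<open>w\<close> are both compared with the edge
    \<open>{u, w}\<close>.\<close>
  proof (cases "x = v \<and> u \<noteq> w")
    case True
    then show ?thesis
      using twinD[OF assms(1), of w] twinD[OF assms(2), of u] assms x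
      by (auto simp: twin_in insert_commute dest: twin_in)
  next
    case False
    then show ?thesis
      using twinD[OF assms(1) x(1,2)] twinD[OF assms(2) x(1) _ x(3)] by blast
  qed
  with assms show ?thesis by (auto simp: twin_def)
qed

text \<open>One endpoint is replaced at a time, passing through \<open>{u, v'}\<close>. If this pair
  collapses, all four vertices are twins of each other, and the route goes through \<open>v\<close>
  and \<open>u'\<close> instead.\<close>

lemma twin_edge:
  assumes "twin V E u u'" "twin V E v v'" "u \<noteq> v" "u' \<noteq> v'"
  shows "{u, v} \<in> E \<longleftrightarrow> {u', v'} \<in> E"
proof (cases "u = v'")
  case False
  have "{v, u} \<in> E \<longleftrightarrow> {v', u} \<in> E"
    using twinD[OF assms(2), of u] assms twin_in[OF assms(1)] False by auto
  moreover have "{u, v'} \<in> E \<longleftrightarrow> {u', v'} \<in> E"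
    using twinD[OF assms(1), of v'] assms twin_in[OF assms(2)] False by auto
  ultimately show ?thesis by (simp add: insert_commute)
next
  case True
  have "twin V E v u'" using twin_trans assms True by metis
  from twinD[OF this, of u] show ?thesis
    using assms twin_in[OF assms(1)] True by (cases "v = u'") (auto simp: insert_commute)
qed

section \<open>Cuts given by one side, and their edges at twins\<close>

lemma simple_graph_edgeD:
  assumes "simple_graph V E" "{u, v} \<in> E"
  shows "u \<in> V" "v \<in> V" "u \<noteq> v"
  using assms unfolding simple_graph_def by force+

lemma simple_graph_edgeE:
  assumes "simple_graph V E" "e \<in> E"
  obtains u v where "e = {u, v}" "u \<in> V" "v \<in> V" "u \<noteq> v"
  using assms unfolding simple_graph_def by (metis card_2_iff insert_subset)

lemma matching_unique: "matching M \<Longrightarrow> {a, b} \<in> M \<Longrightarrow> {a, c} \<in> M \<Longrightarrow> b = c"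
  unfolding matching_def by (metis disjoint_iff doubleton_eq_iff insertI1)

lemma edge_in_cut_iff:
  assumes "A \<subseteq> V" "u \<in> V" "v \<in> V"
  shows "{u, v} \<in> edges_between E A (V - A) \<longleftrightarrow> {u, v} \<in> E \<and> (u \<in> A \<longleftrightarrow> v \<notin> A)"
  using assms unfolding edges_between_def by (auto simp: doubleton_eq_iff)

lemma matching_cut_iff:
  "matching_cut V E M \<longleftrightarrow>
    matching M \<and> (\<exists>A\<subseteq>V. A \<noteq> {} \<and> A \<noteq> V \<and> M = edges_between E A (V - A))"
proof -
  have part: "A \<noteq> B \<and> partition_on V {A, B} \<longleftrightarrow> A \<subseteq> V \<and> A \<noteq> {} \<and> A \<noteq> V \<and> B = V - A" for A B
    unfolding partition_on_def disjoint_def by auto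
  show ?thesis unfolding matching_cut_def using part by (metis (no_types, lifting))
qed

lemma matching_cut_subset: "matching_cut V E M \<Longrightarrow> M \<subseteq> E"
  unfolding matching_cut_def edges_between_def by auto

lemma incident_edgeE:
  assumes "simple_graph V E" "matching_cut V E M" "u \<in> \<Union>M"
  obtains w where "{u, w} \<in> M" "w \<in> V" "u \<in> V" "u \<noteq> w"
proof -
  from assms(3) obtain e where e: "e \<in> M" "u \<in> e" by blast
  with assms matching_cut_subset have "e \<in> E" by blast
  then obtain a b where "e = {a, b}" "a \<in> V" "b \<in> V" "a \<noteq> b" using simple_graph_edgeE assms(1) by metis
  with e that show ?thesis by (auto simp: insert_commute)
qed

text \<open>
  This is why three vertices per twin class suffice: a matching cut either avoids a class of at
  least three twins or cuts off a single one of them, and then the class consists of pendant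
  vertices.
\<close>

lemma cut_twins_pendant:
  assumes G: "simple_graph V E" and mc: "matching_cut V E M" and cw: "{c, w} \<in> M"
    and tw: "twin V E c c1" "twin V E c c2" "c \<noteq> c1" "c \<noteq> c2" "c1 \<noteq> c2"
    and d: "twin V E c d"
  shows "{d, x} \<in> E \<longleftrightarrow> x = w"
proof -
  from mc obtain A where A: "A \<subseteq> V" "M = edges_between E A (V - A)" and m: "matching M"
    unfolding matching_cut_iff by blast
  have ME: "{a, b} \<in> M \<longleftrightarrow> {a, b} \<in> E \<and> (a \<in> A \<longleftrightarrow> b \<notin> A)" if "a \<in> V" "b \<in> V" for a b
    using edge_in_cut_iff that A by metis
  have V: "c1 \<in> V" "c2 \<in> V" "c \<in> V" "d \<in> V" using tw d by (auto dest: twin_in)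
  have cwE: "{c, w} \<in> E" using cw matching_cut_subset[OF mc] by blast
  note w = simple_graph_edgeD[OF G cwE]
  have side: "c \<in> A \<longleftrightarrow> w \<notin> A" using ME w cw by blast
  \<comment> \<open>If \<open>w\<close> were the twin \<open>b\<close>, then \<open>c\<close>,
    \<open>b\<close>, \<open>b'\<close> would form a triangle whose vertices \<open>c\<close> and
    \<open>b\<close> are separated. Whichever side \<open>b'\<close> is on, a second cut edge meets
    \<open>{c, w}\<close>.\<close>
  have not_w: "w \<noteq> b" if "twin V E c b" "twin V E c b'" "c \<noteq> b" "c \<noteq> b'" "b \<noteq> b'" for b b'
  proof
    assume wb: "w = b"
    have bV: "b \<in> V" "b' \<in> V" using that by (auto dest: twin_in)
    have "{b', b} \<in> E" "{c, b'} \<in> E"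
      using twin_edge[of V E c b' b b] twin_edge[of V E c c b b'] that cwE wb twin_refl[of _ V E] V bV
        twin_trans[OF twin_sym] by metis+
    then show False
      using ME[of b' b] ME[of c b'] side that wb cw V bV matching_unique[OF m, of c b b']
        matching_unique[OF m, of b c b'] by (auto simp: insert_commute)
  qed
  have w12: "w \<noteq> c1" "w \<noteq> c2" using not_w tw by metis+
  have e12: "{c1, w} \<in> E" "{c2, w} \<in> E"
    using twinD[OF tw(1), of w] twinD[OF tw(2), of w] w w12 cwE by auto
  \<comment> \<open>Both twins are adjacent to \<open>w\<close>, whose only cut edge goes to
    \<open>c\<close>; so they lie on the side of \<open>w\<close>.\<close>
  have side12: "c1 \<in> A \<longleftrightarrow> w \<in> A" "c2 \<in> A \<longleftrightarrow> w \<in> A"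
    using ME[of c1 w] ME[of c2 w] V w e12 side tw cw matching_unique[OF m, of w c c1]
      matching_unique[OF m, of w c c2] by (auto simp: insert_commute)
  have no: "{c, c1} \<notin> E" "{c, c2} \<notin> E"
    using ME[of c c1] ME[of c c2] V side side12 cw w12 matching_unique[OF m, of c w c1]
      matching_unique[OF m, of c w c2] by auto
  \<comment> \<open>A further neighbor \<open>x\<close> of \<open>c\<close> would lie on the side of
    \<open>c\<close> and be adjacent to \<open>c1\<close> and \<open>c2\<close> on the other side,
    giving two cut edges at \<open>x\<close>. This is where one extra twin would not be
    enough.\<close>
  have only: "x = w" if "{c, x} \<in> E" for x
  proof (rule ccontr)
    assume "x \<noteq> w"
    note x = simple_graph_edgeD[OF G that]
    have "x \<noteq> c1" "x \<noteq> c2" using no that by auto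
    then have "{c1, x} \<in> E" "{c2, x} \<in> E" using twinD[OF tw(1), of x] twinD[OF tw(2), of x] x that by auto
    then show False
      using ME[of c x] ME[of c1 x] ME[of c2 x] x V side side12 that \<open>x \<noteq> w\<close> cw tw(5)
        matching_unique[OF m, of c w x] matching_unique[OF m, of x c1 c2]
      by (auto simp: insert_commute)
  qed
  have dw: "d \<noteq> w"
    using twin_edge[of V E c c d c1] d tw cwE no twin_refl[of c V E] V w
      twin_trans[OF twin_sym[OF d] tw(1)] by metis
  show ?thesis
  proof
    assume "x = w"
    then show "{d, x} \<in> E" using twinD[OF d, of w] w dw cwE by blast
  next
    assume dx: "{d, x} \<in> E"
    note x = simple_graph_edgeD[OF G dx]
    show "x = w"
    proof (cases "x = c")
      case True
      then have "{c, d} \<in> E" using dx by (simp add: insert_commute)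
      then show ?thesis using only dw by blast
    next
      case False
      then have "{c, x} \<in> E" using twinD[OF d, of x] x dx by blast
      then show ?thesis by (rule only)
    qed
  qed
qed

text \<open>The cut edges at \<open>c\<close> and at \<open>d\<close> both end in the only neighbor
  \<open>w\<close> of the class, and a matching has just one edge there.\<close>

lemma cut_twins_unique:
  assumes "simple_graph V E" "matching_cut V E M"
    and "twin V E c c1" "twin V E c c2" "c \<noteq> c1" "c \<noteq> c2" "c1 \<noteq> c2"
    and "twin V E c d" "c \<in> \<Union>M" "d \<in> \<Union>M"
  shows "c = d"
proof -
  obtain w where w: "{c, w} \<in> M" using incident_edgeE assms by metis
  obtain w' where w': "{d, w'} \<in> M" using incident_edgeE assms by metis
  then have "w' = w"
    using cut_twins_pendant[OF assms(1,2) w assms(3-8), of w'] matching_cut_subset[OF assms(2)] by blast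
  with w w' matching_unique[of M w c d] assms(2) show ?thesis
    by (auto simp: matching_cut_iff insert_commute)
qed

text \<open>
  All comparisons between the cuts of a graph and of its kernel are instances of this lemma.
\<close>

lemma matching_cut_pullback:
  assumes G1: "simple_graph V1 E1" and G2: "simple_graph V2 E2"
    and im: "\<tau> ` V1 \<subseteq> V2"
    and edge: "\<And>u v. u \<in> V1 \<Longrightarrow> v \<in> V1 \<Longrightarrow> \<tau> u \<noteq> \<tau> v \<Longrightarrow> {u, v} \<in> E1 \<longleftrightarrow> {\<tau> u, \<tau> v} \<in> E2"
    and A: "A \<subseteq> V2" and M: "M = edges_between E2 A (V2 - A)" "matching M"
    and inj: "\<And>u v. u \<in> V1 \<Longrightarrow> v \<in> V1 \<Longrightarrow> \<tau> u = \<tau> v \<Longrightarrow> \<tau> u \<in> \<Union>M \<Longrightarrow> u = v"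
    and ne: "\<exists>v\<in>V1. \<tau> v \<in> A" "\<exists>v\<in>V1. \<tau> v \<notin> A"
  shows "matching_cut V1 E1 {e \<in> E1. \<tau> ` e \<in> M}"
proof -
  let ?A = "{v \<in> V1. \<tau> v \<in> A}" and ?N = "{e \<in> E1. \<tau> ` e \<in> M}"
  have "e \<in> ?N \<longleftrightarrow> e \<in> edges_between E1 ?A (V1 - ?A)" for e
  proof (cases "e \<in> E1")
    case True
    then obtain u v where uv: "e = {u, v}" "u \<in> V1" "v \<in> V1" "u \<noteq> v" using simple_graph_edgeE G1 by metis
    have AV: "?A \<subseteq> V1" by auto
    have "{\<tau> u, \<tau> v} \<in> M \<longleftrightarrow> {\<tau> u, \<tau> v} \<in> E2 \<and> (\<tau> u \<in> A \<longleftrightarrow> \<tau> v \<notin> A)"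
      unfolding M by (rule edge_in_cut_iff) (use A im uv in auto)
    then show ?thesis
      unfolding uv(1) edge_in_cut_iff[OF AV uv(2,3)]
      using edge[OF uv(2,3)] uv by (cases "\<tau> u = \<tau> v") auto
  next
    case False
    then show ?thesis by (auto simp: edges_between_def)
  qed
  then have N: "?N = edges_between E1 ?A (V1 - ?A)" by blast
  have "matching ?N"
    unfolding matching_def
  proof (intro ballI impI, rule ccontr)
    fix e f assume e: "e \<in> ?N" and f: "f \<in> ?N" and "e \<noteq> f" "e \<inter> f \<noteq> {}"
    then obtain a where a: "a \<in> e" "a \<in> f" by blast
    obtain b where b: "e = {a, b}" "a \<in> V1" "b \<in> V1"
      using a e simple_graph_edgeE[OF G1] by (smt (verit) insertE insert_commute mem_Collect_eq singletonD)
    obtain c where c: "f = {a, c}" "c \<in> V1"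
      using a f simple_graph_edgeE[OF G1] by (smt (verit) insertE insert_commute mem_Collect_eq singletonD)
    \<comment> \<open>The images of the other two ends agree because \<open>M\<close> is a matching.
      Their common value is touched by \<open>M\<close>, so that injectivity, assumed only over
      touched vertices, applies.\<close>
    have "{\<tau> a, \<tau> b} \<in> M" "{\<tau> a, \<tau> c} \<in> M" using e f b c by auto
    then have "\<tau> b = \<tau> c" "\<tau> b \<in> \<Union>M" using matching_unique[OF M(2)] by auto
    then show False using inj b c \<open>e \<noteq> f\<close> by auto
  qed
  then show ?thesis
    unfolding matching_cut_iff using N ne by (intro conjI exI[of _ ?A]) auto
qed

lemma matching_cut_pullback_surj:
  assumes "simple_graph V1 E1" "simple_graph V2 E2" "\<tau> ` V1 = V2"
    and "\<And>u v. u \<in> V1 \<Longrightarrow> v \<in> V1 \<Longrightarrow> \<tau> u \<noteq> \<tau> v \<Longrightarrow> {u, v} \<in> E1 \<longleftrightarrow> {\<tau> u, \<tau> v} \<in> E2"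
    and "matching_cut V2 E2 M"
    and "\<And>u v. u \<in> V1 \<Longrightarrow> v \<in> V1 \<Longrightarrow> \<tau> u = \<tau> v \<Longrightarrow> \<tau> u \<in> \<Union>M \<Longrightarrow> u = v"
  shows "matching_cut V1 E1 {e \<in> E1. \<tau> ` e \<in> M}"
proof -
  from assms(5) obtain A where A: "A \<subseteq> V2" "A \<noteq> {}" "A \<noteq> V2" "M = edges_between E2 A (V2 - A)" "matching M"
    unfolding matching_cut_iff by blast
  show ?thesis
    by (rule matching_cut_pullback[OF assms(1,2) _ assms(4) A(1,4,5) assms(6)])
      (use A(1-3) assms(3) in blast)+
qed

text \<open>\<open>\<iota>\<close> embeds the kernel \<open>(W, F)\<close> as an induced subgraph
  and \<open>r\<close> retracts onto it along twins. The condition \<open>fibre_large\<close> is the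
  only trace of the number three: a class in which something is contracted has three vertices in the
  kernel. How these are chosen is irrelevant to the correspondence of cuts.\<close>

locale twin_kernel =
  fixes V :: "'a set" and E :: "'a set set" and W :: "'b set" and F :: "'b set set"
    and r :: "'a \<Rightarrow> 'b" and \<iota> :: "'b \<Rightarrow> 'a"
  assumes graph: "simple_graph V E"
    and r_in: "v \<in> V \<Longrightarrow> r v \<in> W"
    and \<iota>_in: "a \<in> W \<Longrightarrow> \<iota> a \<in> V"
    and r_\<iota>: "a \<in> W \<Longrightarrow> r (\<iota> a) = a"
    and F_eq: "F = {e. e \<subseteq> W \<and> \<iota> ` e \<in> E}"
    and fibre_twin: "u \<in> V \<Longrightarrow> v \<in> V \<Longrightarrow> r u = r v \<Longrightarrow> twin V E u v"
    and fibre_large: "u \<in> V \<Longrightarrow> v \<in> V \<Longrightarrow> r u = r v \<Longrightarrow> u \<noteq> v \<Longrightarrow>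
      \<exists>a\<in>W. \<exists>b\<in>W. \<exists>c\<in>W. a \<noteq> b \<and> a \<noteq> c \<and> b \<noteq> c \<and>
        twin V E u (\<iota> a) \<and> twin V E u (\<iota> b) \<and> twin V E u (\<iota> c)"
begin

definition contract :: "'a set set \<Rightarrow> 'b set set" where
  "contract M = (`) r ` M"

definition sect :: "('b \<Rightarrow> 'a) \<Rightarrow> bool" where
  "sect \<sigma> \<longleftrightarrow> (\<forall>a\<in>W. \<sigma> a \<in> V \<and> r (\<sigma> a) = a)"

lemma sect_\<iota>: "sect \<iota>"
  by (simp add: sect_def \<iota>_in r_\<iota>)

lemma sect_inj: "sect \<sigma> \<Longrightarrow> inj_on \<sigma> W"
  unfolding sect_def by (metis inj_onI)

lemma sect_twin: "sect \<sigma> \<Longrightarrow> a \<in> W \<Longrightarrow> twin V E (\<sigma> a) (\<iota> a)"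
  using fibre_twin \<iota>_in r_\<iota> unfolding sect_def by metis

lemma F_iff: "a \<in> W \<Longrightarrow> b \<in> W \<Longrightarrow> {a, b} \<in> F \<longleftrightarrow> {\<iota> a, \<iota> b} \<in> E"
  by (auto simp: F_eq)

text \<open>A section differs from \<open>\<iota>\<close> only by exchanging vertices for twins, so
  each section embeds the kernel as an induced subgraph.\<close>

lemma sect_edge:
  assumes "sect \<sigma>" "a \<in> W" "b \<in> W" "a \<noteq> b"
  shows "{a, b} \<in> F \<longleftrightarrow> {\<sigma> a, \<sigma> b} \<in> E"
  using twin_edge[OF sect_twin sect_twin, of \<sigma> a \<sigma> b] assms sect_inj[OF sect_\<iota>] sect_inj[OF assms(1)]
  by (auto simp: F_iff inj_on_eq_iff)

lemma graph_F: "simple_graph W F"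
proof -
  note inj = sect_inj[OF sect_\<iota>]
  have "finite W"
    using graph \<iota>_in finite_imageD[OF _ inj] finite_subset[of "\<iota> ` W" V]
    by (auto simp: simple_graph_def)
  moreover have "card e = 2" if "e \<in> F" for e
    using that graph card_image[OF inj_on_subset[OF inj]] by (auto simp: F_eq simple_graph_def)
  ultimately show ?thesis by (auto simp: simple_graph_def F_eq)
qed

lemma twin_F:
  assumes "a \<in> W" "b \<in> W" "twin V E (\<iota> a) (\<iota> b)"
  shows "twin W F a b"
  unfolding twin_def
proof (intro conjI ballI)
  fix c assume c: "c \<in> W - {a, b}"
  then have "\<iota> c \<noteq> \<iota> a" "\<iota> c \<noteq> \<iota> b" using assms r_\<iota> by (metis DiffD1 DiffD2 insertCI)+
  with twinD[OF assms(3), of "\<iota> c"] c assms \<iota>_in F_iff show "{a, c} \<in> F \<longleftrightarrow> {b, c} \<in> F" by auto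
qed (use assms in auto)

text \<open>Of the three kept twins at most one is \<open>u\<close> itself, so two others
  remain.\<close>

lemma fibre_large_twins:
  assumes "u \<in> V" "v \<in> V" "r u = r v" "u \<noteq> v"
  obtains c1 c2 where "twin V E u c1" "twin V E u c2" "u \<noteq> c1" "u \<noteq> c2" "c1 \<noteq> c2"
proof -
  obtain a b c where *: "a \<in> W" "b \<in> W" "c \<in> W" "a \<noteq> b" "a \<noteq> c" "b \<noteq> c"
    "twin V E u (\<iota> a)" "twin V E u (\<iota> b)" "twin V E u (\<iota> c)"
    using fibre_large[OF assms] by blast
  then have "\<iota> a \<noteq> \<iota> b" "\<iota> a \<noteq> \<iota> c" "\<iota> b \<noteq> \<iota> c" using r_\<iota> by metis+
  then show ?thesis using * that by metis
qed

lemma fibre_large_twins_F: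
  assumes "a \<in> W" "v \<in> V" "r v = a" "v \<noteq> \<iota> a"
  obtains b c where "twin W F a b" "twin W F a c" "a \<noteq> b" "a \<noteq> c" "b \<noteq> c"
proof -
  obtain b1 b2 b3 where *: "b1 \<in> W" "b2 \<in> W" "b3 \<in> W" "b1 \<noteq> b2" "b1 \<noteq> b3" "b2 \<noteq> b3"
    "twin V E (\<iota> a) (\<iota> b1)" "twin V E (\<iota> a) (\<iota> b2)" "twin V E (\<iota> a) (\<iota> b3)"
    using fibre_large[of "\<iota> a" v] assms \<iota>_in r_\<iota> by metis
  then show ?thesis using that twin_F[OF assms(1)] by metis
qed

section \<open>From cuts of the graph to cuts of the kernel\<close>

lemma incident_unique:
  assumes "matching_cut V E M" "u \<in> V" "v \<in> V" "r u = r v" "u \<in> \<Union>M" "v \<in> \<Union>M"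
  shows "u = v"
  using fibre_large_twins cut_twins_unique[OF graph assms(1)] fibre_twin assms by metis

lemma inj_on_incident: "matching_cut V E M \<Longrightarrow> inj_on r (\<Union>M)"
  using incident_unique matching_cut_subset[of V E M] graph
  by (intro inj_onI) (meson UnionE simple_graph_def subset_iff)

text \<open>A section through all touched vertices. For a matching cut the choice is unique, since a
  fibre contains at most one touched vertex; untouched fibres receive the kept vertex by
  default.\<close>

definition section_of :: "'a set set \<Rightarrow> 'b \<Rightarrow> 'a" where
  "section_of M a = (if \<exists>u\<in>\<Union>M. r u = a then SOME u. u \<in> \<Union>M \<and> r u = a else \<iota> a)"

lemma incident_in: "matching_cut V E M \<Longrightarrow> \<Union>M \<subseteq> V"
  using matching_cut_subset graph unfolding simple_graph_def by blast

lemma section_of: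
  assumes "matching_cut V E M"
  shows "sect (section_of M)" and "u \<in> \<Union>M \<Longrightarrow> section_of M (r u) = u"
proof -
  have *: "section_of M a \<in> \<Union>M \<and> r (section_of M a) = a" if "\<exists>u\<in>\<Union>M. r u = a" for a
    using that someI_ex[of "\<lambda>u. u \<in> \<Union>M \<and> r u = a"] by (auto simp: section_of_def)
  show "sect (section_of M)"
    unfolding sect_def
  proof
    fix a assume a: "a \<in> W"
    show "section_of M a \<in> V \<and> r (section_of M a) = a"
    proof (cases "\<exists>u\<in>\<Union>M. r u = a")
      case True
      then show ?thesis using * incident_in[OF assms] by blast
    next
      case False
      then have "section_of M a = \<iota> a" by (auto simp: section_of_def)
      then show ?thesis using a \<iota>_in r_\<iota> by simp
    qed
  qed
  show "section_of M (r u) = u" if "u \<in> \<Union>M"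
    using *[of "r u"] that inj_onD[OF inj_on_incident[OF assms]] by blast
qed

text \<open>Turns the image under \<open>r\<close> into a preimage under a section, the form to
  which \<open>matching_cut_pullback\<close> applies.\<close>

lemma contract_eq:
  assumes "matching_cut V E M"
  shows "contract M = {e \<in> F. section_of M ` e \<in> M}"
proof -
  note s = section_of[OF assms]
  have M: "e \<in> M \<Longrightarrow> section_of M ` r ` e = e" for e
    using s(2) by (force simp: image_image)
  have "r ` e \<in> F" if e: "e \<in> M" for e
  proof -
    obtain u v where uv: "e = {u, v}" "u \<in> V" "v \<in> V" "u \<noteq> v" "e \<in> E"
      using e assms matching_cut_subset simple_graph_edgeE[OF graph] by (metis subsetD)
    have uv': "u \<in> \<Union>M" "v \<in> \<Union>M" using e uv by auto
    then have "r u \<noteq> r v" using inj_onD[OF inj_on_incident[OF assms]] uv by blast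
    then show ?thesis
      using sect_edge[OF s(1), of "r u" "r v"] s(2) uv uv' r_in by simp
  qed
  moreover have "e \<in> contract M" if "e \<in> F" "section_of M ` e \<in> M" for e
  proof -
    have "r ` section_of M ` e = e"
      using that(1) s(1) by (force simp: F_eq sect_def image_image)
    then show ?thesis using that(2) unfolding contract_def by (metis imageI)
  qed
  ultimately show ?thesis using M by (auto simp: contract_def)
qed

text \<open>Restricting the two sides to the kept vertices works unless all of these lie on one
  side. The other side then contains a contracted vertex separated from its kept twin, so its whole
  class is isolated and a single kept vertex of it can be split off.\<close>

lemma contract_empty_cut:
  assumes "matching_cut V E {}"
  shows "matching_cut W F {}"
proof -
  from assms obtain A where A: "A \<subseteq> V" "A \<noteq> {}" "A \<noteq> V" "{} = edges_between E A (V - A)"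
    unfolding matching_cut_iff by blast
  have nocut: "u \<in> A \<longleftrightarrow> v \<in> A" if "{u, v} \<in> E" for u v
    using edge_in_cut_iff[OF A(1), of u v E] A(4) simple_graph_edgeD[OF graph that] that by blast
  show ?thesis
  proof (cases "\<exists>s. \<forall>a\<in>W. (\<iota> a \<in> A) = s")
    case True
    then obtain s where s: "\<And>a. a \<in> W \<Longrightarrow> (\<iota> a \<in> A) = s" by blast
    obtain v where v: "v \<in> V" "(v \<in> A) \<noteq> s" using A(1-3) by blast
    let ?u = "\<iota> (r v)"
    have u: "?u \<in> V" "(?u \<in> A) = s" "r ?u = r v" using v r_in \<iota>_in r_\<iota> s by auto
    then have uv: "?u \<noteq> v" using v by metis
    have tw: "twin V E v ?u" using fibre_twin u v by metis
    \<comment> \<open>A neighbor of \<open>v\<close> would be on the side of \<open>v\<close> and,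
      by twinship, also adjacent to \<open>?u\<close> on the other side, but no edge
      crosses.\<close>
    have iso: "{v, w} \<notin> E" for w
    proof
      assume vw: "{v, w} \<in> E"
      note w = simple_graph_edgeD[OF graph vw]
      have side: "(w \<in> A) \<noteq> s" using nocut[OF vw] v by blast
      then have "w \<noteq> ?u" using u by blast
      then have "{?u, w} \<in> E" using twinD[OF tw, of w] w vw by blast
      then show False using nocut[of ?u w] side u by blast
    qed
    obtain a b c where abc: "a \<in> W" "b \<in> W" "a \<noteq> b" "twin V E v (\<iota> a)"
      using fibre_large[of v ?u] u uv v by metis
    have "{\<iota> a, x} \<notin> E" for x
    proof
      assume ax: "{\<iota> a, x} \<in> E"
      then have "{v, x} \<in> E"
        using iso[of "\<iota> a"] twinD[OF abc(4), of x] simple_graph_edgeD[OF graph ax]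
        by (cases "x = v") (auto simp: insert_commute)
      then show False using iso by blast
    qed
    then have "edges_between F {a} (W - {a}) = {}"
      by (auto simp: edges_between_def F_eq)
    moreover have "{a} \<noteq> W" using abc by blast
    ultimately show ?thesis
      unfolding matching_cut_iff by (intro conjI exI[of _ "{a}"]) (simp_all add: abc matching_def)
  next
    case False
    have "matching_cut W F {e \<in> F. \<iota> ` e \<in> {}}"
    proof (rule matching_cut_pullback[OF graph_F graph _ _ A(1,4)])
      show "{u, v} \<in> F \<longleftrightarrow> {\<iota> u, \<iota> v} \<in> E" if "u \<in> W" "v \<in> W" for u v
        using F_iff that .
    qed (use False \<iota>_in in \<open>auto simp: matching_def\<close>)
    then show ?thesis by simp
  qed
qed

text \<open>If there is a cut edge, its two ends lie in the range of the section, so neither side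
  becomes empty in the kernel.\<close>

lemma contract_matching_cut:
  assumes "matching_cut V E M"
  shows "matching_cut W F (contract M)"
proof (cases "M = {}")
  case True
  then show ?thesis using contract_empty_cut assms by (simp add: contract_def)
next
  case False
  let ?s = "section_of M"
  note s = section_of[OF assms]
  from assms obtain A where A: "A \<subseteq> V" "M = edges_between E A (V - A)" and m: "matching M"
    unfolding matching_cut_iff by blast
  from False obtain a b where ab: "{a, b} \<in> M" "a \<in> A" "b \<notin> A" "a \<in> V" "b \<in> V"
    using A unfolding edges_between_def by blast
  show ?thesis
    unfolding contract_eq[OF assms]
  proof (rule matching_cut_pullback[OF graph_F graph _ _ A m])
    show "?s ` W \<subseteq> V" using s(1) by (auto simp: sect_def)
    show "{u, v} \<in> F \<longleftrightarrow> {?s u, ?s v} \<in> E" if "u \<in> W" "v \<in> W" "?s u \<noteq> ?s v" for u v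
      using sect_edge[OF s(1)] that by blast
    show "u = v" if "u \<in> W" "v \<in> W" "?s u = ?s v" for u v
      using sect_inj[OF s(1)] that by (meson inj_onD)
    have "a \<in> \<Union>M" "b \<in> \<Union>M" using ab by auto
    then show "\<exists>v\<in>W. ?s v \<in> A" "\<exists>v\<in>W. ?s v \<notin> A"
      using s(2) r_in ab by metis+
  qed
qed

section \<open>From cuts of the kernel to cuts of the graph\<close>

definition lift :: "('b \<Rightarrow> 'a) \<Rightarrow> 'b set set \<Rightarrow> 'a set set" where
  "lift \<sigma> M = (`) \<sigma> ` M"

lemma contract_lift:
  assumes "sect \<sigma>" "matching_cut W F M"
  shows "contract (lift \<sigma> M) = M"
proof -
  have "r ` \<sigma> ` e = e" if "e \<in> M" for e
  proof -
    have "e \<subseteq> W" using that matching_cut_subset[OF assms(2)] by (auto simp: F_eq)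
    then show ?thesis using assms(1) by (force simp: sect_def image_image)
  qed
  then show ?thesis unfolding contract_def lift_def image_image by simp
qed

lemma lift_contract:
  assumes "matching_cut V E M"
  shows "lift (section_of M) (contract M) = M"
proof -
  have "section_of M ` r ` e = e" if "e \<in> M" for e
    using that section_of(2)[OF assms] by (force simp: image_image)
  then show ?thesis unfolding contract_def lift_def image_image by simp
qed

text \<open>The cut is pulled back along a map \<open>\<tau>\<close> instead of \<open>r\<close>,
  because \<open>r\<close> sends all vertices of a touched fibre to the same touched vertex.
  \<open>\<tau>\<close> follows \<open>r\<close> on the selected touched vertices and diverts the
  others to untouched kept twins.\<close>

lemma lift_matching_cut:
  assumes \<sigma>: "sect \<sigma>" and M: "matching_cut W F M"
  shows "matching_cut V E (lift \<sigma> M)"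
proof -
  let ?I = "\<Union>M"
  have IW: "?I \<subseteq> W" using matching_cut_subset[OF M] by (auto simp: F_eq)
  \<comment> \<open>In a touched fibre with a second vertex the class has three vertices in the
    kernel, and \<open>M\<close> touches at most one of them.\<close>
  have free: "\<exists>a\<in>W. a \<notin> ?I \<and> twin V E (\<iota> a) v" if v: "v \<in> V" "\<not> (v = \<sigma> (r v) \<and> r v \<in> ?I)" for v
  proof (cases "r v \<in> ?I")
    case False
    then show ?thesis using v r_in[of v] \<iota>_in r_\<iota> fibre_twin by metis
  next
    case True
    then have "\<sigma> (r v) \<noteq> v" "\<sigma> (r v) \<in> V" "r (\<sigma> (r v)) = r v" using v \<sigma> r_in by (auto simp: sect_def)
    then obtain a b c where abc: "a \<in> W" "b \<in> W" "c \<in> W" "a \<noteq> b" "a \<noteq> c" "b \<noteq> c"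
      "twin V E v (\<iota> a)" "twin V E v (\<iota> b)" "twin V E v (\<iota> c)"
      using fibre_large[of v "\<sigma> (r v)"] v by metis
    have "twin W F a b" "twin W F a c"
      using twin_F twin_trans[OF twin_sym[OF abc(7)]] abc by metis+
    then have "a \<notin> ?I \<or> b \<notin> ?I" using cut_twins_unique[OF graph_F M, of a b c b] abc by metis
    then show ?thesis using abc twin_sym by metis
  qed
  \<comment> \<open>The middle case fixes the untouched kept vertices, which makes
    \<open>\<tau>\<close> surjective and thus keeps both sides nonempty.\<close>
  define \<tau> where "\<tau> v =
    (if v = \<sigma> (r v) \<and> r v \<in> ?I then r v
     else if v = \<iota> (r v) \<and> r v \<notin> ?I then r v
     else SOME a. a \<in> W \<and> a \<notin> ?I \<and> twin V E (\<iota> a) v)" for v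
  have \<tau>: "\<tau> v \<in> W \<and> twin V E (\<iota> (\<tau> v)) v \<and> (\<tau> v \<in> ?I \<longrightarrow> v = \<sigma> (\<tau> v))" if v: "v \<in> V" for v
  proof -
    have tw: "twin V E (\<iota> (r v)) v" using v r_in[of v] \<iota>_in r_\<iota> fibre_twin by metis
    show ?thesis
    proof (cases "v = \<sigma> (r v) \<and> r v \<in> ?I")
      case True
      then show ?thesis using tw v r_in by (auto simp: \<tau>_def)
    next
      case False
      have "\<exists>a. a \<in> W \<and> a \<notin> ?I \<and> twin V E (\<iota> a) v" using free[OF v False] by blast
      from someI_ex[OF this] False show ?thesis using tw v r_in[of v] by (auto simp: \<tau>_def)
    qed
  qed
  have surj: "\<exists>v\<in>V. \<tau> v = a" if "a \<in> W" for a
  proof (cases "a \<in> ?I")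
    case True
    then have "\<tau> (\<sigma> a) = a" using \<sigma> that by (auto simp: \<tau>_def sect_def)
    then show ?thesis using \<sigma> that by (auto simp: sect_def)
  next
    case False
    then have "\<tau> (\<iota> a) = a" using that r_\<iota> by (auto simp: \<tau>_def)
    then show ?thesis using \<iota>_in that by blast
  qed
  have "matching_cut V E {e \<in> E. \<tau> ` e \<in> M}"
  proof (rule matching_cut_pullback_surj[OF graph graph_F _ _ M])
    show "\<tau> ` V = W" using \<tau> surj by blast
    show "{u, v} \<in> E \<longleftrightarrow> {\<tau> u, \<tau> v} \<in> F" if "u \<in> V" "v \<in> V" "\<tau> u \<noteq> \<tau> v" for u v
    proof -
      have "\<iota> (\<tau> u) \<noteq> \<iota> (\<tau> v)" using that \<tau> r_\<iota> by metis
      then show ?thesis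
        using that \<tau>[of u] \<tau>[of v] twin_edge[of V E "\<iota> (\<tau> u)" u "\<iota> (\<tau> v)" v] F_iff by blast
    qed
    show "u = v" if "u \<in> V" "v \<in> V" "\<tau> u = \<tau> v" "\<tau> u \<in> ?I" for u v
      using \<tau>[of u] \<tau>[of v] that by metis
  qed
  moreover have "{e \<in> E. \<tau> ` e \<in> M} = lift \<sigma> M"
  proof (intro equalityI subsetI)
    fix e assume "e \<in> {e \<in> E. \<tau> ` e \<in> M}"
    then have e: "e \<in> E" "\<tau> ` e \<in> M" by auto
    then have "e \<subseteq> V" using graph by (auto simp: simple_graph_def)
    then have "\<sigma> (\<tau> v) = v" if "v \<in> e" for v using \<tau>[of v] e(2) that by (metis UnionI image_eqI subsetD)
    then have "\<sigma> ` \<tau> ` e = e" by (force simp: image_image)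
    then show "e \<in> lift \<sigma> M" using e(2) unfolding lift_def by (metis imageI)
  next
    fix e assume "e \<in> lift \<sigma> M"
    then obtain e' where e': "e' \<in> M" "e = \<sigma> ` e'" by (auto simp: lift_def)
    have e'F: "e' \<in> F" using e' matching_cut_subset[OF M] by blast
    then obtain a b where ab: "e' = {a, b}" "a \<in> W" "b \<in> W" "a \<noteq> b" using simple_graph_edgeE[OF graph_F] by metis
    have "\<tau> (\<sigma> a) = a" "\<tau> (\<sigma> b) = b" using \<sigma> ab e' by (auto simp: \<tau>_def sect_def)
    then have "\<tau> ` e = e'" using ab e' by simp
    moreover have "e \<in> E" using sect_edge[OF \<sigma> ab(2-4)] ab e'F e' by simp
    ultimately show "e \<in> {e \<in> E. \<tau> ` e \<in> M}" using e' by simp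
  qed
  ultimately show ?thesis by simp
qed

section \<open>Minimal and maximal cuts, and the fibres of the contraction\<close>

lemma contract_strict_mono:
  assumes "matching_cut V E M" "N \<subset> M"
  shows "contract N \<subset> contract M"
proof -
  have "inj_on ((`) r) M"
    using inj_on_image_eq_iff[OF inj_on_incident[OF assms(1)]] by (intro inj_onI) blast
  with assms(2) show ?thesis unfolding contract_def by (intro image_strict_mono)
qed

lemma lift_strict_mono:
  assumes "sect \<sigma>" "matching_cut W F M" "N \<subset> M"
  shows "lift \<sigma> N \<subset> lift \<sigma> M"
proof -
  have "inj_on ((`) \<sigma>) M"
    using inj_on_image_eq_iff[OF sect_inj[OF assms(1)]] matching_cut_subset[OF assms(2)]
    by (intro inj_onI) (simp add: F_eq subset_iff)
  with assms(3) show ?thesis unfolding lift_def by (intro image_strict_mono)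
qed

text \<open>A smaller cut of the kernel is lifted along the section through \<open>M\<close> itself.
  This section takes \<open>contract M\<close> back to \<open>M\<close>, so the strict inclusion is
  preserved; the same works for larger cuts.\<close>

lemma minimal_matching_cut_contract:
  assumes "matching_cut V E M"
  shows "minimal_matching_cut V E M \<longleftrightarrow> minimal_matching_cut W F (contract M)"
  unfolding minimal_matching_cut_def
  using assms contract_matching_cut contract_strict_mono[OF assms] lift_contract[OF assms]
    lift_matching_cut[OF section_of(1)[OF assms]] lift_strict_mono[OF section_of(1)[OF assms]]
  by metis

lemma maximal_matching_cut_contract:
  assumes "matching_cut V E M"
  shows "maximal_matching_cut V E M \<longleftrightarrow> maximal_matching_cut W F (contract M)"
  unfolding maximal_matching_cut_def
  using assms contract_matching_cut contract_strict_mono lift_contract[OF assms]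
    lift_matching_cut[OF section_of(1)[OF assms]] lift_strict_mono[OF section_of(1)[OF assms]]
  by metis

lemma contract_fibre:
  assumes "matching_cut W F M"
  shows "{N. matching_cut V E N \<and> contract N = M} = {lift \<sigma> M |\<sigma>. sect \<sigma>}"
  using assms contract_lift lift_matching_cut lift_contract section_of(1) by blast

text \<open>
  A minimal cut of the kernel that touches a class with contracted vertices is a single pendant edge,
  so at most one vertex can be exchanged.
\<close>

lemma minimal_contract_fibre:
  assumes "minimal_matching_cut W F M"
  shows "{N. matching_cut V E N \<and> contract N = M} =
    insert (lift \<iota> M) {lift (\<iota>(r v := v)) M |v. v \<in> V \<and> v \<noteq> \<iota> (r v) \<and> r v \<in> \<Union>M}"
proof -
  have M: "matching_cut W F M" using assms by (simp add: minimal_matching_cut_def)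
  have "lift \<sigma> M = lift \<iota> M \<or> (\<exists>v\<in>V. v \<noteq> \<iota> (r v) \<and> r v \<in> \<Union>M \<and> lift \<sigma> M = lift (\<iota>(r v := v)) M)"
    if \<sigma>: "sect \<sigma>" for \<sigma>
  proof (cases "\<forall>a\<in>\<Union>M. \<sigma> a = \<iota> a")
    case True
    then show ?thesis unfolding lift_def by (intro disjI1 image_cong) auto
  next
    case False
    then obtain a where a: "a \<in> \<Union>M" "\<sigma> a \<noteq> \<iota> a" by blast
    obtain w where w: "{a, w} \<in> M" "w \<in> W" "a \<in> W" "a \<noteq> w" using incident_edgeE[OF graph_F M a(1)] .
    have \<sigma>a: "\<sigma> a \<in> V" "r (\<sigma> a) = a" using \<sigma> w by (auto simp: sect_def)
    obtain b c where bc: "twin W F a b" "twin W F a c" "a \<noteq> b" "a \<noteq> c" "b \<noteq> c"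
      using fibre_large_twins_F[OF w(3) \<sigma>a a(2)] .
    note pend = cut_twins_pendant[OF graph_F M w(1) bc]
    have aF: "{a, x} \<in> F \<longleftrightarrow> x = w" for x
      by (rule pend[OF twin_refl[OF w(3)]])
    have "e \<in> edges_between F {a} (W - {a}) \<longleftrightarrow> e = {a, w}" for e
    proof
      assume "e \<in> edges_between F {a} (W - {a})"
      then obtain b where "e = {a, b}" "{a, b} \<in> F" unfolding edges_between_def by blast
      then show "e = {a, w}" using aF[of b] by simp
    next
      assume "e = {a, w}"
      then show "e \<in> edges_between F {a} (W - {a})"
        using aF[of w] w(2,4) unfolding edges_between_def by blast
    qed
    then have "edges_between F {a} (W - {a}) = {{a, w}}" by blast
    moreover have "{a} \<noteq> W" using w by blast
    ultimately have "matching_cut W F {{a, w}}"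
      unfolding matching_cut_iff by (intro conjI exI[of _ "{a}"]) (simp_all add: w matching_def)
    \<comment> \<open>The pendant edge alone is already a matching cut, so minimality leaves nothing
      else in \<open>M\<close>.\<close>
    then have Meq: "M = {{a, w}}" using assms w(1) unfolding minimal_matching_cut_def by blast
    \<comment> \<open>Otherwise \<open>w\<close> would also have two further twins in the kernel,
      and these would be additional neighbors of \<open>a\<close>.\<close>
    have "\<sigma> w = \<iota> w"
    proof (rule ccontr)
      assume "\<sigma> w \<noteq> \<iota> w"
      moreover have "\<sigma> w \<in> V" "r (\<sigma> w) = w" using \<sigma> w by (auto simp: sect_def)
      ultimately obtain b' c' where bc': "twin W F w b'" "twin W F w c'" "w \<noteq> b'" "w \<noteq> c'" "b' \<noteq> c'"
        using fibre_large_twins_F[OF w(2)] by metis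
      have "{w, a} \<in> M" using w by (simp add: insert_commute)
      from cut_twins_pendant[OF graph_F M this bc' bc'(1), of a]
      have "{a, b'} \<in> F" by (simp add: insert_commute)
      then show False using aF[of b'] bc'(3) by simp
    qed
    then have "lift \<sigma> M = lift (\<iota>(r (\<sigma> a) := \<sigma> a)) M" using \<sigma>a w by (simp add: Meq lift_def insert_commute)
    then show ?thesis using \<sigma>a a by metis
  qed
  moreover have "sect (\<iota>(r v := v))" if "v \<in> V" for v
    using that \<iota>_in r_\<iota> by (auto simp: sect_def)
  ultimately show ?thesis unfolding contract_fibre[OF M] using sect_\<iota> by blast
qed

end

section \<open>Programs for the kernel and for lifting\<close>

lemma polytime_nat_const: "polytime_nat (\<lambda>x. c)"
  by (induction c) (auto intro: polytime_nat_0 polytime_nat_Suc)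

lemma polytime_nat_comp: "polytime_nat n \<Longrightarrow> polytime g \<Longrightarrow> polytime_nat (\<lambda>x. n (g x))"
  unfolding polytime_nat_def by (rule polytime_comp)

lemma polytime_nat_add:
  assumes "polytime_nat m" "polytime_nat n"
  shows "polytime_nat (\<lambda>x. m x + n x)"
proof -
  have "polytime (\<lambda>x. foldr (\<lambda>i acc. Pair Leaf acc) [0..<m x] (enc_nat (n x)))"
    by (rule polytime_foldr_upt[OF assms(1) assms(2)[unfolded polytime_nat_def], where q = 1])
      (auto intro!: polytime_intros)
  moreover have "foldr (\<lambda>i acc. Pair Leaf acc) [0..<k] (enc_nat l) = enc_nat (k + l)" for k l
    by (induction k arbitrary: l) (auto simp flip: enc_nat_Suc)
  ultimately show ?thesis by (simp add: polytime_nat_def)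
qed

lemma polytime_nat_mult:
  assumes "polytime_nat m" "polytime_nat n"
  shows "polytime_nat (\<lambda>x. m x * n x)"
proof -
  obtain p where p: "n x \<le> poly p (size x)" for x
    using polytime_size[OF assms(2)[unfolded polytime_nat_def]] by auto
  have bound: "len acc + n x \<le> size acc + poly p (i + size x)" for acc x i
    using p[of x] len_le_size[of acc] poly_nat_mono[of "size x" "i + size x" p] by linarith
  have "polytime (\<lambda>x. foldr (\<lambda>i acc. enc_nat (len acc + n x)) [0..<m x] Leaf)"
    by (rule polytime_foldr_upt[OF assms(1) polytime_Leaf, where q = p])
      (simp_all add: bound, intro polytime_intros polytime_nat_add polytime_nat_comp[OF assms(2)])
  moreover have "foldr (\<lambda>i acc. enc_nat (len acc + l)) [0..<k] (enc_nat c) = enc_nat (k * l + c)" for k l c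
    by (induction k arbitrary: c) (auto simp: algebra_simps)
  from this[of _ _ 0] have "foldr (\<lambda>i acc. enc_nat (len acc + l)) [0..<k] Leaf = enc_nat (k * l)" for k l
    by simp
  ultimately show ?thesis by (simp add: polytime_nat_def)
qed

definition bit_at :: "data \<Rightarrow> nat \<Rightarrow> bool" where
  "bit_at d i \<longleftrightarrow> left ((right ^^ i) d) \<noteq> Leaf"

definition entry :: "data \<Rightarrow> nat \<Rightarrow> nat \<Rightarrow> bool" where
  "entry d i j \<longleftrightarrow> bit_at (left ((right ^^ i) d)) j"

definition twins :: "nat \<Rightarrow> (nat \<Rightarrow> nat \<Rightarrow> bool) \<Rightarrow> nat \<Rightarrow> nat \<Rightarrow> bool" where
  "twins n g i j \<longleftrightarrow> (\<forall>k<n. k = i \<or> k = j \<or> (g i k \<longleftrightarrow> g j k))"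

definition kept :: "nat \<Rightarrow> (nat \<Rightarrow> nat \<Rightarrow> bool) \<Rightarrow> nat \<Rightarrow> bool" where
  "kept n g i \<longleftrightarrow> length (filter (\<lambda>j. twins n g j i) [0..<i]) < 3"

text \<open>
  The kernel vertex onto which \<open>v\<close> is contracted: \<open>v\<close> itself if it is kept and its smallest twin
  otherwise.
\<close>

definition rank :: "nat \<Rightarrow> (nat \<Rightarrow> nat \<Rightarrow> bool) \<Rightarrow> nat \<Rightarrow> nat" where
  "rank n g v = length (filter (\<lambda>u. kept n g u \<and>
    (kept n g v \<longrightarrow> u < v) \<and> (\<not> kept n g v \<longrightarrow> \<not> (\<exists>t<Suc u. twins n g t v))) [0..<v])"

definition kernel_data :: "data \<Rightarrow> data" where
  "kernel_data d =
    enc_list (map (\<lambda>i. enc_list (map (\<lambda>j. enc_bool (entry d i j))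
        (filter (\<lambda>j. kept (len d) (entry d) j) [0..<len d])))
      (filter (\<lambda>i. kept (len d) (entry d) i) [0..<len d]))"

definition touched :: "data \<Rightarrow> nat \<Rightarrow> bool" where
  "touched s a \<longleftrightarrow> (\<exists>b<len s. entry s a b)"

text \<open>\<open>act\<close> is the characteristic function of the range of a section; the section
  itself is never tabulated.\<close>

definition lift_data :: "data \<Rightarrow> data \<Rightarrow> (nat \<Rightarrow> bool) \<Rightarrow> data" where
  "lift_data d s act =
    enc_list (map (\<lambda>i. enc_list (map (\<lambda>j. enc_bool (act i \<and> act j \<and>
        entry s (rank (len d) (entry d) i) (rank (len d) (entry d) j))) [0..<len d])) [0..<len d])"

text \<open>The head belongs to the section of kept vertices. The condition on \<open>i\<close> in
  the other items describes the range of that section after moving the fibre of \<open>v\<close> to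
  \<open>v\<close>.\<close>

definition minimal_lifts :: "data \<Rightarrow> data" where
  "minimal_lifts x =
    Pair (lift_data (left x) (right (right x)) (\<lambda>i. kept (len (left x)) (entry (left x)) i))
      (enc_list (map
        (\<lambda>v. lift_data (left x) (right (right x)) (\<lambda>i.
          (rank (len (left x)) (entry (left x)) i = rank (len (left x)) (entry (left x)) v \<longrightarrow> i = v) \<and>
          (rank (len (left x)) (entry (left x)) i \<noteq> rank (len (left x)) (entry (left x)) v \<longrightarrow>
            kept (len (left x)) (entry (left x)) i)))
        (filter (\<lambda>v. \<not> kept (len (left x)) (entry (left x)) v \<and>
            touched (right (right x)) (rank (len (left x)) (entry (left x)) v)) [0..<len (left x)])))"

text \<open>When vertex \<open>j\<close> is to be decided, \<open>acc\<close> holds the bits of the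
  vertices above it, the latest one in front. The bit of \<open>k\<close> is therefore at position
  \<open>k - Suc j\<close>.\<close>

definition taken :: "data \<Rightarrow> nat \<Rightarrow> data \<Rightarrow> bool" where
  "taken d j acc \<longleftrightarrow> (\<exists>k<len d. j < k \<and>
    rank (len d) (entry d) k = rank (len d) (entry d) j \<and> bit_at acc (k - Suc j))"

definition lift_step :: "data \<Rightarrow> data \<Rightarrow> data \<Rightarrow> nat \<Rightarrow> data" where
  "lift_step d s acc j =
    Pair (enc_bool (\<not> kept (len d) (entry d) j \<and> touched s (rank (len d) (entry d) j) \<and> \<not> taken d j acc))
      (enc_bool (kept (len d) (entry d) j \<and> \<not> taken d j acc))"

text \<open>\<open>z\<close> holds the depth counter, the decided bits and the input of the lifting
  algorithm. At an inner node the depth remaining below it is the number of the vertex to decide.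
  Inside the input, the kernel instance between graph and cut is skipped.\<close>

definition lift_tree :: "data \<Rightarrow> data" where
  "lift_tree z =
    (if left z \<noteq> Leaf
     then lift_step (left (right (right z))) (right (right (right (right z)))) (left (right z)) (len (right (left z)))
     else lift_data (left (right (right z))) (right (right (right (right z)))) (\<lambda>i. bit_at (left (right z)) i))"

lemma polytime_bit: "polytime f \<Longrightarrow> polytime_nat i \<Longrightarrow> polytime_bool (\<lambda>x. bit_at (f x) (i x))"
  unfolding bit_at_def by (intro polytime_intros)

lemma polytime_entry:
  "polytime f \<Longrightarrow> polytime_nat i \<Longrightarrow> polytime_nat j \<Longrightarrow> polytime_bool (\<lambda>x. entry (f x) (i x) (j x))"
  unfolding entry_def by (intro polytime_intros polytime_bit)

lemmas polytime_intros' = polytime_intros polytime_nat_const polytime_bit polytime_entry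

lemma polytime_twins:
  assumes "polytime f" "polytime_nat i" "polytime_nat j"
  shows "polytime_bool (\<lambda>x. twins (len (f x)) (entry (f x)) (i x) (j x))"
  unfolding twins_def
  by (intro polytime_intros' polytime_comp[OF assms(1)] polytime_nat_comp[OF assms(2)] polytime_nat_comp[OF assms(3)])

lemma polytime_kept:
  assumes "polytime f" "polytime_nat i"
  shows "polytime_bool (\<lambda>x. kept (len (f x)) (entry (f x)) (i x))"
  unfolding kept_def
  by (intro polytime_intros' polytime_twins polytime_comp[OF assms(1)] polytime_nat_comp[OF assms(2)])

lemma polytime_rank:
  assumes "polytime f" "polytime_nat i"
  shows "polytime_nat (\<lambda>x. rank (len (f x)) (entry (f x)) (i x))"
  unfolding rank_def
  by (intro polytime_intros' polytime_twins polytime_kept polytime_comp[OF assms(1)] polytime_nat_comp[OF assms(2)])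

lemma polytime_kernel_data: "polytime kernel_data"
  unfolding kernel_data_def[abs_def] by (intro polytime_intros' polytime_kept)

lemma polytime_touched:
  assumes "polytime f" "polytime_nat i"
  shows "polytime_bool (\<lambda>x. touched (f x) (i x))"
  unfolding touched_def
  by (intro polytime_intros' polytime_comp[OF assms(1)] polytime_nat_comp[OF assms(2)])

lemma polytime_taken:
  assumes "polytime f" "polytime_nat i" "polytime g"
  shows "polytime_bool (\<lambda>x. taken (f x) (i x) (g x))"
  unfolding taken_def
  by (intro polytime_intros' polytime_rank polytime_comp[OF assms(1)] polytime_nat_comp[OF assms(2)]
      polytime_comp[OF assms(3)])

lemma polytime_minimal_lifts: "polytime minimal_lifts"
  unfolding minimal_lifts_def[abs_def] lift_data_def
  by (intro polytime_intros' polytime_kept polytime_rank polytime_touched)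

lemma polytime_lift_tree: "polytime lift_tree"
  unfolding lift_tree_def[abs_def] lift_step_def lift_data_def
  by (intro polytime_intros' polytime_kept polytime_rank polytime_touched polytime_taken)

section \<open>Reading and measuring encoded matrices\<close>

lemma left_funpow_right_enc_list: "i < length vs \<Longrightarrow> left ((right ^^ i) (enc_list vs)) = vs ! i"
proof (induction vs arbitrary: i)
  case (Cons v vs)
  then show ?case by (cases i) (auto simp: funpow_Suc_right simp del: funpow.simps)
qed simp

lemma len_enc_edges [simp]: "len (enc_edges n E) = n"
  by (simp add: enc_edges_def)

lemma entry_enc_edges: "i < n \<Longrightarrow> j < n \<Longrightarrow> entry (enc_edges n E) i j \<longleftrightarrow> {i, j} \<in> E"
  by (simp add: entry_def bit_at_def enc_edges_def left_funpow_right_enc_list)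

lemma bit_enc_list: "i < length bs \<Longrightarrow> bit_at (enc_list (map enc_bool bs)) i \<longleftrightarrow> bs ! i"
  by (simp add: bit_at_def left_funpow_right_enc_list)

lemma length_filter_upt: "length (filter P [0..<n]) = card {i. i < n \<and> P i}"
  by (simp add: length_filter_conv_card cong: conj_cong)

text \<open>The number of survivors below \<open>v\<close> is the index of \<open>v\<close> among
  them; this makes a count of kept vertices a kernel vertex.\<close>

lemma nth_filter_upt:
  assumes "v < n" "P v"
  shows "length (filter P [0..<v]) < length (filter P [0..<n])"
    and "filter P [0..<n] ! length (filter P [0..<v]) = v"
proof -
  have "[0..<n] = [0..<v] @ v # [Suc v..<n]"
    using upt_add_eq_append[of 0 v "n - v"] upt_conv_Cons[of v n] assms(1) by simp
  with assms(2) show "length (filter P [0..<v]) < length (filter P [0..<n])"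
    "filter P [0..<n] ! length (filter P [0..<v]) = v" by (simp_all add: nth_append)
qed

lemma size_enc_list: "size (enc_list vs) = sum_list (map size vs) + length vs"
  by (induction vs) auto

text \<open>A row consists of n cells and n entries of size at most 1, and each row occupies one
  more cell of the outer list.\<close>

lemma size_enc_edges_le: "size (enc_edges n E) \<le> n * (2 * n + 1)"
proof -
  have row: "size (enc_list (map (\<lambda>j. enc_bool (P j)) [0..<n])) \<le> 2 * n" for P :: "nat \<Rightarrow> bool"
  proof -
    have "sum_list (map (\<lambda>j. size (enc_bool (P j))) [0..<n]) \<le> sum_list (map (\<lambda>j. 1) [0..<n])"
      using size_enc_bool by (intro sum_list_mono)
    then show ?thesis by (simp add: size_enc_list comp_def sum_list_triv)
  qed
  have "sum_list (map (\<lambda>i. size (enc_list (map (\<lambda>j. enc_bool ({i, j} \<in> E)) [0..<n]))) [0..<n]) \<le>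
    sum_list (map (\<lambda>i. 2 * n) [0..<n])"
    using row by (intro sum_list_mono)
  also have "\<dots> = n * (2 * n)" by (simp add: sum_list_triv)
  finally show ?thesis
    unfolding enc_edges_def by (subst size_enc_list) (simp add: comp_def)
qed

lemma size_enc_edges_ge: "n \<le> size (enc_edges n E)"
  by (simp add: enc_edges_def size_enc_list)


text \<open>The traversal of \<open>enum_tree\<close> on Boolean lists: \<open>br\<close> tells
  whether both values are possible for the next index, \<open>fc\<close> gives the only one
  otherwise, and \<open>bs\<close> contains the bits of all larger indices.\<close>

fun bit_lists :: "(nat \<Rightarrow> bool list \<Rightarrow> bool) \<Rightarrow> (nat \<Rightarrow> bool list \<Rightarrow> bool) \<Rightarrow> nat \<Rightarrow> bool list \<Rightarrow> bool list list"
where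
  "bit_lists br fc 0 bs = [bs]"
| "bit_lists br fc (Suc j) bs =
    (if br j bs then bit_lists br fc j (False # bs) @ bit_lists br fc j (True # bs)
     else bit_lists br fc j (fc j bs # bs))"

lemma bit_lists_suffix: "cs \<in> set (bit_lists br fc n bs) \<Longrightarrow> length cs = n + length bs \<and> drop n cs = bs"
proof (induction n arbitrary: bs)
  case (Suc j)
  then obtain b where "cs \<in> set (bit_lists br fc j (b # bs))"
    by (auto split: if_splits)
  from Suc.IH[OF this] show ?case by (metis add_Suc_shift drop_Suc drop_tl length_Cons list.sel(3))
qed simp

lemma drop_eq_Cons_iff:
  "j < length xs \<Longrightarrow> drop j xs = y # ys \<longleftrightarrow> xs ! j = y \<and> drop (Suc j) xs = ys"
  by (metis Cons_nth_drop_Suc list.inject)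

text \<open>Every decision depends only on the suffix above the current index, so the leaves are
  described by one condition per index, independent of the traversal.\<close>

lemma set_bit_lists:
  "set (bit_lists br fc n bs) = {cs. length cs = n + length bs \<and> drop n cs = bs \<and>
    (\<forall>j<n. br j (drop (Suc j) cs) \<or> cs ! j = fc j (drop (Suc j) cs))}"
proof (induction n arbitrary: bs)
  case (Suc j)
  show ?case
  proof (intro set_eqI)
    fix cs
    have "cs \<in> set (bit_lists br fc (Suc j) bs) \<longleftrightarrow> length cs = Suc j + length bs \<and>
      (\<forall>i<j. br i (drop (Suc i) cs) \<or> cs ! i = fc i (drop (Suc i) cs)) \<and>
      (\<exists>b. drop j cs = b # bs \<and> (br j bs \<or> b = fc j bs))"
      by (auto simp: Suc)
    also have "\<dots> \<longleftrightarrow> cs \<in> {cs. length cs = Suc j + length bs \<and> drop (Suc j) cs = bs \<and>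
      (\<forall>i<Suc j. br i (drop (Suc i) cs) \<or> cs ! i = fc i (drop (Suc i) cs))}"
      by (auto simp: less_Suc_eq drop_eq_Cons_iff)
    finally show "cs \<in> set (bit_lists br fc (Suc j) bs) \<longleftrightarrow> cs \<in> {cs. length cs = Suc j + length bs \<and>
      drop (Suc j) cs = bs \<and> (\<forall>i<Suc j. br i (drop (Suc i) cs) \<or> cs ! i = fc i (drop (Suc i) cs))}" .
  qed
qed auto

lemma distinct_bit_lists: "distinct (bit_lists br fc n bs)"
proof (induction n arbitrary: bs)
  case (Suc j)
  have "cs \<notin> set (bit_lists br fc j (True # bs))" if "cs \<in> set (bit_lists br fc j (False # bs))" for cs
    using bit_lists_suffix[OF that] bit_lists_suffix[of cs br fc j "True # bs"] by auto
  with Suc show ?case by auto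
qed simp

lemma enum_tree_bit_lists:
  assumes "\<And>j bs. Suc j + length bs = N \<Longrightarrow>
      left (W (Pair (Pair Leaf (enc_nat j)) (Pair (enc_list (map enc_bool bs)) x))) \<noteq> Leaf \<longleftrightarrow> br j bs"
    and "\<And>j bs. Suc j + length bs = N \<Longrightarrow>
      right (W (Pair (Pair Leaf (enc_nat j)) (Pair (enc_list (map enc_bool bs)) x))) = enc_bool (fc j bs)"
  shows "n + length bs = N \<Longrightarrow> enum_tree W (enc_nat n) (enc_list (map enc_bool bs)) x =
    map (\<lambda>bs. W (Pair Leaf (Pair (enc_list (map enc_bool bs)) x))) (bit_lists br fc n bs)"
proof (induction n arbitrary: bs)
  case (Suc n)
  with Suc.IH[of "False # bs"] Suc.IH[of "True # bs"] Suc.IH[of "fc n bs # bs"] assms[of n bs]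
  show ?case by (simp add: Let_def)
qed simp

context twin_kernel
begin

text \<open>Membership in the lifted cut without a search for the preimage of an edge, in the form
  that the program evaluates.\<close>

lemma lift_edge_iff:
  assumes "sect \<sigma>" "M \<subseteq> F" "u \<in> V" "v \<in> V"
  shows "{u, v} \<in> lift \<sigma> M \<longleftrightarrow> \<sigma> (r u) = u \<and> \<sigma> (r v) = v \<and> {r u, r v} \<in> M"
proof
  assume "{u, v} \<in> lift \<sigma> M"
  then obtain e where e: "e \<in> M" "{u, v} = \<sigma> ` e" by (auto simp: lift_def)
  have eW: "e \<subseteq> W" using e assms(2) by (auto simp: F_eq)
  have "r ` \<sigma> ` e = e" using eW assms(1) by (force simp: sect_def image_image)
  then have "{r u, r v} = e" using e by (metis image_empty image_insert)
  moreover have "\<sigma> (r w) = w" if "w \<in> \<sigma> ` e" for w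
    using that eW assms(1) by (auto simp: sect_def)
  ultimately show "\<sigma> (r u) = u \<and> \<sigma> (r v) = v \<and> {r u, r v} \<in> M" using e by auto
next
  assume *: "\<sigma> (r u) = u \<and> \<sigma> (r v) = v \<and> {r u, r v} \<in> M"
  then have "\<sigma> ` {r u, r v} \<in> lift \<sigma> M" unfolding lift_def by (intro imageI) auto
  with * show "{u, v} \<in> lift \<sigma> M" by simp
qed

lemma lift_incident:
  assumes "sect \<sigma>" "M \<subseteq> F" "a \<in> \<Union>M"
  shows "\<sigma> a \<in> \<Union>(lift \<sigma> M)"
  using assms(3) by (auto simp: lift_def)

text \<open>Touched vertices lie in the range of the section. A lifted cut thus determines its
  section on the touched fibres, the source of all distinctness results.\<close>

lemma lift_incidentD:
  assumes "sect \<sigma>" "M \<subseteq> F" "u \<in> \<Union>(lift \<sigma> M)"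
  shows "\<sigma> (r u) = u"
proof -
  from assms(3) obtain e a where "e \<in> M" "a \<in> e" "u = \<sigma> a" by (auto simp: lift_def)
  moreover from this have "a \<in> W" using assms(2) by (auto simp: F_eq)
  ultimately show ?thesis using assms(1) by (simp add: sect_def)
qed

lemma lift_cong: "(\<And>a. a \<in> \<Union>M \<Longrightarrow> \<sigma> a = \<sigma>' a) \<Longrightarrow> lift \<sigma> M = lift \<sigma>' M"
  unfolding lift_def by (intro image_cong) auto

end

locale ordered_twin_kernel =
  twin_kernel "{..<n}" E W F r \<iota> for n :: nat and E W F and r :: "nat \<Rightarrow> 'b" and \<iota> +
  assumes \<iota>_le: "v < n \<Longrightarrow> \<iota> (r v) \<le> v"
begin

definition kept_vertex :: "nat \<Rightarrow> bool" where
  "kept_vertex v \<longleftrightarrow> \<iota> (r v) = v"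

definition suffix_taken :: "nat \<Rightarrow> bool list \<Rightarrow> bool" where
  "suffix_taken j bs \<longleftrightarrow> (\<exists>k<n. j < k \<and> r k = r j \<and> bs ! (k - Suc j))"

text \<open>
  Sections of \<open>r\<close> as bit vectors marking their ranges, decided from vertex \<open>n - 1\<close> down to \<open>0\<close>. The kept
  vertex of a fibre is the smallest one, so it can always be marked last and no partial choice is a
  dead end. Fibres not touched by \<open>M\<close> do not influence the lifted cut; marking their kept vertex
  avoids repetitions.
\<close>

definition selections :: "'b set set \<Rightarrow> bool list list" where
  "selections M = bit_lists
    (\<lambda>j bs. \<not> kept_vertex j \<and> r j \<in> \<Union>M \<and> \<not> suffix_taken j bs)
    (\<lambda>j bs. kept_vertex j \<and> \<not> suffix_taken j bs) n []"

definition selected :: "bool list \<Rightarrow> 'b \<Rightarrow> nat" where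
  "selected bs a = (THE i. i < n \<and> r i = a \<and> bs ! i)"

lemma selections_iff:
  "bs \<in> set (selections M) \<longleftrightarrow> length bs = n \<and>
    (\<forall>j<n. (\<not> kept_vertex j \<and> r j \<in> \<Union>M \<and> \<not> (\<exists>k<n. j < k \<and> r k = r j \<and> bs ! k)) \<or>
      (bs ! j \<longleftrightarrow> kept_vertex j \<and> \<not> (\<exists>k<n. j < k \<and> r k = r j \<and> bs ! k)))"
proof -
  have "suffix_taken j (drop (Suc j) bs) \<longleftrightarrow> (\<exists>k<n. j < k \<and> r k = r j \<and> bs ! k)"
    if "length bs = n" "j < n" for j
    using that by (auto simp: suffix_taken_def)
  then show ?thesis unfolding selections_def set_bit_lists by auto
qed

lemma kept_vertex_unique: "kept_vertex i \<Longrightarrow> r i = a \<Longrightarrow> i = \<iota> a"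
  by (auto simp: kept_vertex_def)

text \<open>Of two marked vertices in a fibre the larger would have excluded the smaller. One is
  marked because the kept vertex comes last and is forced if nothing above it was chosen.\<close>

lemma selections_selected:
  assumes "bs \<in> set (selections M)" "a \<in> W"
  shows "\<exists>!i. i < n \<and> r i = a \<and> bs ! i"
proof (rule ex_ex1I)
  from assms(1) have *: "\<And>j. j < n \<Longrightarrow> \<exists>k<n. j < k \<and> r k = r j \<and> bs ! k \<Longrightarrow> \<not> bs ! j"
    and ex: "\<And>j. j < n \<Longrightarrow> kept_vertex j \<Longrightarrow> bs ! j \<or> (\<exists>k<n. j < k \<and> r k = r j \<and> bs ! k)"
    unfolding selections_iff by blast+
  have "\<iota> a < n" "r (\<iota> a) = a" "kept_vertex (\<iota> a)"
    using \<iota>_in[OF assms(2)] r_\<iota>[OF assms(2)] by (auto simp: kept_vertex_def)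
  then show "\<exists>i. i < n \<and> r i = a \<and> bs ! i" using ex[of "\<iota> a"] by metis
  show "i = j" if "i < n \<and> r i = a \<and> bs ! i" "j < n \<and> r j = a \<and> bs ! j" for i j
    using that *[of i] *[of j] by (metis linorder_neqE_nat)
qed

lemma selected:
  assumes "bs \<in> set (selections M)" "a \<in> W"
  shows "selected bs a < n" "r (selected bs a) = a" "bs ! selected bs a"
  using theI'[OF selections_selected[OF assms]] unfolding selected_def by auto

lemma sect_selected: "bs \<in> set (selections M) \<Longrightarrow> sect (selected bs)"
  using selected unfolding sect_def by auto

lemma nth_selections:
  assumes "bs \<in> set (selections M)" "i < n"
  shows "bs ! i \<longleftrightarrow> selected bs (r i) = i"
proof -
  have "r i \<in> W" using r_in assms(2) by simp
  from selections_selected[OF assms(1) this] selected[OF assms(1) this] assms(2) show ?thesis by metis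
qed

lemma selected_untouched:
  assumes "bs \<in> set (selections M)" "a \<in> W" "a \<notin> \<Union>M"
  shows "selected bs a = \<iota> a"
proof -
  note s = selected[OF assms(1,2)]
  have "kept_vertex (selected bs a)"
    using assms(1)[unfolded selections_iff, THEN conjunct2, rule_format, OF s(1)] s(2,3) assms(3) by simp
  then show ?thesis using s(2) kept_vertex_unique by blast
qed

lemma set_lift_selections:
  assumes M: "M \<subseteq> F"
  shows "(\<lambda>bs. lift (selected bs) M) ` set (selections M) = {lift \<sigma> M |\<sigma>. sect \<sigma>}"
proof (intro equalityI subsetI)
  fix N assume "N \<in> {lift \<sigma> M |\<sigma>. sect \<sigma>}"
  then obtain \<sigma> where \<sigma>: "sect \<sigma>" "N = lift \<sigma> M" by blast
  \<comment> \<open>Only the values of \<open>\<sigma>\<close> on touched fibres matter for the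
    lifted cut; in the others the kept vertex is marked, as the traversal does.\<close>
  define bs where "bs = map (\<lambda>i. if r i \<in> \<Union>M then \<sigma> (r i) = i else kept_vertex i) [0..<n]"
  have nth: "bs ! i \<longleftrightarrow> (if r i \<in> \<Union>M then \<sigma> (r i) = i else kept_vertex i)" if "i < n" for i
    using that by (simp add: bs_def)
  have "(\<not> kept_vertex j \<and> r j \<in> \<Union>M \<and> \<not> (\<exists>k<n. j < k \<and> r k = r j \<and> bs ! k)) \<or>
      (bs ! j \<longleftrightarrow> kept_vertex j \<and> \<not> (\<exists>k<n. j < k \<and> r k = r j \<and> bs ! k))" if j: "j < n" for j
  proof (cases "r j \<in> \<Union>M")
    case False
    then have "\<not> (\<exists>k<n. j < k \<and> r k = r j \<and> bs ! k)" if "kept_vertex j"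
      using that kept_vertex_unique nth by (metis nat_neq_iff)
    then show ?thesis using False nth[OF j] by auto
  next
    case True
    have \<sigma>j: "\<sigma> (r j) < n" "r (\<sigma> (r j)) = r j" using \<sigma> r_in[of j] j by (auto simp: sect_def)
    have *: "(\<exists>k<n. j < k \<and> r k = r j \<and> bs ! k) \<longleftrightarrow> j < \<sigma> (r j)"
    proof
      assume "\<exists>k<n. j < k \<and> r k = r j \<and> bs ! k"
      then show "j < \<sigma> (r j)" using True nth by (metis (full_types))
    next
      assume "j < \<sigma> (r j)"
      then show "\<exists>k<n. j < k \<and> r k = r j \<and> bs ! k"
        using True \<sigma>j nth[OF \<sigma>j(1)] by (intro exI[of _ "\<sigma> (r j)"]) simp
    qed
    have "\<iota> (r j) \<le> \<sigma> (r j)" using \<iota>_le[OF \<sigma>j(1)] \<sigma>j(2) by simp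
    then show ?thesis unfolding * nth[OF j] using True by (auto simp: kept_vertex_def)
  qed
  then have bs: "bs \<in> set (selections M)" unfolding selections_iff by (simp add: bs_def)
  have "selected bs a = \<sigma> a" if "a \<in> \<Union>M" for a
  proof -
    have a: "a \<in> W" using that M by (auto simp: F_eq)
    then have "\<sigma> a < n" "r (\<sigma> a) = a" using \<sigma> by (auto simp: sect_def)
    then show ?thesis using nth_selections[OF bs, of "\<sigma> a"] nth[of "\<sigma> a"] that by auto
  qed
  from lift_cong[of M "selected bs" \<sigma>, OF this] have "lift (selected bs) M = N" using \<sigma>(2) by simp
  with bs show "N \<in> (\<lambda>bs. lift (selected bs) M) ` set (selections M)" by blast
qed (use sect_selected in blast)

text \<open>On touched fibres the selection is read off from the lifted cut, and on untouched ones
  it is always the kept vertex.\<close>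

lemma inj_lift_selections:
  assumes M: "M \<subseteq> F"
  shows "inj_on (\<lambda>bs. lift (selected bs) M) (set (selections M))"
proof (rule inj_onI)
  fix bs cs assume bs: "bs \<in> set (selections M)" and cs: "cs \<in> set (selections M)"
    and eq: "lift (selected bs) M = lift (selected cs) M"
  have "selected bs a = selected cs a" if a: "a \<in> W" for a
  proof (cases "a \<in> \<Union>M")
    case True
    from lift_incident[OF sect_selected[OF bs] M True] eq
    have "selected bs a \<in> \<Union>(lift (selected cs) M)" by simp
    from lift_incidentD[OF sect_selected[OF cs] M this] show ?thesis
      using selected(2)[OF bs a] by simp
  next
    case False
    then show ?thesis using selected_untouched bs cs a by metis
  qed
  then have "bs ! i = cs ! i" if "i < n" for i
    using that nth_selections[OF bs] nth_selections[OF cs] r_in by simp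
  then show "bs = cs" using bs cs by (intro nth_equalityI) (auto simp: selections_iff)
qed

end

section \<open>The kernel of a graph\<close>

definition kernel_verts :: "nat \<Rightarrow> nat set set \<Rightarrow> nat list" where
  "kernel_verts n E = filter (kept n (\<lambda>i j. {i, j} \<in> E)) [0..<n]"

definition kernel_edges :: "nat \<Rightarrow> nat set set \<Rightarrow> nat set set" where
  "kernel_edges n E = {e. e \<subseteq> {..<length (kernel_verts n E)} \<and> (!) (kernel_verts n E) ` e \<in> E}"

definition kernel_graph :: "graph \<Rightarrow> graph" where
  "kernel_graph G = (length (kernel_verts (fst G) (snd G)), kernel_edges (fst G) (snd G))"

text \<open>An encoded matrix is known to agree with the edge set only for indices below n; this and
  the next two lemmas transfer the notions across such agreement.\<close>

lemma twins_cong: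
  assumes "\<And>i j. i < n \<Longrightarrow> j < n \<Longrightarrow> g i j = h i j" "i < n" "j < n"
  shows "twins n g i j \<longleftrightarrow> twins n h i j"
  using assms by (auto simp: twins_def)

lemma kept_cong:
  assumes "\<And>i j. i < n \<Longrightarrow> j < n \<Longrightarrow> g i j = h i j" "i < n"
  shows "kept n g i \<longleftrightarrow> kept n h i"
proof -
  have "filter (\<lambda>j. twins n g j i) [0..<i] = filter (\<lambda>j. twins n h j i) [0..<i]"
    using twins_cong[of n g h] assms by (intro filter_cong) auto
  then show ?thesis by (simp add: kept_def)
qed

lemma rank_cong:
  assumes "\<And>i j. i < n \<Longrightarrow> j < n \<Longrightarrow> g i j = h i j" "v < n"
  shows "rank n g v = rank n h v"
proof -
  have k: "kept n g i = kept n h i" if "i < n" for i by (intro kept_cong assms(1) that)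
  have t: "(\<exists>t<Suc u. twins n g t v) = (\<exists>t<Suc u. twins n h t v)" if "u < v" for u
    using twins_cong[of n g h _ v] assms that by (metis Suc_lessI dual_order.strict_trans)
  show ?thesis
    unfolding rank_def using k t assms(2) by (intro arg_cong[where f = length] filter_cong) auto
qed

lemma twins_iff_twin:
  "i < n \<Longrightarrow> j < n \<Longrightarrow> twins n (\<lambda>i j. {i, j} \<in> E) i j \<longleftrightarrow> twin {..<n} E i j"
  by (auto simp: twins_def twin_def)

lemma kept_iff_card:
  assumes "v < n"
  shows "kept n (\<lambda>i j. {i, j} \<in> E) v \<longleftrightarrow> card {u. u < v \<and> twin {..<n} E u v} < 3"
proof -
  have "{u. u < v \<and> twins n (\<lambda>i j. {i, j} \<in> E) u v} = {u. u < v \<and> twin {..<n} E u v}"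
    using assms twins_iff_twin[of _ n v E] by auto
  then show ?thesis by (simp add: kept_def length_filter_upt)
qed

text \<open>The largest kept vertex of \<open>U\<close> has all other kept ones as smaller twins,
  and being kept it has fewer than three of these.\<close>

lemma kept_twins_le:
  assumes U: "U \<subseteq> {..<n}" and tw: "\<And>u v. u \<in> U \<Longrightarrow> v \<in> U \<Longrightarrow> twin {..<n} E u v"
  shows "card {v \<in> U. kept n (\<lambda>i j. {i, j} \<in> E) v} \<le> 3"
proof (rule ccontr)
  let ?K = "{v \<in> U. kept n (\<lambda>i j. {i, j} \<in> E) v}"
  assume "\<not> card ?K \<le> 3"
  then have card: "card ?K \<ge> 4" by simp
  have fin: "finite ?K" using U finite_subset[of ?K "{..<n}"] by auto
  have ne: "?K \<noteq> {}" using card by (metis card.empty not_numeral_le_zero)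
  let ?m = "Max ?K"
  have m: "?m \<in> ?K" using Max_in fin ne by blast
  then have mn: "?m < n" using U by auto
  have "?K - {?m} \<subseteq> {u. u < ?m \<and> twin {..<n} E u ?m}"
  proof
    fix u assume "u \<in> ?K - {?m}"
    then have "u \<in> ?K" "u \<noteq> ?m" by auto
    then have "u \<le> ?m" "u \<in> U" using fin by auto
    then show "u \<in> {u. u < ?m \<and> twin {..<n} E u ?m}" using tw m \<open>u \<noteq> ?m\<close> by auto
  qed
  then have "card (?K - {?m}) \<le> card {u. u < ?m \<and> twin {..<n} E u ?m}"
    by (intro card_mono) auto
  moreover have "card (?K - {?m}) \<ge> 3" using card m fin by simp
  ultimately show False using m kept_iff_card[OF mn, of E] by auto
qed

text \<open>The least vertex of the class that is not kept has at least three smaller twins, and all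
  of them are kept.\<close>

lemma not_kept_twins:
  assumes v: "v < n" "\<not> kept n (\<lambda>i j. {i, j} \<in> E) v"
  shows "3 \<le> card {u. u < n \<and> twin {..<n} E u v \<and> kept n (\<lambda>i j. {i, j} \<in> E) u}" (is "3 \<le> card ?K")
proof (rule ccontr)
  assume small: "\<not> 3 \<le> card ?K"
  define m where "m = (LEAST u. u < n \<and> twin {..<n} E u v \<and> \<not> kept n (\<lambda>i j. {i, j} \<in> E) u)"
  have "\<exists>u. u < n \<and> twin {..<n} E u v \<and> \<not> kept n (\<lambda>i j. {i, j} \<in> E) u"
    using v twin_refl[of v "{..<n}"] by auto
  from LeastI_ex[OF this] have m: "m < n" "twin {..<n} E m v" "\<not> kept n (\<lambda>i j. {i, j} \<in> E) m"
    unfolding m_def by auto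
  have "{u. u < m \<and> twin {..<n} E u m} \<subseteq> ?K"
    using not_less_Least[of _ "\<lambda>u. u < n \<and> twin {..<n} E u v \<and> \<not> kept n (\<lambda>i j. {i, j} \<in> E) u"]
      m twin_trans[OF _ m(2)] unfolding m_def[symmetric] by fastforce
  then have "card {u. u < m \<and> twin {..<n} E u m} \<le> card ?K" by (intro card_mono) auto
  then show False using small m(3) kept_iff_card[OF m(1), of E] by simp
qed

lemma three_elements:
  assumes "3 \<le> card A"
  obtains a b c where "a \<in> A" "b \<in> A" "c \<in> A" "a \<noteq> b" "a \<noteq> c" "b \<noteq> c"
proof -
  obtain B where "B \<subseteq> A" "card B = 3" using obtain_subset_with_card_n[OF assms] by metis
  then show ?thesis using that unfolding card_3_iff by blast
qed

text \<open>The representative behind \<open>rank\<close>. A kept vertex represents itself even if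
  it is not the least of its class, so the contracted vertices join the fibre of the class minimum
  only.\<close>

definition least_twin :: "nat \<Rightarrow> nat set set \<Rightarrow> nat \<Rightarrow> nat" where
  "least_twin n E v =
    (if kept n (\<lambda>i j. {i, j} \<in> E) v then v else LEAST t. twin {..<n} E t v)"

lemma least_twin:
  assumes v: "v < n"
  shows "twin {..<n} E (least_twin n E v) v" "least_twin n E v \<le> v" "kept n (\<lambda>i j. {i, j} \<in> E) (least_twin n E v)"
    and "rank n (\<lambda>i j. {i, j} \<in> E) v = length (filter (kept n (\<lambda>i j. {i, j} \<in> E)) [0..<least_twin n E v])"
proof -
  let ?g = "\<lambda>i j. {i, j} \<in> E" and ?l = "least_twin n E v"
  have refl: "twin {..<n} E v v" using v twin_refl[of v "{..<n}" E] by simp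
  show tw: "twin {..<n} E ?l v" and le: "?l \<le> v"
    using refl LeastI[of "\<lambda>t. twin {..<n} E t v", OF refl] Least_le[of "\<lambda>t. twin {..<n} E t v", OF refl]
    by (auto simp: least_twin_def)
  have least: "\<not> twin {..<n} E u v" if "\<not> kept n ?g v" "u < ?l" for u
    using that not_less_Least[of u "\<lambda>t. twin {..<n} E t v"] by (simp add: least_twin_def)
  show "kept n ?g ?l"
  proof (cases "kept n ?g v")
    case True
    then show ?thesis by (simp add: least_twin_def)
  next
    case False
    have "{u. u < ?l \<and> twin {..<n} E u ?l} = {}"
      using least[OF False] twin_trans[OF _ tw] by blast
    then have "card {u. u < ?l \<and> twin {..<n} E u ?l} < 3" by (metis card.empty zero_less_numeral)
    then show ?thesis using kept_iff_card[of ?l n E] le v by simp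
  qed
  \<comment> \<open>For a vertex that is not kept, having no twin among 0, ..., u means that
    \<open>u\<close> lies below the least twin. So \<open>rank\<close> counts the kept vertices
    below the representative.\<close>
  have "u < v \<and> kept n ?g u \<and> (kept n ?g v \<longrightarrow> u < v) \<and> (\<not> kept n ?g v \<longrightarrow> \<not> (\<exists>t<Suc u. twins n ?g t v)) \<longleftrightarrow>
    u < ?l \<and> kept n ?g u" for u
  proof (cases "kept n ?g v")
    case True
    then show ?thesis by (auto simp: least_twin_def)
  next
    case False
    have "u < ?l \<longleftrightarrow> u < v \<and> \<not> (\<exists>t<Suc u. twins n ?g t v)"
    proof
      assume u: "u < ?l"
      have "\<not> twins n ?g t v" if "t < Suc u" for t
      proof -
        have "t < ?l" using u that by simp
        then show ?thesis using least[OF False] twins_iff_twin[of t n v E] le v by simp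
      qed
      then show "u < v \<and> \<not> (\<exists>t<Suc u. twins n ?g t v)" using u le by auto
    next
      assume "u < v \<and> \<not> (\<exists>t<Suc u. twins n ?g t v)"
      moreover have "twins n ?g ?l v" using tw twins_iff_twin[of ?l n v E] le v by simp
      ultimately show "u < ?l" by (metis less_Suc_eq_le linorder_not_less)
    qed
    with False show ?thesis by blast
  qed
  then show "rank n ?g v = length (filter (kept n ?g) [0..<?l])"
    unfolding rank_def length_filter_upt by simp
qed

lemma kernel_verts_rank:
  assumes "v < n"
  shows "rank n (\<lambda>i j. {i, j} \<in> E) v < length (kernel_verts n E)"
    and "kernel_verts n E ! rank n (\<lambda>i j. {i, j} \<in> E) v = least_twin n E v"
  using nth_filter_upt[of "least_twin n E v" n "kept n (\<lambda>i j. {i, j} \<in> E)"] least_twin[OF assms, of E] assms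
  by (auto simp: kernel_verts_def)

lemma nth_kernel_verts:
  assumes "a < length (kernel_verts n E)"
  shows "kernel_verts n E ! a < n" "kept n (\<lambda>i j. {i, j} \<in> E) (kernel_verts n E ! a)"
  using nth_mem[OF assms] by (auto simp: kernel_verts_def)

lemma ordered_twin_kernel:
  assumes "simple_graph {..<n} E"
  shows "ordered_twin_kernel n E {..<length (kernel_verts n E)} (kernel_edges n E)
    (rank n (\<lambda>i j. {i, j} \<in> E)) ((!) (kernel_verts n E))"
proof
  let ?g = "\<lambda>i j. {i, j} \<in> E" and ?W = "{..<length (kernel_verts n E)}"
  note kv = kernel_verts_rank[of _ n E]
  show "simple_graph {..<n} E" by (rule assms)
  show "rank n ?g v \<in> ?W" if "v \<in> {..<n}" for v using kv that by simp
  show "kernel_verts n E ! a \<in> {..<n}" if "a \<in> ?W" for a using nth_kernel_verts that by simp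
  show "rank n ?g (kernel_verts n E ! a) = a" if a: "a \<in> ?W" for a
  proof -
    let ?v = "kernel_verts n E ! a"
    have v: "?v < n" "kept n ?g ?v" using nth_kernel_verts a by auto
    have "kernel_verts n E ! rank n ?g ?v = ?v" using kv(2)[OF v(1)] v(2) by (simp add: least_twin_def)
    moreover have "distinct (kernel_verts n E)" by (simp add: kernel_verts_def)
    ultimately show ?thesis using kv(1)[OF v(1)] a nth_eq_iff_index_eq by auto
  qed
  show "kernel_edges n E = {e. e \<subseteq> ?W \<and> (!) (kernel_verts n E) ` e \<in> E}" by (simp add: kernel_edges_def)
  show tw: "twin {..<n} E u v" if "u \<in> {..<n}" "v \<in> {..<n}" "rank n ?g u = rank n ?g v" for u v
  proof -
    have "least_twin n E u = least_twin n E v" using kv(2)[of u] kv(2)[of v] that by simp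
    then show ?thesis
      using twin_trans[OF twin_sym[OF least_twin(1)[of u n E]] , of v] least_twin(1)[of v n E] that by simp
  qed
  show "\<exists>a\<in>?W. \<exists>b\<in>?W. \<exists>c\<in>?W. a \<noteq> b \<and> a \<noteq> c \<and> b \<noteq> c \<and> twin {..<n} E u (kernel_verts n E ! a) \<and>
      twin {..<n} E u (kernel_verts n E ! b) \<and> twin {..<n} E u (kernel_verts n E ! c)"
    if uv: "u \<in> {..<n}" "v \<in> {..<n}" "rank n ?g u = rank n ?g v" "u \<noteq> v" for u v
  proof -
    \<comment> \<open>Kept vertices represent themselves, so of two vertices with the same rank one
      is not kept. Its class then contains three kept vertices.\<close>
    have "\<not> kept n ?g u \<or> \<not> kept n ?g v"
      using kv(2)[of u] kv(2)[of v] uv by (auto simp: least_twin_def)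
    then obtain x where x: "x < n" "\<not> kept n ?g x" "twin {..<n} E u x"
      using tw[OF uv(1-3)] uv twin_refl[of u "{..<n}" E] by auto
    obtain a b c where abc: "a \<noteq> b" "a \<noteq> c" "b \<noteq> c"
      and in_K: "\<forall>d\<in>{a, b, c}. d < n \<and> twin {..<n} E d x \<and> kept n ?g d"
      using three_elements[OF not_kept_twins[OF x(1,2)]]
      by (smt (verit, del_insts) insertE mem_Collect_eq singletonD)
    have "rank n ?g d \<in> ?W" "kernel_verts n E ! rank n ?g d = d" "twin {..<n} E u d" if "d \<in> {a, b, c}" for d
    proof -
      have d: "d < n" "twin {..<n} E d x" "kept n ?g d" using in_K that by auto
      show "rank n ?g d \<in> ?W" "kernel_verts n E ! rank n ?g d = d"
        using kv[OF d(1)] d(3) by (auto simp: least_twin_def)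
      show "twin {..<n} E u d" using twin_trans[OF x(3) twin_sym[OF d(2)]] .
    qed
    note d = this
    have in_abc: "a \<in> {a, b, c}" "b \<in> {a, b, c}" "c \<in> {a, b, c}" by blast+
    note da = d[OF in_abc(1)] and db = d[OF in_abc(2)] and dc = d[OF in_abc(3)]
    have "rank n ?g a \<noteq> rank n ?g b" "rank n ?g a \<noteq> rank n ?g c" "rank n ?g b \<noteq> rank n ?g c"
      using abc da(2) db(2) dc(2) by metis+
    then show ?thesis using da db dc by metis
  qed
  show "kernel_verts n E ! rank n ?g v \<le> v" if "v < n" for v
    using kv(2)[OF that] least_twin(2)[OF that, of E] by simp
qed

lemma kept_iff_nth_rank:
  assumes "v < n"
  shows "kept n (\<lambda>i j. {i, j} \<in> E) v \<longleftrightarrow> kernel_verts n E ! rank n (\<lambda>i j. {i, j} \<in> E) v = v"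
  using kernel_verts_rank(2)[OF assms, of E] least_twin(3)[OF assms, of E] by (auto simp: least_twin_def)

text \<open>Shows that the minimum defining \<open>nd\<close> is attained, and bounds it by the
  number of vertices.\<close>

lemma singletons_decomposition: "neighborhood_decomposition V E ((\<lambda>v. {v}) ` V)"
  by (auto simp: neighborhood_decomposition_def partition_on_def disjoint_def graph_module_def clique_def)

lemma nd_le_card: "nd V E \<le> card V"
proof -
  have "card ((\<lambda>v. {v}) ` V) = card V" by (simp add: card_image)
  then show ?thesis
    unfolding nd_def using singletons_decomposition by (intro Least_le) blast
qed

lemma nd_decomposition:
  obtains \<P> where "neighborhood_decomposition V E \<P>" "card \<P> = nd V E"
  using LeastI_ex[of "\<lambda>k. \<exists>\<P>. neighborhood_decomposition V E \<P> \<and> card \<P> = k"]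
    singletons_decomposition unfolding nd_def by metis

text \<open>Vertices outside the part cannot distinguish its members because it is a module, those
  inside because it is a clique or independent.\<close>

lemma decomposition_twins:
  assumes "neighborhood_decomposition V E \<P>" "U \<in> \<P>" "u \<in> U" "v \<in> U"
  shows "twin V E u v"
proof -
  have U: "graph_module V E U" "clique E U \<or> independent_set E U"
    using assms(1,2) by (auto simp: neighborhood_decomposition_def)
  then have "{u, w} \<in> E \<longleftrightarrow> {v, w} \<in> E" if "w \<in> V - {u, v}" for w
  proof (cases "w \<in> U")
    case True
    then show ?thesis
      using U(2) that assms(3,4) unfolding clique_def independent_set_def by (metis DiffD2 insertCI)
  next
    case False
    then show ?thesis using U(1) that assms(3,4) unfolding graph_module_def by (metis DiffD1 DiffI)
  qed
  then show ?thesis using U(1) assms(3,4) by (auto simp: twin_def graph_module_def)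
qed

lemma length_kernel_verts_le: "length (kernel_verts n E) \<le> 3 * nd {..<n} E"
proof -
  obtain \<P> where \<P>: "neighborhood_decomposition {..<n} E \<P>" "card \<P> = nd {..<n} E"
    by (rule nd_decomposition)
  then have part: "partition_on {..<n} \<P>" by (simp add: neighborhood_decomposition_def)
  let ?K = "\<lambda>U. {v \<in> U. kept n (\<lambda>i j. {i, j} \<in> E) v}"
  have "length (kernel_verts n E) = card (?K {..<n})"
    unfolding kernel_verts_def length_filter_upt by simp
  also have "?K {..<n} = (\<Union>U\<in>\<P>. ?K U)" using partition_onD1[OF part] by auto
  also have "card \<dots> \<le> (\<Sum>U\<in>\<P>. card (?K U))"
    using finite_elements[OF _ part] by (intro card_UN_le) simp
  also have "\<dots> \<le> (\<Sum>U\<in>\<P>. 3)"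
    using partition_onD1[OF part] decomposition_twins[OF \<P>(1)] by (intro sum_mono kept_twins_le) auto
  finally show ?thesis using \<P>(2) by simp
qed

section \<open>Correctness of the programs\<close>

lemma kernel_graph_in_graphs:
  assumes "G \<in> graphs"
  shows "kernel_graph G \<in> graphs"
proof -
  obtain n E where G: "G = (n, E)" by (cases G)
  interpret ordered_twin_kernel n E "{..<length (kernel_verts n E)}" "kernel_edges n E"
    "rank n (\<lambda>i j. {i, j} \<in> E)" "(!) (kernel_verts n E)"
    using assms by (intro ordered_twin_kernel) (simp add: graphs_def verts_def edges_def G)
  show ?thesis
    using graph_F by (simp add: graphs_def verts_def edges_def kernel_graph_def G)
qed

lemma kernel_data_enc_edges:
  "kernel_data (enc_edges n E) = enc_edges (length (kernel_verts n E)) (kernel_edges n E)"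
proof -
  let ?e = "enc_edges n E" and ?kv = "kernel_verts n E"
  have kept: "filter (kept n (entry ?e)) [0..<n] = ?kv"
    unfolding kernel_verts_def using kept_cong[of n "entry ?e"] entry_enc_edges
    by (intro filter_cong) auto
  have map_kv: "map f ?kv = map (\<lambda>a. f (?kv ! a)) [0..<length ?kv]" for f :: "nat \<Rightarrow> data"
    by (rule nth_equalityI) simp_all
  have "entry ?e (?kv ! a) (?kv ! b) \<longleftrightarrow> {a, b} \<in> kernel_edges n E"
    if "a < length ?kv" "b < length ?kv" for a b
    using that entry_enc_edges nth_kernel_verts(1) by (auto simp: kernel_edges_def)
  then show ?thesis
    unfolding kernel_data_def enc_edges_def[of "length ?kv"] len_enc_edges kept map_kv
    by (intro arg_cong[where f = enc_list] map_cong refl) simp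
qed

lemma kernelization_kernel_graph:
  obtains A where "\<And>is_sol. kernelization (nd_enum_problem is_sol) A kernel_graph"
proof -
  obtain A p where A: "\<And>x. \<exists>tr. runs A x (kernel_data x) tr \<and> time tr \<le> poly p (size x)"
    using polytime_program[OF polytime_kernel_data] by blast
  \<comment> \<open>A matrix for at most 3k vertices, plus the parameter of the kernel, for which
    the number of its vertices is a sufficient bound.\<close>
  define f where "f k = 3 * k * (2 * (3 * k) + 1) + 3 * k" for k :: nat
  have "polytime_nat (\<lambda>x. f (len x))"
    unfolding f_def by (intro polytime_nat_add polytime_nat_mult polytime_nat_const polytime_nat_len polytime_id)
  then obtain B q where "\<And>x. \<exists>tr. runs B x (enc_nat (f (len x))) tr \<and> time tr \<le> poly q (size x)"
    unfolding polytime_nat_def using polytime_program by blast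
  then have computable: "computable f"
    unfolding computable_def by (metis len_enc_nat)
  show thesis
  proof (rule that[of A])
    fix is_sol :: "nat set \<Rightarrow> nat set set \<Rightarrow> nat set set \<Rightarrow> bool"
    let ?Q = "nd_enum_problem is_sol"
    have run: "\<exists>tr. runs A (enc_inst ?Q G) (enc_inst ?Q (kernel_graph G)) tr \<and>
        time tr \<le> poly p (inst_size ?Q G + param ?Q G)" for G
      using A[of "enc_inst ?Q G"] poly_nat_mono[of "inst_size ?Q G" "inst_size ?Q G + param ?Q G" p]
      by (auto simp: nd_enum_problem_def kernel_data_enc_edges kernel_graph_def edges_def inst_size_def
          intro: order_trans)
    have size: "inst_size ?Q (kernel_graph G) + param ?Q (kernel_graph G) \<le> f (param ?Q G)" for G
    proof -
      let ?m = "fst (kernel_graph G)"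
      have m: "?m \<le> 3 * param ?Q G"
        using length_kernel_verts_le by (simp add: kernel_graph_def nd_enum_problem_def verts_def edges_def)
      have "inst_size ?Q (kernel_graph G) \<le> ?m * (2 * ?m + 1)"
        using size_enc_edges_le by (simp add: inst_size_def nd_enum_problem_def)
      also have "\<dots> \<le> 3 * param ?Q G * (2 * (3 * param ?Q G) + 1)"
        using m by (intro mult_mono) auto
      finally have "inst_size ?Q (kernel_graph G) \<le> 3 * param ?Q G * (2 * (3 * param ?Q G) + 1)" .
      moreover have "param ?Q (kernel_graph G) \<le> ?m"
        using nd_le_card[of "{..<?m}"] by (simp add: nd_enum_problem_def verts_def)
      ultimately show ?thesis using m by (simp add: f_def)
    qed
    show "kernelization ?Q A kernel_graph"
      unfolding kernelization_def
    proof (intro conjI exI[of _ p] exI[of _ f] ballI computable run size)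
      show "kernel_graph G \<in> instances ?Q" if "G \<in> instances ?Q" for G
        using that kernel_graph_in_graphs by (simp add: nd_enum_problem_def)
    qed
  qed
qed

lemma card_kernel_graph: "card (verts (kernel_graph G)) \<le> 3 * nd (verts G) (edges G)"
  using length_kernel_verts_le by (simp add: kernel_graph_def verts_def edges_def)

section \<open>Correctness of lifting for a fixed graph\<close>

locale graph_kernel =
  fixes n :: nat and E :: "nat set set"
  assumes graph_E: "simple_graph {..<n} E"
begin

abbreviation m where "m \<equiv> length (kernel_verts n E)"
abbreviation H where "H \<equiv> kernel_edges n E"
abbreviation rk where "rk \<equiv> rank n (\<lambda>i j. {i, j} \<in> E)"
abbreviation kv where "kv \<equiv> (!) (kernel_verts n E)"

sublocale ordered_twin_kernel n E "{..<m}" H rk kv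
  by (rule ordered_twin_kernel[OF graph_E])

lemma rank_enc_edges: "v < n \<Longrightarrow> rank n (entry (enc_edges n E)) v = rk v"
  by (intro rank_cong entry_enc_edges)

lemma kept_enc_edges: "v < n \<Longrightarrow> kept n (entry (enc_edges n E)) v \<longleftrightarrow> kept_vertex v"
  using kept_cong[of n "entry (enc_edges n E)", OF entry_enc_edges] kept_iff_nth_rank
  by (simp add: kept_vertex_def)

lemma touched_enc_edges:
  assumes "M \<subseteq> H" "a < m"
  shows "touched (enc_edges m M) a \<longleftrightarrow> a \<in> \<Union>M"
proof
  assume "touched (enc_edges m M) a"
  then show "a \<in> \<Union>M" using assms(2) entry_enc_edges by (auto simp: touched_def)
next
  assume "a \<in> \<Union>M"
  then obtain e where e: "e \<in> M" "a \<in> e" by blast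
  then obtain u v where "e = {u, v}" "u < m" "v < m"
    using simple_graph_edgeE[OF graph_F] assms(1) by (metis lessThan_iff subsetD)
  with e obtain b where "b < m" "{a, b} \<in> M" by (auto simp: insert_commute)
  then show "touched (enc_edges m M) a" using assms(2) entry_enc_edges by (auto simp: touched_def)
qed

lemma lift_data_enc_edges:
  assumes "sect \<sigma>" "M \<subseteq> H" "\<And>i. i < n \<Longrightarrow> act i \<longleftrightarrow> \<sigma> (rk i) = i"
  shows "lift_data (enc_edges n E) (enc_edges m M) act = enc_edges n (lift \<sigma> M)"
proof -
  have "(act i \<and> act j \<and> entry (enc_edges m M) (rank n (entry (enc_edges n E)) i) (rank n (entry (enc_edges n E)) j))
    \<longleftrightarrow> {i, j} \<in> lift \<sigma> M" if "i < n" "j < n" for i j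
    using lift_edge_iff[OF assms(1,2), of i j] r_in[of i] r_in[of j] assms(3) that
    by (auto simp: rank_enc_edges entry_enc_edges)
  then show ?thesis
    unfolding lift_data_def enc_edges_def[of n "lift \<sigma> M"] len_enc_edges
    by (intro arg_cong[where f = enc_list] map_cong refl) simp
qed

text \<open>The fibres are formed among all matching cuts; by the first hypothesis a fibre over a
  solution consists of solutions. It is nonempty because it contains the lift along the kept
  vertices.\<close>

lemma solution_partition_contract:
  assumes "\<And>M. is_sol {..<n} E M \<longleftrightarrow> matching_cut {..<n} E M \<and> is_sol {..<m} H (contract M)"
    and "\<And>M. is_sol {..<m} H M \<Longrightarrow> matching_cut {..<m} H M"
  shows "solution_partition (nd_enum_problem is_sol) (n, E) (kernel_graph (n, E))
    (\<lambda>M. {N. matching_cut {..<n} E N \<and> contract N = M})"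
proof -
  let ?S = "\<lambda>M. {N. matching_cut {..<n} E N \<and> contract N = M}"
  have Sol: "Sol (nd_enum_problem is_sol) (n, E) = {M. is_sol {..<n} E M}"
    "Sol (nd_enum_problem is_sol) (kernel_graph (n, E)) = {M. is_sol {..<m} H M}"
    by (simp_all add: nd_enum_problem_def verts_def edges_def kernel_graph_def)
  have "lift kv M \<in> ?S M" if "is_sol {..<m} H M" for M
    using contract_lift[OF sect_\<iota>] lift_matching_cut[OF sect_\<iota>] assms(2)[OF that] by simp
  then have "\<forall>M\<in>{M. is_sol {..<m} H M}. ?S M \<noteq> {}" by blast
  moreover have "disjoint_family_on ?S {M. is_sol {..<m} H M}"
    unfolding disjoint_family_on_def by blast
  moreover have "(\<Union>M\<in>{M. is_sol {..<m} H M}. ?S M) = {M. is_sol {..<n} E M}"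
    using assms(1) by blast
  ultimately show ?thesis unfolding solution_partition_def Sol by blast
qed

definition minimal_fibre :: "nat set set \<Rightarrow> nat set set list" where
  "minimal_fibre M = lift kv M # map (\<lambda>v. lift (kv(rk v := v)) M)
    (filter (\<lambda>v. \<not> kept_vertex v \<and> rk v \<in> \<Union>M) [0..<n])"

lemma sect_upd: "v < n \<Longrightarrow> sect (kv(rk v := v))"
  using sect_\<iota> by (auto simp: sect_def)

lemma minimal_lifts_enc:
  assumes M: "M \<subseteq> H"
  shows "minimal_lifts (Pair (enc_edges n E) (Pair y (enc_edges m M))) =
    enc_list (map (enc_edges n) (minimal_fibre M))"
proof -
  let ?e = "enc_edges n E" and ?s = "enc_edges m M"
  have "lift_data ?e ?s (\<lambda>i. kept n (entry ?e) i) = enc_edges n (lift kv M)"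
    by (rule lift_data_enc_edges[OF sect_\<iota> M]) (simp add: kept_enc_edges kept_vertex_def)
  moreover have "lift_data ?e ?s (\<lambda>i. (rank n (entry ?e) i = rank n (entry ?e) v \<longrightarrow> i = v) \<and>
      (rank n (entry ?e) i \<noteq> rank n (entry ?e) v \<longrightarrow> kept n (entry ?e) i)) =
      enc_edges n (lift (kv(rk v := v)) M)" if "v < n" for v
    by (rule lift_data_enc_edges[OF sect_upd[OF that] M])
      (use that in \<open>auto simp: kept_enc_edges kept_vertex_def rank_enc_edges\<close>)
  moreover have "filter (\<lambda>v. \<not> kept n (entry ?e) v \<and> touched ?s (rank n (entry ?e) v)) [0..<n] =
      filter (\<lambda>v. \<not> kept_vertex v \<and> rk v \<in> \<Union>M) [0..<n]"
    using r_in by (intro filter_cong refl) (simp add: kept_enc_edges rank_enc_edges touched_enc_edges[OF M])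
  ultimately show ?thesis
    unfolding minimal_lifts_def minimal_fibre_def
    by (simp, intro arg_cong[where f = enc_list] map_cong refl) simp
qed

lemma distinct_minimal_fibre:
  assumes M: "M \<subseteq> H"
  shows "distinct (minimal_fibre M)"
proof -
  \<comment> \<open>The lift that moves a fibre to \<open>v\<close> touches \<open>v\<close>, while
    no other section in the list has \<open>v\<close> in its range.\<close>
  have own: "v \<in> \<Union>(lift (kv(rk v := v)) M)" if "v < n" "rk v \<in> \<Union>M" for v
    using lift_incident[OF sect_upd[OF that(1)] M that(2)] by simp
  have "lift (kv(rk v := v)) M \<noteq> lift kv M" if "v < n" "rk v \<in> \<Union>M" "\<not> kept_vertex v" for v
    using own[OF that(1,2)] lift_incidentD[OF sect_\<iota> M, of v] that(3) unfolding kept_vertex_def by metis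
  moreover have "u = v" if "u < n" "v < n" "rk v \<in> \<Union>M" "\<not> kept_vertex v"
    "lift (kv(rk u := u)) M = lift (kv(rk v := v)) M" for u v
  proof -
    have "v \<in> \<Union>(lift (kv(rk u := u)) M)" using own[OF that(2,3)] that(5) by metis
    from lift_incidentD[OF sect_upd[OF that(1)] M this] that(4) show ?thesis
      unfolding kept_vertex_def fun_upd_apply by (metis (full_types))
  qed
  ultimately show ?thesis
    by (auto simp: minimal_fibre_def distinct_map inj_on_def)
qed

lemma set_minimal_fibre:
  assumes "minimal_matching_cut {..<m} H M"
  shows "set (minimal_fibre M) = {N. matching_cut {..<n} E N \<and> contract N = M}"
  unfolding minimal_contract_fibre[OF assms] by (auto simp: minimal_fibre_def kept_vertex_def)

definition fibre :: "nat set set \<Rightarrow> nat set set list" where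
  "fibre M = map (\<lambda>bs. lift (selected bs) M) (selections M)"

lemma distinct_fibre: "M \<subseteq> H \<Longrightarrow> distinct (fibre M)"
  using inj_lift_selections distinct_bit_lists by (simp add: fibre_def distinct_map selections_def)

lemma set_fibre:
  assumes "matching_cut {..<m} H M"
  shows "set (fibre M) = {N. matching_cut {..<n} E N \<and> contract N = M}"
  using set_lift_selections[OF matching_cut_subset[OF assms]] contract_fibre[OF assms]
  by (simp add: fibre_def)

lemma taken_enc_edges:
  assumes "Suc j + length bs = n"
  shows "taken (enc_edges n E) j (enc_list (map enc_bool bs)) \<longleftrightarrow> suffix_taken j bs"
  using assms rank_enc_edges bit_enc_list[of _ bs] by (auto simp: taken_def suffix_taken_def)

lemma enum_tree_lift_tree:
  assumes M: "M \<subseteq> H"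
  shows "enum_tree lift_tree (enc_nat n) Leaf (Pair (enc_edges n E) (Pair y (enc_edges m M))) =
    map (enc_edges n) (fibre M)"
proof -
  let ?e = "enc_edges n E" and ?s = "enc_edges m M"
  let ?x = "Pair ?e (Pair y ?s)"
  let ?z = "\<lambda>j bs. Pair (Pair Leaf (enc_nat j)) (Pair (enc_list (map enc_bool bs)) ?x)"
  let ?br = "\<lambda>j bs. \<not> kept_vertex j \<and> rk j \<in> \<Union>M \<and> \<not> suffix_taken j bs"
  let ?fc = "\<lambda>j bs. kept_vertex j \<and> \<not> suffix_taken j bs"
  have step: "left (lift_tree (?z j bs)) \<noteq> Leaf \<longleftrightarrow> ?br j bs" "right (lift_tree (?z j bs)) = enc_bool (?fc j bs)"
    if "Suc j + length bs = n" for j bs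
    using that r_in[of j] taken_enc_edges[OF that]
    by (simp_all add: lift_tree_def lift_step_def kept_enc_edges rank_enc_edges touched_enc_edges[OF M])
  have "enum_tree lift_tree (enc_nat n) (enc_list (map enc_bool [])) ?x =
      map (\<lambda>bs. lift_tree (Pair Leaf (Pair (enc_list (map enc_bool bs)) ?x))) (selections M)"
    unfolding selections_def by (rule enum_tree_bit_lists[where N = n]) (use step in auto)
  also have "\<dots> = map (enc_edges n) (fibre M)"
  proof -
    have "lift_tree (Pair Leaf (Pair (enc_list (map enc_bool bs)) ?x)) = enc_edges n (lift (selected bs) M)"
      if bs: "bs \<in> set (selections M)" for bs
    proof -
      have "length bs = n" using bs by (simp add: selections_iff)
      then show ?thesis
        using lift_data_enc_edges[OF sect_selected[OF bs] M, of "bit_at (enc_list (map enc_bool bs))"]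
          nth_selections[OF bs] bit_enc_list[of _ bs] by (simp add: lift_tree_def)
    qed
    then show ?thesis by (simp add: fibre_def)
  qed
  finally show ?thesis by simp
qed

end

text \<open>With L the size available to the lifting algorithm, both instances take at most L, the
  cut at most L(2L + 1) and the two pairings 2, in total 2 + 2L + 2L*L.\<close>

lemma lift_input_size:
  fixes is_sol
  defines "Q \<equiv> nd_enum_problem is_sol"
  shows "size (lift_input Q x y s) \<le> poly [:2, 2, 2:] (lift_size Q x y)"
proof -
  have "size (enc_sol Q y s) \<le> fst y * (2 * fst y + 1)"
    using size_enc_edges_le by (simp add: Q_def nd_enum_problem_def)
  also have "\<dots> \<le> lift_size Q x y * (2 * lift_size Q x y + 1)"
  proof -
    have "fst y \<le> lift_size Q x y"
      using size_enc_edges_ge[of "fst y" "edges y"]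
      by (simp add: lift_size_def inst_size_def Q_def nd_enum_problem_def)
    then show ?thesis by (intro mult_mono) auto
  qed
  finally have "size (enc_sol Q y s) \<le> lift_size Q x y * (2 * lift_size Q x y + 1)" .
  moreover have "inst_size Q x + inst_size Q y \<le> lift_size Q x y" by (simp add: lift_size_def)
  ultimately show ?thesis
    by (simp add: lift_input_def inst_size_def algebra_simps)
qed

section \<open>Assembly of the enumeration kernels\<close>

lemma delay_at_most_mono: "delay_at_most c tr \<Longrightarrow> c \<le> d \<Longrightarrow> delay_at_most d tr"
  unfolding delay_at_most_def using le_trans by blast

text \<open>The hypothesis \<open>sol\<close> says that a matching cut can be judged by its
  contraction. In this form the construction covers all matching cuts and the maximal ones
  alike.\<close>

lemma polynomial_delay_kernel:
  assumes sol: "\<And>n E M. simple_graph {..<n} E \<Longrightarrow> is_sol {..<n} E M \<longleftrightarrow>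
      matching_cut {..<n} E M \<and>
      is_sol {..<length (kernel_verts n E)} (kernel_edges n E)
        (twin_kernel.contract (rank n (\<lambda>i j. {i, j} \<in> E)) M)"
    and sol_mc: "\<And>V E M. is_sol V E M \<Longrightarrow> matching_cut V E M"
  obtains A A' where "polynomial_delay_enum_kernel (nd_enum_problem is_sol) A A' kernel_graph"
proof -
  let ?Q = "nd_enum_problem is_sol"
  \<comment> \<open>The root of the traversal: one level per vertex of the graph, no bits decided,
    and the whole input as parameter.\<close>
  let ?g = "\<lambda>x. Pair (enc_nat (len (left x))) (Pair Leaf x)"
  have bit: "size (right (lift_tree (Pair (Pair a b) y))) \<le> 1" for a b y
    using size_enc_bool by (simp add: lift_tree_def lift_step_def)
  have "polytime ?g" by (intro polytime_intros)
  then obtain A' p where A': "\<And>x. \<exists>res tr. runs A' x res tr \<and>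
      outputs tr = enum_tree lift_tree (left (?g x)) (left (right (?g x))) (right (right (?g x))) \<and>
      delay_at_most (poly p (size x)) tr"
    using enum_tree_program[OF polytime_lift_tree _ bit, of ?g] by blast
  obtain A where A: "kernelization ?Q A kernel_graph" using kernelization_kernel_graph by metis
  show thesis
  proof (rule that[of A A'], unfold polynomial_delay_enum_kernel_def, intro conjI A exI[of _ "pcompose p [:2, 2, 2:]"] ballI)
    fix G assume "G \<in> instances ?Q"
    then obtain n E where G: "G = (n, E)" "simple_graph {..<n} E"
      by (cases G) (auto simp: nd_enum_problem_def graphs_def verts_def edges_def)
    interpret graph_kernel n E by standard (rule G(2))
    show "\<exists>S. solution_partition ?Q G (kernel_graph G) S \<and>
        (\<forall>M\<in>Sol ?Q (kernel_graph G). \<exists>zs res tr. distinct zs \<and> set zs = S M \<and>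
          runs A' (lift_input ?Q G (kernel_graph G) M) res tr \<and> outputs tr = map (enc_sol ?Q G) zs \<and>
          delay_at_most (poly (pcompose p [:2, 2, 2:]) (lift_size ?Q G (kernel_graph G))) tr)"
    proof (intro exI[of _ "\<lambda>M. {N. matching_cut {..<n} E N \<and> contract N = M}"] conjI ballI)
      show "solution_partition ?Q G (kernel_graph G) (\<lambda>M. {N. matching_cut {..<n} E N \<and> contract N = M})"
        unfolding G(1) by (rule solution_partition_contract[OF sol[OF graph_E] sol_mc])
      fix M assume "M \<in> Sol ?Q (kernel_graph G)"
      then have M: "matching_cut {..<m} H M"
        using sol_mc by (auto simp: nd_enum_problem_def kernel_graph_def verts_def edges_def G(1))
      note MH = matching_cut_subset[OF M]
      let ?x = "lift_input ?Q G (kernel_graph G) M"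
      let ?y = "enc_edges m H"
      have x: "?x = Pair (enc_edges n E) (Pair ?y (enc_edges m M))"
        by (simp add: lift_input_def nd_enum_problem_def kernel_graph_def edges_def G(1))
      obtain res tr where tr: "runs A' ?x res tr"
        "outputs tr = enum_tree lift_tree (enc_nat (len (left ?x))) Leaf ?x" "delay_at_most (poly p (size ?x)) tr"
        using A'[of ?x] by auto
      have "outputs tr = map (enc_sol ?Q G) (fibre M)"
        unfolding tr(2) x using enum_tree_lift_tree[OF MH] by (simp add: nd_enum_problem_def G(1))
      moreover have "delay_at_most (poly (pcompose p [:2, 2, 2:]) (lift_size ?Q G (kernel_graph G))) tr"
        using tr(3) unfolding poly_pcompose by (rule delay_at_most_mono) (intro poly_nat_mono lift_input_size)
      ultimately show "\<exists>zs res tr. distinct zs \<and> set zs = {N. matching_cut {..<n} E N \<and> contract N = M} \<and>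
          runs A' ?x res tr \<and> outputs tr = map (enc_sol ?Q G) zs \<and>
          delay_at_most (poly (pcompose p [:2, 2, 2:]) (lift_size ?Q G (kernel_graph G))) tr"
        using tr(1) distinct_fibre[OF MH] set_fibre[OF M] by blast
    qed
  qed
qed

lemma fully_polynomial_kernel:
  obtains A A' where "fully_polynomial_enum_kernel (nd_enum_problem minimal_matching_cut) A A' kernel_graph"
proof -
  let ?Q = "nd_enum_problem minimal_matching_cut"
  obtain A' p where A': "\<And>x. \<exists>tr. runs A' x (minimal_lifts x) tr \<and> time tr \<le> poly p (size x)"
    using polytime_program[OF polytime_minimal_lifts] by blast
  obtain A where A: "kernelization ?Q A kernel_graph" using kernelization_kernel_graph by metis
  show thesis
  proof (rule that[of A A'], unfold fully_polynomial_enum_kernel_def, intro conjI A exI[of _ "pcompose p [:2, 2, 2:]"] ballI)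
    fix G assume "G \<in> instances ?Q"
    then obtain n E where G: "G = (n, E)" "simple_graph {..<n} E"
      by (cases G) (auto simp: nd_enum_problem_def graphs_def verts_def edges_def)
    interpret graph_kernel n E by standard (rule G(2))
    show "\<exists>S. solution_partition ?Q G (kernel_graph G) S \<and>
        (\<forall>M\<in>Sol ?Q (kernel_graph G). \<exists>zs tr. distinct zs \<and> set zs = S M \<and>
          runs A' (lift_input ?Q G (kernel_graph G) M) (enc_list (map (enc_sol ?Q G) zs)) tr \<and>
          time tr \<le> poly (pcompose p [:2, 2, 2:]) (lift_size ?Q G (kernel_graph G)))"
    proof (intro exI[of _ "\<lambda>M. {N. matching_cut {..<n} E N \<and> contract N = M}"] conjI ballI)
      show "solution_partition ?Q G (kernel_graph G) (\<lambda>M. {N. matching_cut {..<n} E N \<and> contract N = M})"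
        unfolding G(1)
        by (rule solution_partition_contract)
          (use minimal_matching_cut_contract in \<open>auto simp: minimal_matching_cut_def[of "{..<n}"] minimal_matching_cut_def[of "{..<m}"]\<close>)
      fix M assume "M \<in> Sol ?Q (kernel_graph G)"
      then have M: "minimal_matching_cut {..<m} H M"
        by (auto simp: nd_enum_problem_def kernel_graph_def verts_def edges_def G(1))
      then have MH: "M \<subseteq> H" using matching_cut_subset by (auto simp: minimal_matching_cut_def)
      let ?x = "lift_input ?Q G (kernel_graph G) M"
      let ?y = "enc_edges m H"
      have x: "?x = Pair (enc_edges n E) (Pair ?y (enc_edges m M))"
        by (simp add: lift_input_def nd_enum_problem_def kernel_graph_def edges_def G(1))
      obtain tr where tr: "runs A' ?x (minimal_lifts ?x) tr" "time tr \<le> poly p (size ?x)"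
        using A' by blast
      have out: "minimal_lifts ?x = enc_list (map (enc_sol ?Q G) (minimal_fibre M))"
        unfolding x using minimal_lifts_enc[OF MH] by (simp add: nd_enum_problem_def G(1))
      have "poly p (size ?x) \<le> poly (pcompose p [:2, 2, 2:]) (lift_size ?Q G (kernel_graph G))"
        unfolding poly_pcompose by (intro poly_nat_mono lift_input_size)
      with tr(2) have "time tr \<le> poly (pcompose p [:2, 2, 2:]) (lift_size ?Q G (kernel_graph G))"
        by (rule order_trans)
      then show "\<exists>zs tr. distinct zs \<and> set zs = {N. matching_cut {..<n} E N \<and> contract N = M} \<and>
          runs A' ?x (enc_list (map (enc_sol ?Q G) zs)) tr \<and>
          time tr \<le> poly (pcompose p [:2, 2, 2:]) (lift_size ?Q G (kernel_graph G))"
        using tr(1)[unfolded out] distinct_minimal_fibre[OF MH] set_minimal_fibre[OF M] by blast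
    qed
  qed
qed

theorem theorem22:
  shows "(\<exists>A A' K. fully_polynomial_enum_kernel enum_minimal_mc A A' K \<and>
            (\<forall>G\<in>graphs. card (verts (K G)) \<le> 3 * nd (verts G) (edges G)))
       \<and> (\<exists>A A' K. polynomial_delay_enum_kernel enum_mc A A' K \<and>
            (\<forall>G\<in>graphs. card (verts (K G)) \<le> 3 * nd (verts G) (edges G)))
       \<and> (\<exists>A A' K. polynomial_delay_enum_kernel enum_maximal_mc A A' K \<and>
            (\<forall>G\<in>graphs. card (verts (K G)) \<le> 3 * nd (verts G) (edges G)))"
proof -
  have mc: "matching_cut {..<n} E M \<longleftrightarrow> matching_cut {..<n} E M \<and>
      matching_cut {..<length (kernel_verts n E)} (kernel_edges n E)
        (twin_kernel.contract (rank n (\<lambda>i j. {i, j} \<in> E)) M)"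
    and max: "maximal_matching_cut {..<n} E M \<longleftrightarrow> matching_cut {..<n} E M \<and>
      maximal_matching_cut {..<length (kernel_verts n E)} (kernel_edges n E)
        (twin_kernel.contract (rank n (\<lambda>i j. {i, j} \<in> E)) M)"
    if "simple_graph {..<n} E" for n E M
  proof -
    interpret graph_kernel n E by standard (rule that)
    show "matching_cut {..<n} E M \<longleftrightarrow> matching_cut {..<n} E M \<and> matching_cut {..<m} H (contract M)"
      using contract_matching_cut by blast
    show "maximal_matching_cut {..<n} E M \<longleftrightarrow>
        matching_cut {..<n} E M \<and> maximal_matching_cut {..<m} H (contract M)"
      using maximal_matching_cut_contract by (auto simp: maximal_matching_cut_def[of "{..<n}"])
  qed
  have max_mc: "matching_cut V E M" if "maximal_matching_cut V E M" for V :: "nat set" and E M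
    using that by (simp add: maximal_matching_cut_def)
  obtain A1 A1' where "fully_polynomial_enum_kernel enum_minimal_mc A1 A1' kernel_graph"
    unfolding enum_minimal_mc_def by (rule fully_polynomial_kernel)
  moreover obtain A2 A2' where "polynomial_delay_enum_kernel enum_mc A2 A2' kernel_graph"
    unfolding enum_mc_def by (rule polynomial_delay_kernel[OF mc]) auto
  moreover obtain A3 A3' where "polynomial_delay_enum_kernel enum_maximal_mc A3 A3' kernel_graph"
    unfolding enum_maximal_mc_def by (rule polynomial_delay_kernel[OF max max_mc])
  ultimately show ?thesis using card_kernel_graph by blast
qed

end
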